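(* Let $G$ be a torsion-free abelian group of finite rank and $k$ a field. (1) If $G$ is finite free (i.e. $G\cong\mathbb{Z}^n$ for some $n$), then there is only one class in $H^2_S(G,k^* )$, namely $0$, and it is a Noetherian class. If $G$ is not finitely generated, then $0$ is not a Noetherian class. (2) Suppose $k=k_0(\alpha_i: i\in\mathbb{N})$ is a purely transcendental extension, in countably many indeterminates $\alpha_i$, of a field $k_0$ of characteristic $0$. Then $H^2_S(G,k^* )$ contains at least one Noetherian class, and if $G$ is not finite free, then a Noetherian class cannot be the $0$ class.
   Context: The rank of $G$ is $\dim_{\mathbb{Q}}(\mathbb{Q}\otimes_{\mathbb{Z}}G)$. For an abelian group $A$ (written additively) with trivial $G$-action, $Z^2(G,A)$ is the group of functions $\varphi:G\times G\to A$ with $\varphi(g,h)-\varphi(f+g,h)+\varphi(f,g+h)-\varphi(f,g)=0$ for all $f,g,h\in G$; $B^2(G,A)\subset Z^2(G,A)$ is the subgroup of functions $(f,g)\mapsto\beta(g)-\beta(f+g)+\beta(f)$ with $\beta:G\to A$ any function. $Z^2_S(G,A)$ and $B^2_S(G,A)$ are the subgroups of those $\varphi$ in $Z^2(G,A)$, respectively $B^2(G,A)$, with $\varphi(g,h)=\varphi(h,g)$ for all $g,h$, and $H^2_S(G,A)=Z^2_S(G,A)/B^2_S(G,A)$. Here $A=k^*$ is the multiplicative group of $k$ with trivial $G$-action; the class $0$ is that of the constant cocycle $1$. For $c\in H^2_S(G,k^* )$ represented by $\tilde c\in Z^2_S(G,k^* )$, $k[G,c]$ is the commutative $G$-graded ring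 $\bigoplus_{g\in G}kx_g$ with $k$-bilinear multiplication $x_gx_h=\tilde c(g,h)x_{g+h}$; up to isomorphism it depends only on $c$. A class $c$ is Noetherian if $k[G,c]$ is a Noetherian ring. *)

theory Defs
  imports
    "HOL-Library.Poly_Mapping"
    "HOL-Computational_Algebra.Group_Closure"
    "HOL-Algebra.Ring_Divisibility"
    "HOL-Algebra.Generated_Fields"
    "HOL-Algebra.Algebraic_Closure_Type"
begin

section \<open>Torsion-free abelian groups of finite rank\<close>

definition torsion_free :: "'g::ab_group_add itself \<Rightarrow> bool" where
  "torsion_free _ \<longleftrightarrow> (\<forall>n>0. \<forall>g::'g. (\<Sum>i<(n::nat). g) = 0 \<longrightarrow> g = 0)"

definition finitely_generated :: "'g::ab_group_add itself \<Rightarrow> bool" where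
  "finitely_generated _ \<longleftrightarrow> (\<exists>S::'g set. finite S \<and> group_closure S = UNIV)"

text \<open>The group \<open>\<int>\<^sup>n\<close> is the set of integer sequences vanishing from index \<open>n\<close> on.\<close>

definition finite_free :: "'g::ab_group_add itself \<Rightarrow> bool" where
  "finite_free _ \<longleftrightarrow>
     (\<exists>(n::nat) (f :: 'g \<Rightarrow> nat \<Rightarrow> int).
        bij_betw f UNIV {v. \<forall>i\<ge>n. v i = 0} \<and>
        (\<forall>a b. f (a + b) = (\<lambda>i. f a i + f b i)))"

text \<open>
  The tensor product of \<open>\<rat>\<close> and \<open>G\<close> over \<open>\<int>\<close> is the free abelian group on the set of pairs
  \<open>(q, g)\<close>, modulo the subgroup generated by the biadditivity relations. Compatibility with
  integer scalars follows from biadditivity.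
\<close>

definition tensor_relations :: "((rat \<times> 'g::ab_group_add) \<Rightarrow>\<^sub>0 int) set" where
  "tensor_relations =
     {frag_of (q + r, g) - frag_of (q, g) - frag_of (r, g) | q r g. True} \<union>
     {frag_of (q, g + h) - frag_of (q, g) - frag_of (q, h) | q g h. True}"

quotient_type (overloaded) 'g rat_tensor = "(rat \<times> 'g::ab_group_add) \<Rightarrow>\<^sub>0 int" /
  "\<lambda>x y. x - y \<in> group_closure tensor_relations"
proof (rule equivpI)
  let ?N = "group_closure tensor_relations :: ((rat \<times> 'g) \<Rightarrow>\<^sub>0 int) set"
  show "reflp (\<lambda>x y. x - y \<in> ?N)"
    by (simp add: reflp_def)
  show "symp (\<lambda>x y. x - y \<in> ?N)"
  proof (rule sympI)
    fix x y assume "x - y \<in> ?N"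
    then have "- (x - y) \<in> ?N" by (simp only: group_closure_minus_iff)
    then show "y - x \<in> ?N" by simp
  qed
  show "transp (\<lambda>x y. x - y \<in> ?N)"
  proof (rule transpI)
    fix x y z assume "x - y \<in> ?N" "y - z \<in> ?N"
    then have "(x - y) + (y - z) \<in> ?N" by (rule group_closure_add)
    then show "x - z \<in> ?N" by simp
  qed
qed

instantiation rat_tensor :: (ab_group_add) ab_group_add
begin

lift_definition zero_rat_tensor :: "'a rat_tensor" is 0 .

lift_definition plus_rat_tensor :: "'a rat_tensor \<Rightarrow> 'a rat_tensor \<Rightarrow> 'a rat_tensor" is "(+)"
  by (metis add_diff_add group_closure_add)

lift_definition minus_rat_tensor :: "'a rat_tensor \<Rightarrow> 'a rat_tensor \<Rightarrow> 'a rat_tensor" is "(-)"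
proof -
  fix x x' y y' :: "(rat \<times> 'a) \<Rightarrow>\<^sub>0 int"
  assume "x - x' \<in> group_closure tensor_relations" "y - y' \<in> group_closure tensor_relations"
  then have "(x - x') - (y - y') \<in> group_closure tensor_relations"
    by (rule group_closure.diff)
  then show "x - y - (x' - y') \<in> group_closure tensor_relations"
    by (simp add: algebra_simps)
qed

lift_definition uminus_rat_tensor :: "'a rat_tensor \<Rightarrow> 'a rat_tensor" is uminus
  by (simp only: minus_diff_minus group_closure_minus_iff)

instance
  by standard (transfer; simp add: algebra_simps)+

end

text \<open>Scalar multiplication by \<open>q\<close> is induced by \<open>(r, g) \<mapsto> (q * r, g)\<close>.\<close>

abbreviation tensor_scale_frag ::
  "rat \<Rightarrow> ((rat \<times> 'g) \<Rightarrow>\<^sub>0 int) \<Rightarrow> ((rat \<times> 'g) \<Rightarrow>\<^sub>0 int)" where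
  "tensor_scale_frag q \<equiv> frag_extend (\<lambda>(r, g). frag_of (q * r, g))"

lemma tensor_scale_relations:
  assumes "x \<in> group_closure tensor_relations"
  shows "tensor_scale_frag q x \<in> group_closure tensor_relations"
  using assms
proof induction
  case (base s)
  have "tensor_scale_frag q s \<in> insert 0 tensor_relations"
    using base
    unfolding tensor_relations_def
    by (elim insertE UnE; clarsimp simp: frag_extend_diff distrib_left; blast)
  then show ?case by (rule group_closure.base)
next
  case (diff s t)
  then show ?case by (simp add: frag_extend_diff group_closure.diff)
qed

lift_definition tensor_scale :: "rat \<Rightarrow> 'g::ab_group_add rat_tensor \<Rightarrow> 'g rat_tensor"
  is tensor_scale_frag
  by (metis frag_extend_diff tensor_scale_relations)

lemma tensor_scale_frag_add_left:
  "tensor_scale_frag (a + b) x - (tensor_scale_frag a x + tensor_scale_frag b x)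
     \<in> group_closure tensor_relations"
proof (induction x rule: frag_induction [OF subset_UNIV, case_names zero one diff])
  case (one x)
  obtain r g where "x = (r, g)" by fastforce
  then show ?case
    by (intro group_closure.base)
      (force simp: tensor_relations_def distrib_right diff_diff_eq [symmetric])
next
  case (diff x y)
  have "tensor_scale_frag (a + b) (x - y) -
      (tensor_scale_frag a (x - y) + tensor_scale_frag b (x - y)) =
    (tensor_scale_frag (a + b) x - (tensor_scale_frag a x + tensor_scale_frag b x)) -
    (tensor_scale_frag (a + b) y - (tensor_scale_frag a y + tensor_scale_frag b y))"
    by (simp add: frag_extend_diff algebra_simps)
  then show ?case using diff by (metis group_closure.diff)
qed auto

interpretation rat_tensor: vector_space "tensor_scale :: rat \<Rightarrow> 'g::ab_group_add rat_tensor \<Rightarrow> _"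
proof
  fix a b :: rat and x y :: "'g rat_tensor"
  show "tensor_scale a (x + y) = tensor_scale a x + tensor_scale a y"
    by transfer (simp add: frag_extend_add)
  show "tensor_scale (a + b) x = tensor_scale a x + tensor_scale b x"
    by transfer (rule tensor_scale_frag_add_left)
  show "tensor_scale a (tensor_scale b x) = tensor_scale (a * b) x"
  proof transfer
    fix a b and x :: "(rat \<times> 'g) \<Rightarrow>\<^sub>0 int"
    have "tensor_scale_frag a (tensor_scale_frag b x) = tensor_scale_frag (a * b) x"
      by (induction x rule: frag_induction[OF subset_UNIV])
         (auto simp: frag_extend_diff mult.assoc)
    then show "tensor_scale_frag a (tensor_scale_frag b x) - tensor_scale_frag (a * b) x
        \<in> group_closure tensor_relations"
      by simp
  qed
  show "tensor_scale 1 x = x"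
  proof transfer
    fix x :: "(rat \<times> 'g) \<Rightarrow>\<^sub>0 int"
    have "tensor_scale_frag 1 x = x"
      by (induction x rule: frag_induction[OF subset_UNIV]) (auto simp: frag_extend_diff)
    then show "tensor_scale_frag 1 x - x \<in> group_closure tensor_relations"
      by simp
  qed
qed

definition finite_rank :: "'g::ab_group_add itself \<Rightarrow> bool" where
  "finite_rank _ \<longleftrightarrow> (\<exists>B :: 'g rat_tensor set. finite B \<and> rat_tensor.span B = UNIV)"


section \<open>Symmetric second cohomology\<close>

text \<open>
  The coefficient group \<open>A\<close> is an abelian group in the sense of HOL-Algebra, hence written
  multiplicatively.
\<close>

definition Z2 :: "('a, 'b) monoid_scheme \<Rightarrow> ('g::ab_group_add \<Rightarrow> 'g \<Rightarrow> 'a) set" where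
  "Z2 A = {\<phi>. (\<forall>g h. \<phi> g h \<in> carrier A) \<and>
     (\<forall>f g h. \<phi> g h \<otimes>\<^bsub>A\<^esub> inv\<^bsub>A\<^esub> \<phi> (f + g) h \<otimes>\<^bsub>A\<^esub> \<phi> f (g + h) \<otimes>\<^bsub>A\<^esub> inv\<^bsub>A\<^esub> \<phi> f g = \<one>\<^bsub>A\<^esub>)}"

definition B2 :: "('a, 'b) monoid_scheme \<Rightarrow> ('g::ab_group_add \<Rightarrow> 'g \<Rightarrow> 'a) set" where
  "B2 A = {\<lambda>f g. \<beta> g \<otimes>\<^bsub>A\<^esub> inv\<^bsub>A\<^esub> \<beta> (f + g) \<otimes>\<^bsub>A\<^esub> \<beta> f | \<beta>. \<forall>g. \<beta> g \<in> carrier A}"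

definition Z2S :: "('a, 'b) monoid_scheme \<Rightarrow> ('g::ab_group_add \<Rightarrow> 'g \<Rightarrow> 'a) set" where
  "Z2S A = {\<phi> \<in> Z2 A. \<forall>g h. \<phi> g h = \<phi> h g}"

definition B2S :: "('a, 'b) monoid_scheme \<Rightarrow> ('g::ab_group_add \<Rightarrow> 'g \<Rightarrow> 'a) set" where
  "B2S A = {\<phi> \<in> B2 A. \<forall>g h. \<phi> g h = \<phi> h g}"

definition Z2S_group :: "('a, 'b) monoid_scheme \<Rightarrow> ('g::ab_group_add \<Rightarrow> 'g \<Rightarrow> 'a) monoid" where
  "Z2S_group A =
     \<lparr>carrier = Z2S A, monoid.mult = \<lambda>\<phi> \<psi> f g. \<phi> f g \<otimes>\<^bsub>A\<^esub> \<psi> f g, one = \<lambda>_ _. \<one>\<^bsub>A\<^esub>\<rparr>"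

definition H2S :: "('a, 'b) monoid_scheme \<Rightarrow> ('g::ab_group_add \<Rightarrow> 'g \<Rightarrow> 'a) set monoid" where
  "H2S A = Z2S_group A Mod B2S A"

definition kstar :: "'k::field monoid" where
  "kstar = Multiplicative_Group.mult_of ring_of_type_algebra"


section \<open>Twisted group rings\<close>

text \<open>
  The finitely supported function \<open>p\<close> stands for the sum of the \<open>p(g) x\<^sub>g\<close>. As \<open>\<phi>\<close> need not be
  normalised, the unit is the multiple \<open>\<phi>(0, 0)\<^sup>-\<^sup>1\<close> of \<open>x\<^sub>0\<close>.
\<close>

definition twisted_mult ::
  "('g::ab_group_add \<Rightarrow> 'g \<Rightarrow> 'k::field) \<Rightarrow> ('g \<Rightarrow>\<^sub>0 'k) \<Rightarrow> ('g \<Rightarrow>\<^sub>0 'k) \<Rightarrow> ('g \<Rightarrow>\<^sub>0 'k)" where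
  "twisted_mult \<phi> p q =
     (\<Sum>g \<in> Poly_Mapping.keys p. \<Sum>h \<in> Poly_Mapping.keys q.
        Poly_Mapping.single (g + h) (Poly_Mapping.lookup p g * Poly_Mapping.lookup q h * \<phi> g h))"

definition twisted_ring :: "('g::ab_group_add \<Rightarrow> 'g \<Rightarrow> 'k::field) \<Rightarrow> ('g \<Rightarrow>\<^sub>0 'k) ring" where
  "twisted_ring \<phi> =
     \<lparr>carrier = UNIV, monoid.mult = twisted_mult \<phi>,
      one = Poly_Mapping.single 0 (inverse (\<phi> 0 0)), ring.zero = 0, add = (+)\<rparr>"

text \<open>
  For \<open>c\<close> in \<open>H2S kstar\<close>, every representative gives the same answer;
  see \<open>noetherian_class_iff\<close> below.
\<close>

definition noetherian_class :: "('g::ab_group_add \<Rightarrow> 'g \<Rightarrow> 'k::field) set \<Rightarrow> bool" where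
  "noetherian_class c \<longleftrightarrow> (\<exists>\<phi>\<in>c. noetherian_ring (twisted_ring \<phi>))"

lemma carrier_kstar [simp]: "carrier kstar = - {0}"
  by (auto simp: kstar_def ring_of_type_algebra_def)

lemma mult_kstar [simp]: "x \<otimes>\<^bsub>kstar\<^esub> y = x * y"
  by (simp add: kstar_def ring_of_type_algebra_def)

lemma one_kstar [simp]: "\<one>\<^bsub>kstar\<^esub> = 1"
  by (simp add: kstar_def ring_of_type_algebra_def)

lemma group_kstar: "group kstar"
  unfolding kstar_def by (rule field.field_mult_group [OF field_from_type_algebra])

lemma inv_kstar [simp]: "x \<noteq> 0 \<Longrightarrow> inv\<^bsub>kstar\<^esub> x = inverse x"
  by (rule group.inv_equality [OF group_kstar]) auto

lemma poly_mapping_add_induct [case_names zero single add]: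
  assumes "P 0" and "\<And>g a. P (Poly_Mapping.single g a)"
    and "\<And>p q. P p \<Longrightarrow> P q \<Longrightarrow> P (p + q)"
  shows "P (p :: 'g \<Rightarrow>\<^sub>0 'k::ab_group_add)"
proof (induction p rule: update_induct)
  case const
  then show ?case using assms(1) by simp
next
  case (update p g a)
  have "Poly_Mapping.update g a p = Poly_Mapping.single g a + p"
    using update(1) by (intro poly_mapping_eqI)
      (auto simp: lookup_update lookup_add lookup_single in_keys_iff when_def)
  then show ?case using assms update by simp
qed

lemma twisted_mult_superset:
  assumes "finite P" "Poly_Mapping.keys p \<subseteq> P" "finite Q" "Poly_Mapping.keys q \<subseteq> Q"
  shows "twisted_mult \<phi> p q =
     (\<Sum>g \<in> P. \<Sum>h \<in> Q.
        Poly_Mapping.single (g + h) (Poly_Mapping.lookup p g * Poly_Mapping.lookup q h * \<phi> g h))"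
proof -
  have "(\<Sum>h \<in> Poly_Mapping.keys q.
          Poly_Mapping.single (g + h) (Poly_Mapping.lookup p g * Poly_Mapping.lookup q h * \<phi> g h)) =
        (\<Sum>h \<in> Q.
          Poly_Mapping.single (g + h) (Poly_Mapping.lookup p g * Poly_Mapping.lookup q h * \<phi> g h))"
    for g
    using assms by (intro sum.mono_neutral_left) (auto simp: in_keys_iff)
  then show ?thesis
    unfolding twisted_mult_def using assms
    by (simp, intro sum.mono_neutral_left) (auto simp: in_keys_iff)
qed

lemma twisted_mult_add_left: "twisted_mult \<phi> (p + p') q = twisted_mult \<phi> p q + twisted_mult \<phi> p' q"
proof -
  let ?P = "Poly_Mapping.keys p \<union> Poly_Mapping.keys p'"
  have "Poly_Mapping.keys (p + p') \<subseteq> ?P" by (rule keys_add)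
  then show ?thesis
    by (simp add: twisted_mult_superset [where P = ?P and Q = "Poly_Mapping.keys q"]
        lookup_add distrib_right single_add sum.distrib)
qed

lemma twisted_mult_add_right: "twisted_mult \<phi> q (p + p') = twisted_mult \<phi> q p + twisted_mult \<phi> q p'"
proof -
  let ?P = "Poly_Mapping.keys p \<union> Poly_Mapping.keys p'"
  have "Poly_Mapping.keys (p + p') \<subseteq> ?P" by (rule keys_add)
  then show ?thesis
    by (simp add: twisted_mult_superset [where Q = ?P and P = "Poly_Mapping.keys q"]
        lookup_add distrib_right distrib_left single_add sum.distrib)
qed

lemma twisted_mult_zero [simp]: "twisted_mult \<phi> 0 q = 0" "twisted_mult \<phi> p 0 = 0"
  by (simp_all add: twisted_mult_def)

lemma twisted_mult_single [simp]:
  "twisted_mult \<phi> (Poly_Mapping.single g a) (Poly_Mapping.single h b) =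
     Poly_Mapping.single (g + h) (a * b * \<phi> g h)"
  by (subst twisted_mult_superset [where P = "{g}" and Q = "{h}"]) auto

lemma Z2S_kstarD:
  assumes "\<phi> \<in> Z2S kstar"
  shows "\<phi> g h \<noteq> 0" "\<phi> g h * \<phi> f (g + h) = \<phi> (f + g) h * \<phi> f g" "\<phi> g h = \<phi> h g"
    "\<phi> 0 g = \<phi> 0 0"
proof -
  show nz: "\<phi> g h \<noteq> 0" for g h
    using assms by (auto simp: Z2S_def Z2_def)
  show "\<phi> g h = \<phi> h g"
    using assms by (auto simp: Z2S_def)
  have coc: "\<phi> g h * \<phi> f (g + h) = \<phi> (f + g) h * \<phi> f g" for f g h
  proof -
    have "\<phi> g h * inverse (\<phi> (f + g) h) * \<phi> f (g + h) * inverse (\<phi> f g) = 1"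
      using assms nz by (auto simp: Z2S_def Z2_def)
    then show ?thesis using nz by (simp add: field_simps)
  qed
  then show "\<phi> g h * \<phi> f (g + h) = \<phi> (f + g) h * \<phi> f g" .
  show "\<phi> 0 g = \<phi> 0 0"
    using coc [of 0 g 0] nz by simp
qed

lemma twisted_ring_cring:
  assumes "\<phi> \<in> Z2S kstar"
  shows "cring (twisted_ring \<phi>)"
proof -
  note \<phi> = Z2S_kstarD [OF assms]
  have comm: "twisted_mult \<phi> p q = twisted_mult \<phi> q p" for p q
    unfolding twisted_mult_def
    by (subst sum.swap) (simp add: add.commute mult.commute \<phi>(3) mult.left_commute)
  have assoc: "twisted_mult \<phi> (twisted_mult \<phi> p q) r = twisted_mult \<phi> p (twisted_mult \<phi> q r)"
    for p q r
  proof (induction p rule: poly_mapping_add_induct)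
    case single: (single f a)
    show ?case
    proof (induction q rule: poly_mapping_add_induct)
      case single: (single g b)
      show ?case
      proof (induction r rule: poly_mapping_add_induct)
        case (single h c)
        have "\<phi> f g * \<phi> (f + g) h = \<phi> g h * \<phi> f (g + h)"
          using \<phi>(2) [of g h f] by (simp add: mult.commute)
        then show ?case by (simp add: add.assoc mult_ac)
      qed (simp_all add: twisted_mult_add_right)
    qed (simp_all add: twisted_mult_add_left twisted_mult_add_right)
  qed (simp_all add: twisted_mult_add_left)
  have one: "twisted_mult \<phi> (Poly_Mapping.single 0 (inverse (\<phi> 0 0))) p = p" for p
  proof (induction p rule: poly_mapping_add_induct)
    case (single g a)
    then show ?case using \<phi>(1) [of 0 0] \<phi>(4) [of g] by (simp add: field_simps)
  qed (simp_all add: twisted_mult_add_right)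
  show ?thesis
  proof (rule cringI)
    show "abelian_group (twisted_ring \<phi>)"
      by (rule abelian_groupI) (auto simp: twisted_ring_def ac_simps intro: exI [of _ "- _"])
    show "comm_monoid (twisted_ring \<phi>)"
      by (rule comm_monoidI) (simp_all add: twisted_ring_def assoc one, rule comm)
  qed (simp add: twisted_ring_def twisted_mult_add_left)
qed

lemma noetherian_ring_iso:
  assumes "noetherian_ring R" "ring S" "h \<in> ring_iso R S"
  shows "noetherian_ring S"
proof -
  interpret R: noetherian_ring R by fact
  interpret S: ring S by fact
  interpret h: ring_hom_ring R S h
    using assms(3) by (intro ring_hom_ringI2) (auto simp: ring_iso_def R.ring_axioms S.ring_axioms)
  have bij: "h ` carrier R = carrier S"
    using assms(3) by (auto simp: ring_iso_def bij_betw_def)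
  have vimage: "ideal {r \<in> carrier R. h r \<in> I} R" if "ideal I S" for I
  proof -
    interpret I: ideal I S by fact
    show ?thesis
    proof (rule idealI)
      show "subgroup {r \<in> carrier R. h r \<in> I} (add_monoid R)"
        by (rule R.add.subgroupI) (use I.a_inv_closed I.zero_closed in \<open>auto simp flip: a_inv_def\<close>)
    qed (auto simp: R.ring_axioms I.I_l_closed I.I_r_closed)
  qed
  show ?thesis
  proof (rule S.noetherian_ringI)
    fix I assume I: "ideal I S"
    interpret I: ideal I S by fact
    obtain A where A: "A \<subseteq> carrier R" "finite A" "{r \<in> carrier R. h r \<in> I} = Idl\<^bsub>R\<^esub> A"
      using R.finetely_gen [OF vimage [OF I]] by blast
    have hA: "h ` A \<subseteq> carrier S" using A by auto
    have "Idl\<^bsub>R\<^esub> A \<subseteq> {r \<in> carrier R. h r \<in> Idl\<^bsub>S\<^esub> (h ` A)}"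
      using vimage [OF S.genideal_ideal [OF hA]] A S.genideal_self [OF hA]
      by (intro R.genideal_minimal) auto
    moreover have "h ` A \<subseteq> I"
      using A R.genideal_self by auto
    ultimately have "Idl\<^bsub>S\<^esub> (h ` A) \<subseteq> I" and
      sub: "{r \<in> carrier R. h r \<in> I} \<subseteq> {r \<in> carrier R. h r \<in> Idl\<^bsub>S\<^esub> (h ` A)}"
      using S.genideal_minimal [OF I] A(3) by simp_all
    moreover have "x \<in> Idl\<^bsub>S\<^esub> (h ` A)" if x: "x \<in> I" for x
    proof -
      obtain r where "r \<in> carrier R" "x = h r"
        using bij I.Icarr [OF x] by blast
      then show ?thesis using sub x by blast
    qed
    ultimately have "I = Idl\<^bsub>S\<^esub> (h ` A)"
      by blast
    then show "\<exists>A\<subseteq>carrier S. finite A \<and> I = Idl\<^bsub>S\<^esub> A"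
      using hA A(2) by blast
  qed
qed

text \<open>Cohomologous cocycles give isomorphic rings, by rescaling the \<open>x\<^sub>g\<close>.\<close>

lemma twisted_ring_iso:
  assumes \<phi>: "\<phi> \<in> Z2S kstar" and \<beta>: "\<And>g. \<beta> g \<noteq> 0"
    and \<psi>: "\<And>f g. \<psi> f g = \<beta> g * inverse (\<beta> (f + g)) * \<beta> f * \<phi> f g"
  shows "Poly_Mapping.mapp (\<lambda>g a. a * \<beta> g) \<in> ring_iso (twisted_ring \<psi>) (twisted_ring \<phi>)"
proof -
  define T where "T \<beta> p = Poly_Mapping.mapp (\<lambda>g a. a * \<beta> g) p" for \<beta> :: "'a \<Rightarrow> 'b" and p
  have lookup_T: "Poly_Mapping.lookup (T \<beta> p) g = Poly_Mapping.lookup p g * \<beta> g" for \<beta> p g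
    by (auto simp: T_def lookup_mapp when_def in_keys_iff)
  have T_add: "T \<beta> (p + q) = T \<beta> p + T \<beta> q" for p q
    by (rule poly_mapping_eqI) (simp add: lookup_T lookup_add distrib_right)
  have T_single: "T \<beta> (Poly_Mapping.single g a) = Poly_Mapping.single g (a * \<beta> g)" for g a
    by (rule poly_mapping_eqI) (auto simp: lookup_T lookup_single when_def)
  have T_0: "T \<beta> 0 = 0"
    by (rule poly_mapping_eqI) (simp add: lookup_T)
  have T_mult: "T \<beta> (twisted_mult \<psi> p q) = twisted_mult \<phi> (T \<beta> p) (T \<beta> q)" for p q
  proof (induction p rule: poly_mapping_add_induct)
    case single: (single f a)
    show ?case
    proof (induction q rule: poly_mapping_add_induct)
      case (single g b)
      then show ?case using \<beta> by (simp add: T_single \<psi> field_simps)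
    qed (simp_all add: twisted_mult_add_right T_add T_0)
  qed (simp_all add: twisted_mult_add_left T_add T_0)
  have "bij (T \<beta>)"
  proof (rule o_bij)
    show "T (\<lambda>g. inverse (\<beta> g)) \<circ> T \<beta> = id"
      using \<beta> by (auto simp: fun_eq_iff lookup_T intro!: poly_mapping_eqI)
    show "T \<beta> \<circ> T (\<lambda>g. inverse (\<beta> g)) = id"
      using \<beta> by (auto simp: fun_eq_iff lookup_T intro!: poly_mapping_eqI)
  qed
  moreover have "T \<beta> (Poly_Mapping.single 0 (inverse (\<psi> 0 0))) =
      Poly_Mapping.single 0 (inverse (\<phi> 0 0))"
    using \<beta> [of 0] Z2S_kstarD(1) [OF \<phi>, of 0 0] by (simp add: T_single \<psi> field_simps)
  ultimately have "T \<beta> \<in> ring_iso (twisted_ring \<psi>) (twisted_ring \<phi>)"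
    by (auto simp: ring_iso_def ring_hom_def twisted_ring_def T_add T_mult)
  then show ?thesis by (simp add: T_def [abs_def])
qed

lemma mem_H2S_kstar:
  assumes "c \<in> carrier (H2S kstar)"
  obtains \<phi> where "\<phi> \<in> Z2S kstar"
    "\<And>\<psi>. \<psi> \<in> c \<Longrightarrow> \<exists>\<beta>. (\<forall>g. \<beta> g \<noteq> 0) \<and>
       (\<forall>f g. \<psi> f g = \<beta> g * inverse (\<beta> (f + g)) * \<beta> f * \<phi> f g)"
proof -
  obtain \<phi> where \<phi>: "\<phi> \<in> Z2S kstar" "c = B2S kstar #>\<^bsub>Z2S_group kstar\<^esub> \<phi>"
    using assms by (auto simp: H2S_def carrier_FactGroup Z2S_group_def)
  have "\<exists>\<beta>. (\<forall>g. \<beta> g \<noteq> 0) \<and> (\<forall>f g. \<psi> f g = \<beta> g * inverse (\<beta> (f + g)) * \<beta> f * \<phi> f g)"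
    if "\<psi> \<in> c" for \<psi>
    using that unfolding \<phi> r_coset_def Z2S_group_def B2S_def B2_def by auto
  with \<phi> that show thesis by blast
qed

lemma noetherian_class_iff:
  assumes "c \<in> carrier (H2S kstar)" "\<phi> \<in> c"
  shows "noetherian_class c \<longleftrightarrow> noetherian_ring (twisted_ring \<phi>)"
proof -
  obtain \<phi>\<^sub>0 where \<phi>\<^sub>0: "\<phi>\<^sub>0 \<in> Z2S kstar" and c: "\<And>\<psi>. \<psi> \<in> c \<Longrightarrow> \<exists>\<beta>. (\<forall>g. \<beta> g \<noteq> 0) \<and>
       (\<forall>f g. \<psi> f g = \<beta> g * inverse (\<beta> (f + g)) * \<beta> f * \<phi>\<^sub>0 f g)"
    using mem_H2S_kstar [OF assms(1)] by metis
  have "noetherian_ring (twisted_ring \<psi>) \<longleftrightarrow> noetherian_ring (twisted_ring \<phi>\<^sub>0)"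
    if \<psi>_c: "\<psi> \<in> c" for \<psi>
  proof -
    obtain \<beta> where \<beta>: "\<And>g. \<beta> g \<noteq> 0"
      and \<psi>: "\<And>f g. \<psi> f g = \<beta> g * inverse (\<beta> (f + g)) * \<beta> f * \<phi>\<^sub>0 f g"
      using c [OF \<psi>_c] by blast
    note nz = \<beta> Z2S_kstarD(1) [OF \<phi>\<^sub>0]
    have "\<psi> g h * inverse (\<psi> (f + g) h) * \<psi> f (g + h) * inverse (\<psi> f g) = 1" for f g h
    proof -
      have "\<psi> g h * \<psi> f (g + h) = \<psi> (f + g) h * \<psi> f g"
        using Z2S_kstarD(2) [OF \<phi>\<^sub>0, of g h f] nz by (simp add: \<psi> field_simps)
      moreover have "\<psi> (f + g) h \<noteq> 0" "\<psi> f g \<noteq> 0"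
        using nz by (simp_all add: \<psi>)
      ultimately show ?thesis by (simp add: field_simps)
    qed
    moreover have "\<psi> g h \<noteq> 0" for g h
      using nz by (simp add: \<psi>)
    ultimately have "\<psi> \<in> Z2 kstar"
      by (simp add: Z2_def)
    moreover have "\<psi> g h = \<psi> h g" for g h
      using Z2S_kstarD(3) [OF \<phi>\<^sub>0, of g h] by (simp add: \<psi> add.commute)
    ultimately have \<psi>Z: "\<psi> \<in> Z2S kstar"
      unfolding Z2S_def by blast
    have \<phi>\<^sub>0_eq: "\<phi>\<^sub>0 f g = inverse (\<beta> g) * inverse (inverse (\<beta> (f + g))) * inverse (\<beta> f) * \<psi> f g" for f g
      using nz by (simp add: \<psi> field_simps)
    show ?thesis
      using noetherian_ring_iso [OF _ cring.axioms(1) [OF twisted_ring_cring [OF \<phi>\<^sub>0]]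
          twisted_ring_iso [OF \<phi>\<^sub>0 \<beta> \<psi>]]
        noetherian_ring_iso [OF _ cring.axioms(1) [OF twisted_ring_cring [OF \<psi>Z]]
          twisted_ring_iso [OF \<psi>Z _ \<phi>\<^sub>0_eq]] \<beta>
      by auto
  qed
  then show ?thesis
    using assms(2) by (auto simp: noetherian_class_def)
qed


section \<open>Purely transcendental extensions\<close>

text \<open>
  A polynomial over \<open>k\<close> in indeterminates indexed by \<open>\<nat>\<close> maps monomials, which are finitely
  supported exponent functions, to coefficients. A subfield \<open>K\<close> of \<open>k\<close> shares the unit of \<open>k\<close>,
  so its characteristic is \<open>CHAR('k)\<close>.
\<close>

definition poly_eval :: "(nat \<Rightarrow> 'k) \<Rightarrow> ((nat \<Rightarrow>\<^sub>0 nat) \<Rightarrow>\<^sub>0 'k) \<Rightarrow> 'k::field" where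
  "poly_eval \<alpha> p =
     (\<Sum>m \<in> Poly_Mapping.keys p.
        Poly_Mapping.lookup p m *
        (\<Prod>i \<in> Poly_Mapping.keys m. \<alpha> i ^ Poly_Mapping.lookup m i))"

definition algebraically_independent :: "'k::field set \<Rightarrow> (nat \<Rightarrow> 'k) \<Rightarrow> bool" where
  "algebraically_independent K \<alpha> \<longleftrightarrow>
     (\<forall>p. range (Poly_Mapping.lookup p) \<subseteq> K \<and> poly_eval \<alpha> p = 0 \<longrightarrow> p = 0)"

definition purely_transcendental_over :: "'k::field set \<Rightarrow> (nat \<Rightarrow> 'k) \<Rightarrow> bool" where
  "purely_transcendental_over K \<alpha> \<longleftrightarrow>
     subfield K ring_of_type_algebra \<and>
     algebraically_independent K \<alpha> \<and>
     generate_field ring_of_type_algebra (K \<union> range \<alpha>) = UNIV"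

end

theory Submission
  imports Defs "HOL-Library.Nat_Bijection"
begin

text \<open>
  If finitely many elements generate the augmentation ideal of \<open>k[G]\<close>, then their supports generate
  \<open>G\<close>; conversely Laurent polynomial rings are Noetherian by the Hilbert basis theorem.

  For the second part, \<open>G\<close> embeds into \<open>\<rat>\<^sup>n\<close>, and it suffices to find a Noetherian twisted group ring
  \<open>R\<close> of \<open>\<rat>\<^sup>n\<close>, since that of \<open>G\<close> is a retract of it. Exhaust \<open>\<rat>\<^sup>n\<close> by lattices, one root of one
  generator at a time, and let the new generator \<open>y\<close> satisfy \<open>y\<^sup>p = \<alpha>\<^sub>m u\<close> with \<open>u\<close> the old generator
  and \<open>\<alpha>\<^sub>m\<close> a fresh indeterminate. Let \<open>R\<^sub>m\<close> be the part of \<open>R\<close> that is defined over \<open>k\<^sub>0(\<alpha>\<^sub>i : i < m)\<close>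
  and supported on the \<open>m\<close>-th lattice. As \<open>\<alpha>\<^sub>m = y\<^sup>p u\<^sup>-\<^sup>1\<close>, the ring \<open>R\<^sub>m\<^sub>+\<^sub>1\<close> is a localisation of the
  polynomial ring \<open>R\<^sub>m[y]\<close>, so primes of \<open>R\<^sub>m\<close> extend to primes of \<open>R\<^sub>m\<^sub>+\<^sub>1\<close> and of \<open>R\<close>. Given a prime
  \<open>P\<close> of \<open>R\<close>, its contraction to \<open>\<Lambda> = k[\<int>\<^sup>n]\<close> is generated by elements of some \<open>R\<^sub>m\<close>, and then \<open>P\<close> and
  the prime generated by \<open>P \<inter> R\<^sub>m\<close> have the same contraction to \<open>\<Lambda>\<close>. They coincide because \<open>R\<close> is
  algebraic over \<open>\<Lambda>\<close>, so \<open>P\<close> is finitely generated, and \<open>R\<close> is Noetherian by Cohen's theorem.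
\<close>

section \<open>Ideals of subrings\<close>

text \<open>A union of Noetherian rings need not be Noetherian. In the untwisted group ring of
  \<rat>, adjoining a root y with y^p = u makes u - 1 decomposable, since y - 1 divides y^p - 1, and
  primes keep acquiring new generators. With a fixed coefficient field each step is an integral
  extension, and nothing prevents such splitting. Letting the coefficients grow together with the
  lattice turns the relation between y and u into a definition of the fresh indeterminate and leaves
  y transcendental over the preceding ring. This is why two rings live on each lattice:
  \<open>ring_at m\<close> with small coefficients, where primes extend to primes, and
  \<open>full_at m\<close> with all of k, which is Noetherian and finite over
  \<open>full_at 0\<close>. The former controls primes, the latter supplies finiteness. The scalars
  of the generators exist in the algebraic closure of k, so both rings are taken as subsets of one
  untwisted group ring over it, where the twisted product becomes the ordinary one. Hence rings,
  ideals and spans are treated as subsets of a single type.\<close>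

definition unital_subring :: "'r::comm_ring_1 set \<Rightarrow> bool" where
  "unital_subring A \<longleftrightarrow> 1 \<in> A \<and> (\<forall>x\<in>A. \<forall>y\<in>A. x - y \<in> A \<and> x * y \<in> A)"

definition ideal_in :: "'r::comm_ring_1 set \<Rightarrow> 'r set \<Rightarrow> bool" where
  "ideal_in A I \<longleftrightarrow>
     I \<subseteq> A \<and> 0 \<in> I \<and> (\<forall>x\<in>I. \<forall>y\<in>I. x + y \<in> I) \<and> (\<forall>r\<in>A. \<forall>x\<in>I. r * x \<in> I)"

definition prime_in :: "'r::comm_ring_1 set \<Rightarrow> 'r set \<Rightarrow> bool" where
  "prime_in A P \<longleftrightarrow>
     ideal_in A P \<and> 1 \<notin> P \<and> (\<forall>a\<in>A. \<forall>b\<in>A. a * b \<in> P \<longrightarrow> a \<in> P \<or> b \<in> P)"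

text \<open>Coefficients and generators are independent sets. The same notion thus covers the ideal
  generated by S in A and modules over a smaller ring, such as the span of monomials over a field of
  constants.\<close>

inductive_set lin_span :: "'r::comm_ring_1 set \<Rightarrow> 'r set \<Rightarrow> 'r set" for A S where
  zero: "0 \<in> lin_span A S"
| step: "x \<in> lin_span A S \<Longrightarrow> r \<in> A \<Longrightarrow> a \<in> S \<Longrightarrow> r * a + x \<in> lin_span A S"

definition fin_gen :: "'r::comm_ring_1 set \<Rightarrow> 'r set \<Rightarrow> bool" where
  "fin_gen A I \<longleftrightarrow> (\<exists>F. finite F \<and> F \<subseteq> I \<and> I \<subseteq> lin_span A F)"

definition noetherian_subring :: "'r::comm_ring_1 set \<Rightarrow> bool" where
  "noetherian_subring A \<longleftrightarrow> unital_subring A \<and> (\<forall>I. ideal_in A I \<longrightarrow> fin_gen A I)"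

lemma unital_subringD:
  assumes "unital_subring A"
  shows "1 \<in> A" "0 \<in> A" "x \<in> A \<Longrightarrow> y \<in> A \<Longrightarrow> x - y \<in> A" "x \<in> A \<Longrightarrow> y \<in> A \<Longrightarrow> x * y \<in> A"
    "x \<in> A \<Longrightarrow> - x \<in> A" "x \<in> A \<Longrightarrow> y \<in> A \<Longrightarrow> x + y \<in> A" "x \<in> A \<Longrightarrow> x ^ n \<in> A"
proof -
  show one: "1 \<in> A" and diff: "x \<in> A \<Longrightarrow> y \<in> A \<Longrightarrow> x - y \<in> A"
    and mult: "x \<in> A \<Longrightarrow> y \<in> A \<Longrightarrow> x * y \<in> A" for x y
    using assms by (auto simp: unital_subring_def)
  show zero: "0 \<in> A" using diff [OF one one] by simp
  show neg: "x \<in> A \<Longrightarrow> - x \<in> A" for x using diff [OF zero] by fastforce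
  show "x \<in> A \<Longrightarrow> y \<in> A \<Longrightarrow> x + y \<in> A" using diff [of x "- y"] neg by simp
  show "x \<in> A \<Longrightarrow> x ^ n \<in> A" by (induction n) (auto intro: one mult)
qed

lemma unital_subring_sum:
  assumes "unital_subring A" "\<And>i. i \<in> T \<Longrightarrow> f i \<in> A"
  shows "sum f T \<in> A"
  using assms(2) by (induction T rule: infinite_finite_induct)
    (auto intro: unital_subringD(2,6) [OF assms(1)])

lemma ideal_inD:
  assumes "ideal_in A I"
  shows "x \<in> I \<Longrightarrow> x \<in> A" "0 \<in> I" "x \<in> I \<Longrightarrow> y \<in> I \<Longrightarrow> x + y \<in> I"
    "r \<in> A \<Longrightarrow> x \<in> I \<Longrightarrow> r * x \<in> I" "r \<in> A \<Longrightarrow> x \<in> I \<Longrightarrow> x * r \<in> I"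
  using assms by (auto simp: ideal_in_def mult.commute)

lemma ideal_in_diff:
  assumes "unital_subring A" "ideal_in A I" "x \<in> I" "y \<in> I"
  shows "x - y \<in> I"
  using ideal_inD(3) [OF assms(2,3), of "- 1 * y"]
    ideal_inD(4) [OF assms(2) unital_subringD(5) [OF assms(1) unital_subringD(1) [OF assms(1)]] assms(4)]
  by simp

lemma ideal_in_sum:
  assumes "ideal_in A I" "\<And>i. i \<in> T \<Longrightarrow> f i \<in> I"
  shows "sum f T \<in> I"
  using assms(2) by (induction T rule: infinite_finite_induct)
    (auto intro: ideal_inD(2,3) [OF assms(1)])

lemma ideal_in_self: "unital_subring A \<Longrightarrow> ideal_in A A"
  by (auto simp: ideal_in_def intro: unital_subringD)

lemma prime_inD:
  assumes "prime_in A P"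
  shows "ideal_in A P" "1 \<notin> P" "a \<in> A \<Longrightarrow> b \<in> A \<Longrightarrow> a * b \<in> P \<Longrightarrow> a \<in> P \<or> b \<in> P"
  using assms by (auto simp: prime_in_def)

lemma ideal_in_Int:
  assumes "ideal_in R I" "A \<subseteq> R" "unital_subring A"
  shows "ideal_in A (I \<inter> A)"
  using assms(2) by (auto simp: ideal_in_def intro: ideal_inD [OF assms(1)] unital_subringD [OF assms(3)])

lemma prime_in_Int:
  assumes "prime_in R P" "A \<subseteq> R" "unital_subring A"
  shows "prime_in A (P \<inter> A)"
  using ideal_in_Int [OF prime_inD(1) [OF assms(1)] assms(2,3)] assms(1,2)
  by (auto simp: prime_in_def)

lemma lin_span_base: "unital_subring A \<Longrightarrow> a \<in> S \<Longrightarrow> a \<in> lin_span A S"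
  using lin_span.step [OF lin_span.zero, of 1 A a S] unital_subringD(1) by auto

lemma lin_span_add: "x \<in> lin_span A S \<Longrightarrow> y \<in> lin_span A S \<Longrightarrow> x + y \<in> lin_span A S"
  by (induction rule: lin_span.induct) (auto simp: add.assoc intro: lin_span.intros)

lemma lin_span_scale:
  assumes "unital_subring A" "r \<in> A" "x \<in> lin_span A S"
  shows "r * x \<in> lin_span A S"
  using assms(3)
proof induction
  case (step x s a)
  then have "(r * s) * a + r * x \<in> lin_span A S"
    by (intro lin_span.step unital_subringD(4) [OF assms(1,2)])
  then show ?case by (simp add: algebra_simps)
qed (auto intro: lin_span.zero)

lemma lin_span_gen: "r \<in> A \<Longrightarrow> a \<in> S \<Longrightarrow> r * a \<in> lin_span A S"
  using lin_span.step [OF lin_span.zero] by fastforce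

lemma lin_span_induct [consumes 1, case_names zero gen add]:
  assumes "x \<in> lin_span A S" "Q 0" "\<And>r a. r \<in> A \<Longrightarrow> a \<in> S \<Longrightarrow> Q (r * a)"
    "\<And>x y. Q x \<Longrightarrow> Q y \<Longrightarrow> Q (x + y)"
  shows "Q x"
  using assms(1) by induction (auto intro: assms)

lemma lin_span_minimal:
  assumes "ideal_in A I" "S \<subseteq> I" "A' \<subseteq> A"
  shows "lin_span A' S \<subseteq> I"
proof
  fix x assume "x \<in> lin_span A' S"
  then show "x \<in> I"
    using assms by (induction rule: lin_span_induct) (auto intro: ideal_inD)
qed

lemma lin_span_subset:
  assumes "unital_subring A" "S \<subseteq> lin_span A Y" "A' \<subseteq> A"
  shows "lin_span A' S \<subseteq> lin_span A Y"
proof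
  fix x assume "x \<in> lin_span A' S"
  then show "x \<in> lin_span A Y"
    using assms(2,3)
    by (induction rule: lin_span_induct) (auto intro: lin_span.zero lin_span_scale [OF assms(1)] lin_span_add)
qed

lemma lin_span_mono:
  assumes "S \<subseteq> Y" "A \<subseteq> A'"
  shows "lin_span A S \<subseteq> lin_span A' Y"
proof
  fix x assume "x \<in> lin_span A S"
  then show "x \<in> lin_span A' Y"
    using assms by (induction rule: lin_span_induct) (auto intro: lin_span.zero lin_span_add lin_span_gen)
qed

lemma lin_span_ideal_in:
  assumes "unital_subring A" "S \<subseteq> A"
  shows "ideal_in A (lin_span A S)"
proof -
  have "lin_span A S \<subseteq> A"
    by (rule lin_span_minimal [OF ideal_in_self [OF assms(1)] assms(2) subset_refl])
  then show ?thesis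
    by (auto simp: ideal_in_def intro: lin_span.zero lin_span_add lin_span_scale [OF assms(1)])
qed

lemma lin_span_insertE:
  assumes "x \<in> lin_span A (insert a S)" "unital_subring A"
  obtains r y where "r \<in> A" "y \<in> lin_span A S" "x = r * a + y"
proof -
  have "\<exists>r\<in>A. \<exists>y\<in>lin_span A S. x = r * a + y"
    using assms(1)
  proof (induction rule: lin_span_induct)
    case zero
    then show ?case using unital_subringD(2) [OF assms(2)] lin_span.zero by force
  next
    case (gen r b)
    show ?case
    proof (cases "b = a")
      case True
      then show ?thesis using gen lin_span.zero by force
    next
      case False
      then have "r * b \<in> lin_span A S" using gen by (auto intro: lin_span_gen)
      then show ?thesis using unital_subringD(2) [OF assms(2)] by force
    qed
  next
    case (add x y)
    then obtain r u s v where "r \<in> A" "u \<in> lin_span A S" "x = r * a + u"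
      "s \<in> A" "v \<in> lin_span A S" "y = s * a + v" by blast
    then show ?case
      using unital_subringD(6) [OF assms(2)] lin_span_add
      by (intro bexI [of _ "r + s"] bexI [of _ "u + v"]) (auto simp: algebra_simps)
  qed
  then show thesis using that by blast
qed

lemma lin_span_finite_support:
  assumes "x \<in> lin_span A S"
  obtains F where "finite F" "F \<subseteq> S" "x \<in> lin_span A F"
proof -
  have "\<exists>F. finite F \<and> F \<subseteq> S \<and> x \<in> lin_span A F"
    using assms
  proof (induction rule: lin_span_induct)
    case zero
    then show ?case using lin_span.zero by blast
  next
    case (gen r a)
    then show ?case by (intro exI [of _ "{a}"]) (auto intro: lin_span_gen)
  next
    case (add x y)
    then obtain F G where "finite F" "F \<subseteq> S" "x \<in> lin_span A F" "finite G" "G \<subseteq> S" "y \<in> lin_span A G"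
      by blast
    moreover have "lin_span A F \<subseteq> lin_span A (F \<union> G)" "lin_span A G \<subseteq> lin_span A (F \<union> G)"
      by (rule lin_span_mono; blast)+
    ultimately show ?case
      by (intro exI [of _ "F \<union> G"]) (auto intro!: lin_span_add)
  qed
  then show thesis using that by blast
qed

text \<open>Each of finitely many generators involves only finitely many elements of S. This matters
  later because the generators must be found inside a prescribed smaller subring.\<close>

lemma fin_gen_subset:
  assumes "unital_subring A" "S \<subseteq> I" "fin_gen A (lin_span A S)" "I \<subseteq> lin_span A S"
  obtains F where "finite F" "F \<subseteq> S" "I \<subseteq> lin_span A F"
proof -
  obtain F where F: "finite F" "F \<subseteq> lin_span A S" "lin_span A S \<subseteq> lin_span A F"
    using assms(3) by (auto simp: fin_gen_def)
  have "\<forall>x\<in>F. \<exists>G. finite G \<and> G \<subseteq> S \<and> x \<in> lin_span A G"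
    using F(2) lin_span_finite_support by (metis subsetD)
  then obtain G where G: "\<And>x. x \<in> F \<Longrightarrow> finite (G x) \<and> G x \<subseteq> S \<and> x \<in> lin_span A (G x)"
    by metis
  have "F \<subseteq> lin_span A (\<Union>x\<in>F. G x)"
  proof
    fix x assume x: "x \<in> F"
    then have "lin_span A (G x) \<subseteq> lin_span A (\<Union>x\<in>F. G x)" by (intro lin_span_mono) auto
    then show "x \<in> lin_span A (\<Union>x\<in>F. G x)" using G [OF x] by blast
  qed
  then have "lin_span A F \<subseteq> lin_span A (\<Union>x\<in>F. G x)"
    by (intro lin_span_subset [OF assms(1)]) auto
  then show thesis
    using F assms(4) by (intro that [of "\<Union>x\<in>F. G x"]) (use G in blast)+
qed

lemma noetherian_subring_finite_generators:
  assumes "noetherian_subring A" "S \<subseteq> A"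
  obtains F where "finite F" "F \<subseteq> S" "lin_span A S \<subseteq> lin_span A F"
proof -
  have A: "unital_subring A" using assms(1) by (simp add: noetherian_subring_def)
  then have "ideal_in A (lin_span A S)" using assms(2) by (rule lin_span_ideal_in)
  then have "fin_gen A (lin_span A S)" using assms(1) by (simp add: noetherian_subring_def)
  then show thesis
    using fin_gen_subset [OF A _ _ subset_refl, of S] lin_span_base [OF A] that by (metis subsetI)
qed

text \<open>An ideal maximal among those which are not finitely generated is prime.\<close>

theorem cohen_noetherian:
  assumes A: "unital_subring A" and primes: "\<And>P. prime_in A P \<Longrightarrow> fin_gen A P"
  shows "noetherian_subring A"
proof (rule ccontr)
  assume "\<not> noetherian_subring A"
  then obtain I\<^sub>0 where I\<^sub>0: "ideal_in A I\<^sub>0" "\<not> fin_gen A I\<^sub>0"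
    using A by (auto simp: noetherian_subring_def)
  let ?S = "{I. ideal_in A I \<and> \<not> fin_gen A I}"
  have "\<exists>U\<in>?S. \<forall>S\<in>C. S \<subseteq> U" if C: "subset.chain ?S C" for C
  proof (cases "C = {}")
    case True
    then show ?thesis using I\<^sub>0 by blast
  next
    case False
    have C1: "\<And>I. I \<in> C \<Longrightarrow> ideal_in A I" "\<And>I. I \<in> C \<Longrightarrow> \<not> fin_gen A I"
      using C by (auto simp: subset.chain_def)
    have C2: "I \<subseteq> J \<or> J \<subseteq> I" if "I \<in> C" "J \<in> C" for I J
      using C that by (auto simp: subset_chain_def)
    have "ideal_in A (\<Union>C)"
      unfolding ideal_in_def
    proof (intro conjI ballI)
      show "\<Union>C \<subseteq> A" using C1(1) ideal_inD(1) by blast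
      show "0 \<in> \<Union>C" using False C1(1) ideal_inD(2) by blast
      show "x + y \<in> \<Union>C" if xy: "x \<in> \<Union>C" "y \<in> \<Union>C" for x y
      proof -
        obtain I J where "I \<in> C" "J \<in> C" "x \<in> I" "y \<in> J" using xy by blast
        then show ?thesis
          using C2 [of I J] C1(1) ideal_inD(3) by (metis UnionI subsetD)
      qed
      show "r * x \<in> \<Union>C" if "r \<in> A" "x \<in> \<Union>C" for r x
        using that C1(1) ideal_inD(4) by blast
    qed
    moreover have "\<not> fin_gen A (\<Union>C)"
    proof
      assume "fin_gen A (\<Union>C)"
      then obtain F where F: "finite F" "F \<subseteq> \<Union>C" "\<Union>C \<subseteq> lin_span A F"
        by (auto simp: fin_gen_def)
      obtain I where "I \<in> C" "F \<subseteq> I"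
        using finite_subset_Union_chain [OF F(1,2) False C] by blast
      then show False
        using C1(2) F unfolding fin_gen_def by blast
    qed
    ultimately show ?thesis by blast
  qed
  then have "\<exists>P\<in>?S. \<forall>J\<in>?S. P \<subseteq> J \<longrightarrow> J = P"
    by (rule subset_Zorn)
  then obtain P where P: "ideal_in A P" "\<not> fin_gen A P"
    and max: "\<And>J. ideal_in A J \<Longrightarrow> \<not> fin_gen A J \<Longrightarrow> P \<subseteq> J \<Longrightarrow> J = P"
    by auto
  have "prime_in A P"
    unfolding prime_in_def
  proof (intro conjI ballI impI)
    show "ideal_in A P" by fact
    show "1 \<notin> P"
    proof
      assume "1 \<in> P"
      moreover have "P \<subseteq> lin_span A {1}"
        using lin_span_gen [of _ A 1 "{1}"] ideal_inD(1) [OF P(1)]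
        by (metis insertI1 mult.right_neutral subsetI)
      ultimately show False using P(2) unfolding fin_gen_def by blast
    qed
    fix a b assume a: "a \<in> A" and b: "b \<in> A" and ab: "a * b \<in> P"
    show "a \<in> P \<or> b \<in> P"
    proof (rule ccontr)
      assume neg: "\<not> (a \<in> P \<or> b \<in> P)"
      \<comment> \<open>\<open>?J\<close> and the colon ideal \<open>?K\<close> below properly
        contain P, because of a and of b respectively, so maximality makes both finitely generated.
        Their generators combine to generators of P.\<close>
      let ?J = "lin_span A (insert a P)"
      have "ideal_in A ?J"
        using a ideal_inD(1) [OF P(1)] by (intro lin_span_ideal_in [OF A]) auto
      moreover have "P \<subseteq> ?J" "a \<in> ?J" using lin_span_base [OF A] by auto
      ultimately have "fin_gen A ?J" using max neg by blast
      then obtain F where F: "finite F" "F \<subseteq> ?J" "?J \<subseteq> lin_span A F"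
        by (auto simp: fin_gen_def)
      have span_P: "lin_span A P \<subseteq> P"
        by (rule lin_span_minimal [OF P(1)]) auto
      have "\<forall>f\<in>F. \<exists>r\<in>A. \<exists>p\<in>P. f = r * a + p"
        using F(2) lin_span_insertE [OF _ A] span_P by (metis subsetD)
      then obtain r p where rp: "\<And>f. f \<in> F \<Longrightarrow> r f \<in> A \<and> p f \<in> P \<and> f = r f * a + p f"
        by metis
      let ?K = "{x \<in> A. x * a \<in> P}"
      have "ideal_in A ?K"
        by (auto simp: ideal_in_def algebra_simps intro: unital_subringD [OF A] ideal_inD [OF P(1)])
      moreover have "P \<subseteq> ?K"
        using a ideal_inD(1,5) [OF P(1)] by blast
      moreover have "b \<in> ?K" using ab b by (simp add: mult.commute)
      ultimately have "fin_gen A ?K" using max neg by blast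
      then obtain E where E: "finite E" "E \<subseteq> ?K" "?K \<subseteq> lin_span A E"
        by (auto simp: fin_gen_def)
      \<comment> \<open>The P-parts of the generators of \<open>?J\<close> and the a-multiples of
        the generators of \<open>?K\<close>. If x = s a + y lies in P, with y in the span of the
        former, then s a lies in P and hence s in \<open>?K\<close>.\<close>
      let ?G = "p ` F \<union> (\<lambda>x. x * a) ` E"
      have G: "finite ?G" "?G \<subseteq> P" using F(1) E(1,2) rp by auto
      have "x \<in> lin_span A ?G" if "x \<in> P" for x
      proof -
        have "x \<in> lin_span A (insert a (p ` F))"
        proof -
          have "F \<subseteq> lin_span A (insert a (p ` F))"
          proof
            fix f assume f: "f \<in> F"
            have "r f * a + p f \<in> lin_span A (insert a (p ` F))"
              using rp [OF f] f by (intro lin_span_add lin_span_gen lin_span_base [OF A]) auto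
            then show "f \<in> lin_span A (insert a (p ` F))" using rp [OF f] by simp
          qed
          then have "lin_span A F \<subseteq> lin_span A (insert a (p ` F))"
            by (intro lin_span_subset [OF A]) auto
          then show ?thesis using that \<open>P \<subseteq> ?J\<close> F(3) by blast
        qed
        then obtain s y where sy: "s \<in> A" "y \<in> lin_span A (p ` F)" "x = s * a + y"
          using lin_span_insertE [OF _ A] by metis
        have "lin_span A (p ` F) \<subseteq> P"
          using rp by (intro lin_span_minimal [OF P(1)]) auto
        then have "s * a \<in> P"
          using ideal_in_diff [OF A P(1) that, of y] sy by auto
        then have "s \<in> lin_span A E" using E(3) sy(1) by blast
        then have "s * a \<in> lin_span A ((\<lambda>x. x * a) ` E)"
        proof (induction rule: lin_span_induct)
          case (gen r e)
          then show ?case using lin_span_gen [of r A "e * a"] by (auto simp: mult.assoc)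
        qed (auto simp: distrib_right intro: lin_span.zero lin_span_add)
        moreover have "lin_span A (p ` F) \<subseteq> lin_span A ?G"
          "lin_span A ((\<lambda>x. x * a) ` E) \<subseteq> lin_span A ?G"
          by (rule lin_span_mono; blast)+
        ultimately show ?thesis
          unfolding sy(3) using sy(2) by (intro lin_span_add) blast+
      qed
      then have "fin_gen A P" using G unfolding fin_gen_def by (intro exI [of _ ?G]) blast
      then show False using P(2) by blast
    qed
  qed
  then show False using primes P(2) by blast
qed

section \<open>Polynomials over subrings\<close>

definition polys :: "'r::comm_ring_1 set \<Rightarrow> 'r poly set" where
  "polys A = {f. \<forall>i. Polynomial.coeff f i \<in> A}"

lemma polysD: "f \<in> polys A \<Longrightarrow> Polynomial.coeff f i \<in> A"
  by (simp add: polys_def)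

lemma ideal_in_add_closed: "ideal_in A I \<Longrightarrow> f \<in> polys I \<Longrightarrow> g \<in> polys I \<Longrightarrow> f + g \<in> polys I"
  by (auto simp: polys_def intro: ideal_inD)

lemma polys_mult_left:
  assumes "ideal_in A I" "f \<in> polys A" "g \<in> polys I"
  shows "f * g \<in> polys I"
  using assms(2,3)
  by (auto simp: polys_def coeff_mult intro!: ideal_in_sum [OF assms(1)] ideal_inD(4) [OF assms(1)])

lemma polys_closed:
  assumes "unital_subring A"
  shows "0 \<in> polys A" "1 \<in> polys A" "f \<in> polys A \<Longrightarrow> g \<in> polys A \<Longrightarrow> f + g \<in> polys A"
    "f \<in> polys A \<Longrightarrow> g \<in> polys A \<Longrightarrow> f - g \<in> polys A"
    "f \<in> polys A \<Longrightarrow> g \<in> polys A \<Longrightarrow> f * g \<in> polys A"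
    "a \<in> A \<Longrightarrow> Polynomial.monom a n \<in> polys A"
    "a \<in> A \<Longrightarrow> f \<in> polys A \<Longrightarrow> Polynomial.smult a f \<in> polys A"
proof -
  show "f \<in> polys A \<Longrightarrow> g \<in> polys A \<Longrightarrow> f * g \<in> polys A"
    by (rule polys_mult_left [OF ideal_in_self [OF assms]])
qed (auto simp: polys_def intro: unital_subringD [OF assms])

lemma unital_subring_polys: "unital_subring A \<Longrightarrow> unital_subring (polys A)"
  by (simp add: unital_subring_def [of "polys A"] polys_closed)

lemma poly_closed:
  assumes "unital_subring R" "ideal_in R I" "f \<in> polys I" "y \<in> R"
  shows "poly f y \<in> I"
  using assms(3,4) unfolding poly_altdef
  by (auto simp: polys_def intro!: ideal_in_sum [OF assms(2)] ideal_inD(5) [OF assms(2)]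
      unital_subringD(7) [OF assms(1)])

text \<open>Look at the lowest coefficients outside the prime ideal.\<close>

lemma polys_prime:
  assumes A: "unital_subring A" and Q: "prime_in A Q" and f: "f \<in> polys A" and g: "g \<in> polys A"
    and fg: "f * g \<in> polys Q"
  shows "f \<in> polys Q \<or> g \<in> polys Q"
proof (rule ccontr)
  assume neg: "\<not> (f \<in> polys Q \<or> g \<in> polys Q)"
  let ?f = "Polynomial.coeff f" and ?g = "Polynomial.coeff g"
  obtain i where i: "?f i \<notin> Q" "\<And>l. l < i \<Longrightarrow> ?f l \<in> Q"
    using neg exists_least_iff [of "\<lambda>i. ?f i \<notin> Q"] unfolding polys_def by blast
  obtain j where j: "?g j \<notin> Q" "\<And>l. l < j \<Longrightarrow> ?g l \<in> Q"
    using neg exists_least_iff [of "\<lambda>i. ?g i \<notin> Q"] unfolding polys_def by blast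
  note I = prime_inD(1) [OF Q]
  have "(\<Sum>l\<in>{..i + j} - {i}. ?f l * ?g (i + j - l)) \<in> Q"
  proof (rule ideal_in_sum [OF I])
    fix l assume "l \<in> {..i + j} - {i}"
    then consider "l < i" | "i + j - l < j" by force
    then show "?f l * ?g (i + j - l) \<in> Q"
      using i(2) j(2) polysD [OF f] polysD [OF g] ideal_inD(4,5) [OF I] by cases auto
  qed
  moreover have "(\<Sum>l\<in>{..i + j}. ?f l * ?g (i + j - l)) \<in> Q"
    using polysD [OF fg, of "i + j"] by (simp add: coeff_mult)
  moreover have "(\<Sum>l\<in>{..i + j}. ?f l * ?g (i + j - l)) =
      ?f i * ?g j + (\<Sum>l\<in>{..i + j} - {i}. ?f l * ?g (i + j - l))"
    by (subst sum.remove [of _ i]) auto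
  ultimately have "?f i * ?g j \<in> Q"
    using ideal_in_diff [OF A I] by (metis add_diff_cancel_right')
  then show False
    using prime_inD(3) [OF Q] i(1) j(1) polysD [OF f] polysD [OF g] by blast
qed

section \<open>The Hilbert basis theorem for Laurent extensions\<close>

text \<open>Up to a power of the unit y, every element of B is the value at y of a polynomial over
  A. The argument with leading coefficients is therefore run on the polynomials whose value lies in
  the given ideal.\<close>

theorem hilbert_laurent:
  fixes A B :: "'r::comm_ring_1 set"
  assumes A_noeth: "noetherian_subring A" and B: "unital_subring B" and AB: "A \<subseteq> B"
    and y: "y \<in> B" and z: "z \<in> B" "y * z = 1"
    and laurent: "\<And>b. b \<in> B \<Longrightarrow> \<exists>N. \<exists>f\<in>polys A. y ^ N * b = poly f y"
  shows "noetherian_subring B"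
  unfolding noetherian_subring_def
proof (intro conjI allI impI)
  have A: "unital_subring A" using A_noeth by (simp add: noetherian_subring_def)
  show "unital_subring B" by fact
  fix I assume I: "ideal_in B I"
  \<comment> \<open>Bounding the degree instead of fixing it admits zero and cancelling leading
    terms, so the coefficients at d form an ideal \<open>L d\<close> of A.\<close>
  define M where "M d = {f \<in> polys A. Polynomial.degree f \<le> d \<and> poly f y \<in> I}" for d
  define L where "L d = (\<lambda>f. Polynomial.coeff f d) ` M d" for d
  have L: "ideal_in A (L d)" for d
    unfolding ideal_in_def
  proof (intro conjI ballI)
    show "L d \<subseteq> A" by (auto simp: L_def M_def polys_def)
    have "0 \<in> M d" using ideal_inD(2) [OF I] polys_closed(1) [OF A] by (simp add: M_def)
    then show "0 \<in> L d" unfolding L_def by force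
    show "a + b \<in> L d" if "a \<in> L d" "b \<in> L d" for a b
    proof -
      obtain f g where "f \<in> M d" "a = Polynomial.coeff f d" "g \<in> M d" "b = Polynomial.coeff g d"
        using \<open>a \<in> L d\<close> \<open>b \<in> L d\<close> by (auto simp: L_def)
      then have "f + g \<in> M d" "a + b = Polynomial.coeff (f + g) d"
        using ideal_inD(3) [OF I] polys_closed(3) [OF A] by (auto simp: M_def intro: degree_add_le)
      then show ?thesis unfolding L_def by blast
    qed
    show "r * a \<in> L d" if r: "r \<in> A" and "a \<in> L d" for r a
    proof -
      obtain f where "f \<in> M d" "a = Polynomial.coeff f d"
        using \<open>a \<in> L d\<close> by (auto simp: L_def)
      then have "Polynomial.smult r f \<in> M d" "r * a = Polynomial.coeff (Polynomial.smult r f) d"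
        using ideal_inD(4) [OF I] polys_closed(7) [OF A r] r AB
        by (auto simp: M_def intro: order_trans [OF degree_smult_le])
      then show ?thesis unfolding L_def by blast
    qed
  qed
  have L_mono: "L d \<subseteq> L (d + e)" for d e
  proof
    fix a assume "a \<in> L d"
    then obtain f where f: "f \<in> M d" "a = Polynomial.coeff f d"
      by (auto simp: L_def)
    let ?g = "Polynomial.monom 1 e * f"
    have "?g \<in> polys A"
      using f polys_closed(5,6) [OF A] unital_subringD(1) [OF A] by (auto simp: M_def)
    moreover have "Polynomial.degree ?g \<le> d + e"
      using f degree_mult_le [of "Polynomial.monom 1 e" f] degree_monom_le [of "1::'r" e]
      by (auto simp: M_def)
    moreover have "poly ?g y \<in> I"
      using f ideal_inD(4) [OF I unital_subringD(7) [OF B y]] by (auto simp: M_def poly_monom)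
    moreover have "Polynomial.coeff ?g (d + e) = a"
      using f by (simp add: coeff_monom_mult)
    ultimately show "a \<in> L (d + e)" unfolding L_def M_def by force
  qed
  then have L_le: "d \<le> e \<Longrightarrow> L d \<subseteq> L e" for d e
    by (metis le_iff_add)
  have "\<exists>E. finite E \<and> E \<subseteq> M d \<and> L d \<subseteq> lin_span A ((\<lambda>f. Polynomial.coeff f d) ` E)" for d
  proof -
    obtain F where "finite F" "F \<subseteq> L d" "L d \<subseteq> lin_span A F"
      using A_noeth L [of d] unfolding noetherian_subring_def fin_gen_def by blast
    then show ?thesis
      unfolding L_def using finite_subset_image [of F "\<lambda>f. Polynomial.coeff f d" "M d"] by metis
  qed
  then obtain E where E: "\<And>d. finite (E d)" "\<And>d. E d \<subseteq> M d"
    "\<And>d. L d \<subseteq> lin_span A ((\<lambda>f. Polynomial.coeff f d) ` E d)"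
    by metis
  have "ideal_in A (\<Union>d. L d)"
    unfolding ideal_in_def
  proof (intro conjI ballI)
    show "(\<Union>d. L d) \<subseteq> A" using L ideal_inD(1) by blast
    show "0 \<in> (\<Union>d. L d)" using L ideal_inD(2) by blast
    show "a + b \<in> (\<Union>d. L d)" if "a \<in> (\<Union>d. L d)" "b \<in> (\<Union>d. L d)" for a b
    proof -
      obtain d e where "a \<in> L d" "b \<in> L e" using \<open>a \<in> (\<Union>d. L d)\<close> \<open>b \<in> (\<Union>d. L d)\<close> by blast
      then have "a \<in> L (max d e)" "b \<in> L (max d e)" using L_le by (meson max.cobounded1 max.cobounded2 subsetD)+
      then show ?thesis using ideal_inD(3) [OF L] by blast
    qed
    show "r * a \<in> (\<Union>d. L d)" if "r \<in> A" "a \<in> (\<Union>d. L d)" for r a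
      using that ideal_inD(4) [OF L] by blast
  qed
  then obtain F where F: "finite F" "F \<subseteq> (\<Union>d. L d)" "(\<Union>d. L d) \<subseteq> lin_span A F"
    using A_noeth unfolding noetherian_subring_def fin_gen_def by blast
  have "\<exists>N. F \<subseteq> L N"
    using F(1,2)
  proof (induction F rule: finite_induct)
    case (insert a F)
    then obtain N d where "F \<subseteq> L N" "a \<in> L d" by auto
    then have "insert a F \<subseteq> L (max N d)" using L_le [of N "max N d"] L_le [of d "max N d"] by auto
    then show ?case by blast
  qed auto
  then obtain N where N: "F \<subseteq> L N" by blast
  have stable: "L d \<subseteq> L N" for d
    using F(3) lin_span_minimal [OF L N subset_refl] by blast
  define S where "S = (\<lambda>f. poly f y) ` (\<Union>d\<le>N. E d)"
  have S: "finite S" "S \<subseteq> I" using E by (auto simp: S_def M_def)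
  have span_S: "lin_span B S \<subseteq> I" by (rule lin_span_minimal [OF I S(2) subset_refl])
  have lift: "\<exists>g\<in>polys A. Polynomial.degree g \<le> d \<and> Polynomial.coeff g d = a \<and> poly g y \<in> lin_span B S"
    if "d \<le> N" "a \<in> lin_span A ((\<lambda>f. Polynomial.coeff f d) ` E d)" for a d
    using that(2)
  proof (induction rule: lin_span_induct)
    case zero
    then show ?case using polys_closed(1) [OF A] by (intro bexI [of _ 0]) (auto intro: lin_span.zero)
  next
    case (gen r a)
    then obtain f where f: "f \<in> E d" "a = Polynomial.coeff f d" by auto
    then have "f \<in> polys A" "Polynomial.degree f \<le> d" using E(2) by (auto simp: M_def)
    moreover have "poly f y \<in> S" using f that(1) by (auto simp: S_def)
    ultimately show ?case
      using f gen AB polys_closed(7) [OF A]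
      by (intro bexI [of _ "Polynomial.smult r f"])
        (auto intro: order_trans [OF degree_smult_le] lin_span_gen)
  next
    case (add a b)
    then obtain f g where "f \<in> polys A" "Polynomial.degree f \<le> d" "Polynomial.coeff f d = a"
      "poly f y \<in> lin_span B S" "g \<in> polys A" "Polynomial.degree g \<le> d" "Polynomial.coeff g d = b"
      "poly g y \<in> lin_span B S" by blast
    then show ?case
      using polys_closed(3) [OF A] by (intro bexI [of _ "f + g"]) (auto intro: degree_add_le lin_span_add)
  qed
  have main: "poly f y \<in> lin_span B S" if "f \<in> M d" for f d
    using that
  proof (induction d arbitrary: f)
    case d: (0 f)
    then have "Polynomial.coeff f 0 \<in> L 0" unfolding L_def by blast
    then obtain g where "Polynomial.degree g \<le> 0" "Polynomial.coeff g 0 = Polynomial.coeff f 0"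
      "poly g y \<in> lin_span B S"
      using lift [of 0 "Polynomial.coeff f 0"] E(3) [of 0] by auto
    moreover have "Polynomial.degree f = 0" using d by (simp add: M_def)
    ultimately have "f = g" by (metis degree_eq_zeroE le_zero_eq coeff_pCons_0)
    then show ?case using \<open>poly g y \<in> lin_span B S\<close> by simp
  next
    case (Suc d f)
    \<comment> \<open>Above N no new leading coefficients occur: the required one is realised in
      degree N and then shifted up by a power of y.\<close>
    define e where "e = min (Suc d) N"
    have "Polynomial.coeff f (Suc d) \<in> L (Suc d)" using Suc.prems unfolding L_def by blast
    then have "Polynomial.coeff f (Suc d) \<in> L e"
      using stable [of "Suc d"] by (auto simp: e_def min_def)
    then obtain g where g: "g \<in> polys A" "Polynomial.degree g \<le> e"
      "Polynomial.coeff g e = Polynomial.coeff f (Suc d)" "poly g y \<in> lin_span B S"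
      using lift [of e] E(3) [of e] by (auto simp: e_def)
    let ?h = "Polynomial.monom 1 (Suc d - e) * g"
    have e: "e \<le> Suc d" by (simp add: e_def)
    have h: "?h \<in> polys A"
      using g polys_closed(5,6) [OF A] unital_subringD(1) [OF A] by auto
    have hS: "poly ?h y \<in> lin_span B S"
      using g lin_span_scale [OF B unital_subringD(7) [OF B y]] by (auto simp: poly_monom)
    have "Polynomial.degree ?h \<le> Suc d"
      using g e degree_mult_le [of "Polynomial.monom 1 (Suc d - e)" g]
        degree_monom_le [of "1::'r" "Suc d - e"] by auto
    moreover have "Polynomial.coeff ?h (Suc d) = Polynomial.coeff f (Suc d)"
      using g e by (simp add: coeff_monom_mult)
    moreover have "Polynomial.degree f \<le> Suc d" using Suc.prems by (simp add: M_def)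
    ultimately have "Polynomial.degree (f - ?h) \<le> d"
      by (intro degree_le) (metis Suc_lessI coeff_diff coeff_eq_0 diff_self le_less_trans diff_zero)
    moreover have "poly (f - ?h) y \<in> I"
      using Suc.prems hS span_S ideal_in_diff [OF B I, of "poly f y" "poly ?h y"] by (auto simp: M_def)
    moreover have "f - ?h \<in> polys A" using Suc.prems h polys_closed(4) [OF A] by (auto simp: M_def)
    ultimately have "poly (f - ?h) y \<in> lin_span B S"
      by (intro Suc.IH) (auto simp: M_def)
    then have "poly (f - ?h) y + poly ?h y \<in> lin_span B S" using hS by (rule lin_span_add)
    then show ?case by simp
  qed
  have "b \<in> lin_span B S" if b: "b \<in> I" for b
  proof -
    obtain n f where f: "f \<in> polys A" "y ^ n * b = poly f y"
      using laurent ideal_inD(1) [OF I b] by blast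
    have "poly f y \<in> I" using f(2) ideal_inD(4) [OF I unital_subringD(7) [OF B y] b] by metis
    then have "y ^ n * b \<in> lin_span B S" using f main [of f "Polynomial.degree f"] by (simp add: M_def)
    then have "z ^ n * (y ^ n * b) \<in> lin_span B S"
      by (rule lin_span_scale [OF B unital_subringD(7) [OF B z(1)]])
    moreover have "z ^ n * (y ^ n * b) = b"
      using z(2) by (simp add: mult.commute mult.left_commute flip: mult.assoc power_mult_distrib)
    ultimately show ?thesis by simp
  qed
  then show "fin_gen B I" using S unfolding fin_gen_def by blast
qed

section \<open>Rings spanned by the monomials of a finitely generated group\<close>

lemma group_closure_mono: "S \<subseteq> T \<Longrightarrow> group_closure S \<subseteq> group_closure T"
proof
  fix x assume "x \<in> group_closure S" "S \<subseteq> T"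
  then show "x \<in> group_closure T"
    by (induction rule: group_closure.induct) (auto intro: group_closure.intros)
qed

lemma unital_subring_lin_span:
  assumes C: "unital_subring C" and H: "0 \<in> H" "\<And>g h. g \<in> H \<Longrightarrow> h \<in> H \<Longrightarrow> g + h \<in> H"
    and x: "x 0 = 1" "\<And>g h. g \<in> H \<Longrightarrow> h \<in> H \<Longrightarrow> x (g + h) = x g * x h"
  shows "unital_subring (lin_span C (x ` H))"
  unfolding unital_subring_def
proof (intro conjI ballI)
  let ?L = "lin_span C (x ` H)"
  show "1 \<in> ?L" using lin_span_base [OF C] H(1) x(1) by force
  fix a b assume ab: "a \<in> ?L" "b \<in> ?L"
  have "- 1 \<in> C" using unital_subringD(1,5) [OF C] by blast
  then have "- 1 * b \<in> ?L" using lin_span_scale [OF C] ab by blast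
  then show "a - b \<in> ?L" using lin_span_add [OF ab(1), of "- 1 * b"] by simp
  show "a * b \<in> ?L"
    using ab(1)
  proof (induction rule: lin_span_induct)
    case (gen r u)
    then obtain g where g: "g \<in> H" "u = x g" by auto
    have "x g * b \<in> ?L"
      using ab(2)
    proof (induction rule: lin_span_induct)
      case (gen s v)
      then obtain h where h: "h \<in> H" "v = x h" by auto
      have "s * x (g + h) \<in> ?L" using gen g h H by (intro lin_span_gen) auto
      then show ?case using x(2) g h by (simp add: mult.left_commute)
    qed (auto simp: distrib_left intro: lin_span.zero lin_span_add)
    then have "r * (x g * b) \<in> ?L" by (rule lin_span_scale [OF C gen(1)])
    then show ?case by (simp add: g mult.assoc)
  qed (auto simp: distrib_right intro: lin_span.zero lin_span_add)
qed

text \<open>Adjoining a generator g of the group adjoins the unit \<open>x g\<close> and its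
  inverse, which is a Laurent extension. Multiplicativity is asked only on the subgroup because the
  twisted monomials of one stage of the tower multiply correctly only on its own lattice.\<close>

theorem noetherian_monomial_span:
  fixes x :: "'g::ab_group_add \<Rightarrow> 'r::comm_ring_1"
  assumes C: "noetherian_subring C" and "finite S" and x0: "x 0 = 1"
    and "\<And>g h. g \<in> group_closure S \<Longrightarrow> h \<in> group_closure S \<Longrightarrow> x (g + h) = x g * x h"
  shows "noetherian_subring (lin_span C (x ` group_closure S))"
  using assms(2,4)
proof (induction S rule: finite_induct)
  case empty
  have C': "unital_subring C" using C by (simp add: noetherian_subring_def)
  have "lin_span C {1} \<subseteq> C"
    by (rule lin_span_minimal [OF ideal_in_self [OF C']]) (auto intro: unital_subringD(1) [OF C'])
  moreover have "C \<subseteq> lin_span C {1}" using lin_span_gen [of _ C 1 "{1}"] by force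
  ultimately show ?case using C x0 by simp
next
  case (insert g S)
  have C': "unital_subring C" using C by (simp add: noetherian_subring_def)
  let ?H = "group_closure S" and ?H' = "group_closure (insert g S)"
  let ?A = "lin_span C (x ` ?H)" and ?B = "lin_span C (x ` ?H')"
  have HH: "?H \<subseteq> ?H'" by (rule group_closure_mono) auto
  have xa: "x (a + b) = x a * x b" if "a \<in> ?H'" "b \<in> ?H'" for a b
    using insert.prems that by blast
  have A: "noetherian_subring ?A"
    using insert.IH xa HH by blast
  have A': "unital_subring ?A" using A by (simp add: noetherian_subring_def)
  have B: "unital_subring ?B"
    using xa x0 by (intro unital_subring_lin_span [OF C']) (auto intro: group_closure_add)
  have AB: "?A \<subseteq> ?B" using HH by (intro lin_span_mono) auto
  have g: "g \<in> ?H'" by (intro group_closure.base) auto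
  define m where "m n = (\<Sum>i<n. g)" for n :: nat
  have m_add: "m (i + j) = m i + m j" for i j
    by (induction i) (auto simp: m_def algebra_simps)
  have m_H': "m n \<in> ?H'" for n
    by (induction n) (auto simp: m_def intro: group_closure_add g)
  have x_m: "x (m n) = x g ^ n" for n
  proof (induction n)
    case (Suc n)
    have "m (Suc n) = g + m n" using m_add [of 1 n] by (simp add: m_def)
    then show ?case using Suc xa [OF g m_H'] by simp
  qed (simp add: m_def x0)
  \<comment> \<open>\<open>m n\<close> is the n-fold sum of g. Adding enough copies of g clears its
    negative multiples, which is what puts \<open>x g ^ N * x s\<close> into polynomial
    form.\<close>
  have decomp: "\<exists>N n. \<exists>h\<in>?H. m N + s = h + m n" if "s \<in> ?H'" for s
    using that
  proof induction
    case (base s)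
    have "\<exists>h\<in>?H. m 0 + s = h + m 1" if "s = g"
      using that by (intro bexI [of _ 0]) (auto simp: m_def)
    moreover have "\<exists>h\<in>?H. m 0 + s = h + m 0" if "s \<in> insert 0 S"
      using that group_closure.base by (auto simp: m_def)
    ultimately show ?case using base by blast
  next
    case (diff s t)
    then obtain N n h M k h' where *: "h \<in> ?H" "m N + s = h + m n" "h' \<in> ?H" "m M + t = h' + m k"
      by blast
    have "m (N + k) + (s - t) = (m N + s) - (m M + t) + m k + m M"
      by (simp add: m_add algebra_simps)
    also have "\<dots> = (h - h') + m (n + M)"
      unfolding * by (simp add: m_add algebra_simps)
    finally show ?case using *(1,3) group_closure.diff by blast
  qed
  show ?case
  proof (rule hilbert_laurent [OF A B AB])
    show "x g \<in> ?B" "x (- g) \<in> ?B" using g by (auto intro!: lin_span_base [OF C'])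
    show "x g * x (- g) = 1" using xa [of g "- g"] g x0 by simp
    fix b assume "b \<in> ?B"
    then show "\<exists>N. \<exists>f\<in>polys ?A. x g ^ N * b = poly f (x g)"
    proof (induction rule: lin_span_induct)
      case zero
      then show ?case using polys_closed(1) [OF A'] by (intro exI bexI [of _ 0]) auto
    next
      case (gen r u)
      then obtain s where s: "s \<in> ?H'" "u = x s" by auto
      obtain N n h where d: "h \<in> ?H" "m N + s = h + m n" using decomp [OF s(1)] by blast
      have "x g ^ N * x s = x (m N + s)" using xa [OF m_H' s(1)] by (simp add: x_m)
      also have "\<dots> = x h * x g ^ n" using d xa [of h "m n"] m_H' HH by (auto simp: x_m)
      finally have "x g ^ N * (r * u) = poly (Polynomial.monom (r * x h) n) (x g)"
        by (simp add: s poly_monom mult_ac)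
      moreover have "Polynomial.monom (r * x h) n \<in> polys ?A"
        using gen d by (intro polys_closed(6) [OF A'] lin_span_gen) auto
      ultimately show ?case by blast
    next
      case (add a b)
      then obtain N M f h where *: "f \<in> polys ?A" "x g ^ N * a = poly f (x g)"
        "h \<in> polys ?A" "x g ^ M * b = poly h (x g)" by blast
      have "x g ^ (N + M) * (a + b) = x g ^ M * (x g ^ N * a) + x g ^ N * (x g ^ M * b)"
        by (simp add: power_add algebra_simps)
      also have "\<dots> = poly (Polynomial.monom 1 M * f + Polynomial.monom 1 N * h) (x g)"
        unfolding * by (simp add: poly_monom)
      finally show ?case
        using * polys_closed(3,5,6) [OF A'] unital_subringD(1) [OF A'] by blast
    qed
  qed
qed

section \<open>Extension and incomparability of primes\<close>

text \<open>\<open>R\<close> is contained in the localisation of the polynomial ring \<open>A[y]\<close> at \<open>D\<close>.\<close>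

lemma prime_extension:
  assumes A: "unital_subring A" and Q: "prime_in A Q" and R: "unital_subring R"
    and transc: "\<And>f. f \<in> polys A \<Longrightarrow> poly f y = 0 \<Longrightarrow> f = 0"
    and D: "1 \<in> D" "\<And>d e. d \<in> D \<Longrightarrow> e \<in> D \<Longrightarrow> d * e \<in> D"
      "\<And>d. d \<in> D \<Longrightarrow> \<exists>f\<in>polys A. f \<notin> polys Q \<and> d = poly f y"
    and frac: "\<And>r. r \<in> R \<Longrightarrow> \<exists>d\<in>D. \<exists>f\<in>polys A. d * r = poly f y"
  shows "prime_in R {r \<in> R. \<exists>d\<in>D. \<exists>f\<in>polys Q. d * r = poly f y}" (is "prime_in R ?Q")
proof -
  note I = prime_inD(1) [OF Q]
  have QA: "polys Q \<subseteq> polys A" using ideal_inD(1) [OF I] by (auto simp: polys_def)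
  have inj: "f = g" if "f \<in> polys A" "g \<in> polys A" "poly f y = poly g y" for f g
    using transc [of "f - g"] polys_closed(4) [OF A that(1,2)] that(3) by simp
  have Q0: "0 \<in> polys Q" using ideal_inD(2) [OF I] by (simp add: polys_def)
  show ?thesis
    unfolding prime_in_def ideal_in_def
  proof (intro conjI ballI impI)
    show "?Q \<subseteq> R" by blast
    show "0 \<in> ?Q" using D(1) Q0 unital_subringD(2) [OF R] by force
    show "x + y' \<in> ?Q" if xy: "x \<in> ?Q" "y' \<in> ?Q" for x y'
    proof -
      obtain d f e g where *: "d \<in> D" "f \<in> polys Q" "d * x = poly f y"
        "e \<in> D" "g \<in> polys Q" "e * y' = poly g y" using xy by blast
      obtain d' e' where d': "d' \<in> polys A" "d = poly d' y" and e': "e' \<in> polys A" "e = poly e' y"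
        using D(3) *(1,4) by metis
      have "(d * e) * (x + y') = e * (d * x) + d * (e * y')" by (simp add: algebra_simps)
      also have "\<dots> = poly (e' * f + d' * g) y" unfolding *(3,6) by (simp add: d' e')
      finally show ?thesis
        using xy D(2) [OF *(1,4)] unital_subringD(6) [OF R]
          ideal_in_add_closed [OF I polys_mult_left [OF I e'(1) *(2)] polys_mult_left [OF I d'(1) *(5)]]
        by blast
    qed
    show "r * x \<in> ?Q" if r: "r \<in> R" and x: "x \<in> ?Q" for r x
    proof -
      obtain d f where *: "d \<in> D" "f \<in> polys Q" "d * x = poly f y" using x by blast
      obtain e g where e: "e \<in> D" "g \<in> polys A" "e * r = poly g y" using frac [OF r] by blast
      have "(e * d) * (r * x) = (e * r) * (d * x)" by (simp add: mult_ac)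
      also have "\<dots> = poly (g * f) y" by (simp add: e *)
      finally show ?thesis
        using r x D(2) [OF e(1) *(1)] polys_mult_left [OF I e(2) *(2)] unital_subringD(4) [OF R] by blast
    qed
    show "1 \<notin> ?Q"
    proof
      assume "1 \<in> ?Q"
      then obtain d f where *: "d \<in> D" "f \<in> polys Q" "d = poly f y" by auto
      \<comment> \<open>The denominator d is now the value of a polynomial over Q and of one outside
        \<open>polys Q\<close>. Transcendence of y identifies the two.\<close>
      then obtain g where g: "g \<in> polys A" "g \<notin> polys Q" "d = poly g y" using D(3) by blast
      have "f = g" using * g QA by (intro inj) auto
      then show False using * g by blast
    qed
    show "a \<in> ?Q \<or> b \<in> ?Q" if ab: "a \<in> R" "b \<in> R" "a * b \<in> ?Q" for a b
    proof -
      obtain d f where d: "d \<in> D" "f \<in> polys A" "d * a = poly f y" using frac [OF ab(1)] by blast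
      obtain e g where e: "e \<in> D" "g \<in> polys A" "e * b = poly g y" using frac [OF ab(2)] by blast
      obtain c h where c: "c \<in> D" "h \<in> polys Q" "c * (a * b) = poly h y" using ab(3) by blast
      obtain d' e' c' where d': "d' \<in> polys A" "d = poly d' y" and e': "e' \<in> polys A" "e = poly e' y"
        and c': "c' \<in> polys A" "c' \<notin> polys Q" "c = poly c' y"
        using D(3) d(1) e(1) c(1) by metis
      have "poly (c' * (f * g)) y = c * ((d * a) * (e * b))" by (simp add: c' d e)
      also have "\<dots> = d * e * (c * (a * b))" by (simp add: mult_ac)
      also have "\<dots> = poly (d' * (e' * h)) y" unfolding c(3) by (simp add: d' e' mult_ac)
      finally have "c' * (f * g) = d' * (e' * h)"
        using c' d d' e e' c QA by (intro inj polys_closed(5) [OF A]) auto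
      moreover have "d' * (e' * h) \<in> polys Q"
        using c d' e' by (intro polys_mult_left [OF I])
      ultimately have "c' * (f * g) \<in> polys Q" by simp
      then have "f \<in> polys Q \<or> g \<in> polys Q"
        using polys_prime [OF A Q] polys_closed(5) [OF A] c' d(2) e(2) by metis
      then show ?thesis using ab d e by blast
    qed
  qed
qed

text \<open>Gaussian elimination over the domain L / (Q \<inter> L), carried out on representatives:
  more than \<open>card E\<close> elements in the span of E satisfy a relation modulo Q that is
  nontrivial modulo Q.\<close>

lemma linear_dependence_mod_prime:
  assumes R: "unital_subring R" and Q: "prime_in R Q" and L: "unital_subring L" "L \<subseteq> R"
    and "finite E" "E \<subseteq> R" "finite T" "card E < card T" "\<And>i. i \<in> T \<Longrightarrow> w i \<in> lin_span L E"
  shows "\<exists>c. (\<forall>i\<in>T. c i \<in> L) \<and> (\<exists>i\<in>T. c i \<notin> Q) \<and> (\<Sum>i\<in>T. c i * w i) \<in> Q"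
  using assms(5-9)
proof (induction E arbitrary: T w rule: finite_induct)
  case empty
  have w: "w i = 0" if "i \<in> T" for i
    using empty.prems(4) [OF that] by cases auto
  have "T \<noteq> {}" using empty.prems by auto
  then show ?case
    using w ideal_inD(2) [OF prime_inD(1) [OF Q]] prime_inD(2) [OF Q] unital_subringD(1) [OF L(1)]
    by (intro exI [of _ "\<lambda>_. 1"]) auto
next
  case (insert e E)
  note I = prime_inD(1) [OF Q]
  have "\<exists>l u. l \<in> L \<and> u \<in> lin_span L E \<and> w i = l * e + u" if "i \<in> T" for i
    using lin_span_insertE [OF insert.prems(4) [OF that] L(1)] by metis
  then obtain l u where lu: "\<And>i. i \<in> T \<Longrightarrow> l i \<in> L \<and> u i \<in> lin_span L E \<and> w i = l i * e + u i"
    by metis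
  have e: "e \<in> R" using insert.prems by auto
  show ?case
  proof (cases "\<forall>i\<in>T. l i \<in> Q")
    \<comment> \<open>The generator e then contributes only elements of Q, and the induction
      hypothesis applies to the remainders \<open>u i\<close>.\<close>
    case True
    obtain c where c: "\<forall>i\<in>T. c i \<in> L" "\<exists>i\<in>T. c i \<notin> Q" "(\<Sum>i\<in>T. c i * u i) \<in> Q"
      using insert.IH [of T u] insert.prems insert.hyps lu by auto
    have "(\<Sum>i\<in>T. c i * w i) = (\<Sum>i\<in>T. (c i * e) * l i) + (\<Sum>i\<in>T. c i * u i)"
      unfolding sum.distrib [symmetric] by (rule sum.cong) (auto simp: lu algebra_simps)
    moreover have "(\<Sum>i\<in>T. (c i * e) * l i) \<in> Q"
      using True c(1) e L(2) unital_subringD(4) [OF R]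
      by (intro ideal_in_sum [OF I] ideal_inD(4) [OF I]) auto
    ultimately show ?thesis using c ideal_inD(3) [OF I] by metis
  next
    case False
    then obtain r where r: "r \<in> T" "l r \<notin> Q" by blast
    let ?T = "T - {r}"
    have "l r * u i - l i * u r \<in> lin_span L E" if "i \<in> ?T" for i
    proof -
      have "l r * u i + (- l i) * u r \<in> lin_span L E"
        using lu that r unital_subringD(5) [OF L(1)] by (intro lin_span_add lin_span_scale [OF L(1)]) auto
      then show ?thesis by simp
    qed
    moreover have "card E < card ?T" using insert.prems insert.hyps r by simp
    ultimately obtain c where c: "\<forall>i\<in>?T. c i \<in> L" "\<exists>i\<in>?T. c i \<notin> Q"
      "(\<Sum>i\<in>?T. c i * (l r * u i - l i * u r)) \<in> Q"
      using insert.IH [of ?T "\<lambda>i. l r * u i - l i * u r"] insert.prems by auto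
    \<comment> \<open>Cross-multiplication with the pivot \<open>l r\<close> eliminates e without
      division, and primality of Q keeps \<open>c i * l r\<close> outside Q whenever
      \<open>c i\<close> is.\<close>
    define c' where "c' i = (if i = r then - (\<Sum>i\<in>?T. c i * l i) else c i * l r)" for i
    have "(\<Sum>i\<in>T. c' i * w i) = c' r * w r + (\<Sum>i\<in>?T. c' i * w i)"
      using insert.prems r by (intro sum.remove) auto
    also have "\<dots> = (\<Sum>i\<in>?T. c i * l r * w i - c i * l i * w r)"
      by (simp add: c'_def sum_subtractf sum_distrib_right)
    also have "\<dots> = (\<Sum>i\<in>?T. c i * (l r * u i - l i * u r))"
      using lu r by (intro sum.cong) (auto simp: algebra_simps)
    finally have "(\<Sum>i\<in>T. c' i * w i) \<in> Q" using c(3) by simp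
    moreover have "\<forall>i\<in>T. c' i \<in> L"
      using c(1) lu r by (auto simp: c'_def intro!: unital_subringD(4,5) [OF L(1)] unital_subring_sum [OF L(1)])
    moreover have "\<exists>i\<in>T. c' i \<notin> Q"
    proof -
      obtain i where i: "i \<in> ?T" "c i \<notin> Q" using c(2) by blast
      then have "c i * l r \<notin> Q" using prime_inD(3) [OF Q, of "c i" "l r"] r c(1) lu L(2) by blast
      then show ?thesis using i by (intro bexI [of _ i]) (auto simp: c'_def)
    qed
    ultimately show ?thesis by blast
  qed
qed

text \<open>For a in P but not in Q, the powers of a satisfy a relation modulo Q with some
  coefficient outside Q. Let \<open>c m\<close> be the lowest such coefficient. Dropping the terms
  below it and cancelling a^m puts \<open>c m + a * s\<close> into Q, so \<open>c m\<close> lies in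
  P \<inter> L but not in Q.\<close>

lemma incomparability:
  assumes R: "unital_subring R" and L: "unital_subring L" "L \<subseteq> R"
    and alg: "\<And>a. a \<in> R \<Longrightarrow> \<exists>E. finite E \<and> E \<subseteq> R \<and> (\<forall>n. a ^ n \<in> lin_span L E)"
    and Q: "prime_in R Q" and P: "prime_in R P" and QP: "Q \<subseteq> P" "P \<inter> L \<subseteq> Q"
  shows "P = Q"
proof (rule ccontr)
  assume "P \<noteq> Q"
  then obtain a where a: "a \<in> P" "a \<notin> Q" using QP by blast
  note IQ = prime_inD(1) [OF Q] and IP = prime_inD(1) [OF P]
  have aR: "a \<in> R" using ideal_inD(1) [OF IP a(1)] .
  obtain E where E: "finite E" "E \<subseteq> R" "\<And>n. a ^ n \<in> lin_span L E" using alg [OF aR] by blast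
  have "\<exists>c. (\<forall>i\<in>{..card E}. c i \<in> L) \<and> (\<exists>i\<in>{..card E}. c i \<notin> Q) \<and> (\<Sum>i\<in>{..card E}. c i * a ^ i) \<in> Q"
    using E by (intro linear_dependence_mod_prime [OF R Q L E(1,2)]) auto
  then obtain c where c: "\<And>i. i \<le> card E \<Longrightarrow> c i \<in> L" "\<exists>i\<le>card E. c i \<notin> Q"
    "(\<Sum>i\<le>card E. c i * a ^ i) \<in> Q" by auto
  define m where "m = (LEAST i. i \<le> card E \<and> c i \<notin> Q)"
  have m: "m \<le> card E" "c m \<notin> Q" "\<And>i. i < m \<Longrightarrow> c i \<in> Q"
  proof -
    show "m \<le> card E" "c m \<notin> Q" using LeastI_ex [of "\<lambda>i. i \<le> card E \<and> c i \<notin> Q"] c(2) by (auto simp: m_def)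
    then show "\<And>i. i < m \<Longrightarrow> c i \<in> Q"
      using not_less_Least [of _ "\<lambda>i. i \<le> card E \<and> c i \<notin> Q"] by (metis less_trans_Suc less_or_eq_imp_le m_def le_trans)
  qed
  define s where "s = (\<Sum>i\<in>{m<..card E}. c i * a ^ (i - Suc m))"
  have cR: "i \<le> card E \<Longrightarrow> c i \<in> R" for i using c(1) L(2) by blast
  have "s \<in> R"
    unfolding s_def using aR cR
    by (intro unital_subring_sum [OF R] unital_subringD(4,7) [OF R]) auto
  have split: "{..card E} = {..<m} \<union> ({m} \<union> {m<..card E})" using m(1) by auto
  have "(\<Sum>i\<le>card E. c i * a ^ i) = (\<Sum>i<m. c i * a ^ i) + (c m * a ^ m + (\<Sum>i\<in>{m<..card E}. c i * a ^ i))"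
    unfolding split by (subst sum.union_disjoint; (simp; fail | auto)?)+
  also have "(\<Sum>i\<in>{m<..card E}. c i * a ^ i) = a ^ m * (a * s)"
    unfolding s_def sum_distrib_left
  proof (rule sum.cong [OF refl])
    fix i assume "i \<in> {m<..card E}"
    then have "i = m + Suc (i - Suc m)" by simp
    then have "a ^ i = a ^ m * a ^ Suc (i - Suc m)" by (metis power_add)
    then show "c i * a ^ i = a ^ m * (a * (c i * a ^ (i - Suc m)))" by (simp add: mult_ac)
  qed
  finally have "(\<Sum>i\<le>card E. c i * a ^ i) - (\<Sum>i<m. c i * a ^ i) = a ^ m * (c m + a * s)"
    by (simp add: algebra_simps)
  moreover have "(\<Sum>i<m. c i * a ^ i) \<in> Q"
    using m(3) by (intro ideal_in_sum [OF IQ] ideal_inD(5) [OF IQ] unital_subringD(7) [OF R aR]) auto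
  ultimately have prod: "a ^ m * (c m + a * s) \<in> Q"
    using ideal_in_diff [OF R IQ c(3)] by metis
  have "a ^ n \<notin> Q" for n
    using prime_inD(2) [OF Q] prime_inD(3) [OF Q aR unital_subringD(7) [OF R aR]] a(2)
    by (induction n) auto
  then have "c m + a * s \<in> Q"
    using prime_inD(3) [OF Q _ _ prod] aR \<open>s \<in> R\<close> cR [OF m(1)]
      unital_subringD(4,6,7) [OF R] by blast
  then have "(c m + a * s) - a * s \<in> P"
    using QP(1) ideal_inD(5) [OF IP \<open>s \<in> R\<close> a(1)] by (intro ideal_in_diff [OF R IP]) auto
  then have "c m \<in> P" by simp
  then show False using QP(2) c(1) [OF m(1)] m(2) by blast
qed

text \<open>The projection turns an R-combination of elements of I into an A-combination. Hence
  finitely many elements of I that generate its extension to R already generate I.\<close>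

lemma noetherian_subring_retract:
  assumes R: "noetherian_subring R" and A: "unital_subring A" "A \<subseteq> R"
    and \<pi>: "\<And>r. r \<in> R \<Longrightarrow> \<pi> r \<in> A" "\<And>r s. r \<in> R \<Longrightarrow> s \<in> R \<Longrightarrow> \<pi> (r + s) = \<pi> r + \<pi> s"
      "\<And>r a. r \<in> R \<Longrightarrow> a \<in> A \<Longrightarrow> \<pi> (r * a) = \<pi> r * a" "\<And>a. a \<in> A \<Longrightarrow> \<pi> a = a"
  shows "noetherian_subring A"
  unfolding noetherian_subring_def
proof (intro conjI allI impI)
  show "unital_subring A" by fact
  fix I assume I: "ideal_in A I"
  have R': "unital_subring R" using R by (simp add: noetherian_subring_def)
  have IA: "I \<subseteq> A" using ideal_inD(1) [OF I] by blast
  obtain F where F: "finite F" "F \<subseteq> I" "lin_span R I \<subseteq> lin_span R F"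
    using noetherian_subring_finite_generators [OF R, of I] IA A(2) by blast
  have "x \<in> R \<and> \<pi> x \<in> lin_span A F" if "x \<in> lin_span R F" for x
    using that
  proof (induction rule: lin_span_induct)
    case zero
    then show ?case using \<pi>(4) [of 0] unital_subringD(2) [OF A(1)] A(2) lin_span.zero by auto
  next
    case (gen r a)
    then have "a \<in> A" "a \<in> R" using F(2) IA A(2) by auto
    then show ?case
      using gen \<pi>(1,3) unital_subringD(4) [OF R'] by (auto intro: lin_span_gen)
  next
    case (add x y)
    then show ?case using \<pi>(2) unital_subringD(6) [OF R'] lin_span_add by metis
  qed
  moreover have "I \<subseteq> lin_span R F" using F(3) lin_span_base [OF R'] by blast
  ultimately have "I \<subseteq> lin_span A F" using \<pi>(4) IA by (metis subset_iff)
  then show "fin_gen A I" using F unfolding fin_gen_def by blast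
qed

section \<open>Integer multiples in abelian groups\<close>

definition zmul :: "int \<Rightarrow> 'g::ab_group_add \<Rightarrow> 'g" where
  "zmul k g = (if 0 \<le> k then \<Sum>i<nat k. g else - (\<Sum>i<nat (- k). g))"

lemma zmul_0 [simp]: "zmul 0 g = 0" and zmul_1 [simp]: "zmul 1 g = g"
  by (simp_all add: zmul_def)

lemma zmul_succ: "zmul (k + 1) g = zmul k g + g"
proof (cases "0 \<le> k")
  case True
  then have "nat (k + 1) = Suc (nat k)" by simp
  then show ?thesis using True by (simp add: zmul_def)
next
  case False
  then have "nat (- k) = Suc (nat (- (k + 1)))" by simp
  then show ?thesis using False by (auto simp: zmul_def)
qed

lemma zmul_add: "zmul (a + b) g = zmul a g + zmul b g"
proof (induction b rule: int_induct [where k = 0])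
  case (step1 i)
  then show ?case using zmul_succ [of "a + i" g] zmul_succ [of i g] by (simp add: add.assoc)
next
  case (step2 i)
  then show ?case using zmul_succ [of "a + (i - 1)" g] zmul_succ [of "i - 1" g] by (simp add: algebra_simps)
qed simp

lemma zmul_minus: "zmul (- a) g = - zmul a g"
  using zmul_add [of a "- a" g] by (simp add: eq_neg_iff_add_eq_0 add.commute)

lemma zmul_diff: "zmul (a - b) g = zmul a g - zmul b g"
  using zmul_add [of a "- b" g] by (simp add: zmul_minus)

lemma zmul_add_right: "zmul a (g + h) = zmul a g + zmul a h"
proof (induction a rule: int_induct [where k = 0])
  case (step1 i)
  then show ?case unfolding zmul_succ by (simp add: algebra_simps)
next
  case (step2 i)
  then show ?case using zmul_succ [of "i - 1" "g + h"] zmul_succ [of "i - 1" g] zmul_succ [of "i - 1" h]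
    by (simp add: algebra_simps)
qed simp

lemma zmul_0_right [simp]: "zmul a 0 = 0"
  using zmul_add_right [of a 0 0] by simp

lemma zmul_mult: "zmul (a * b) g = zmul a (zmul b g)"
proof (induction a rule: int_induct [where k = 0])
  case (step1 i)
  then show ?case by (simp add: zmul_succ zmul_add distrib_right)
next
  case (step2 i)
  then show ?case using zmul_succ [of "i - 1" "zmul b g"] zmul_add [of "(i - 1) * b" b g]
    by (simp add: algebra_simps)
qed simp

lemma additive_zmul:
  fixes f :: "'g::ab_group_add \<Rightarrow> 'r::ring_1"
  assumes "\<And>x y. f (x + y) = f x + f y"
  shows "f (zmul k g) = of_int k * f g"
proof (induction k rule: int_induct [where k = 0])
  case base
  then show ?case using assms [of 0 0] by simp
next
  case (step1 i)
  then show ?case by (simp add: zmul_succ assms distrib_right)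
next
  case (step2 i)
  then show ?case using zmul_succ [of "i - 1" g] assms [of "zmul (i - 1) g" g] by (simp add: algebra_simps)
qed

lemma torsion_free_zmul:
  assumes "torsion_free TYPE('g::ab_group_add)" "zmul k (g::'g) = 0" "k \<noteq> 0"
  shows "g = 0"
proof -
  have "zmul \<bar>k\<bar> g = 0" using assms(2) by (simp add: abs_if zmul_minus)
  then have "(\<Sum>i<nat \<bar>k\<bar>. g) = 0" by (simp add: zmul_def)
  then show ?thesis using assms unfolding torsion_free_def by (metis zero_less_abs_iff zero_less_nat_eq)
qed

lemma zmul_group_closure: "g \<in> group_closure S \<Longrightarrow> zmul k g \<in> group_closure S"
proof (induction k rule: int_induct [where k = 0])
  case (step1 i)
  then show ?case by (simp add: zmul_succ group_closure_add)
next
  case (step2 i)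
  then show ?case using zmul_diff [of i 1 g] group_closure.diff by fastforce
qed simp

lemma sum_group_closure: "(\<And>i. i \<in> T \<Longrightarrow> f i \<in> group_closure S) \<Longrightarrow> sum f T \<in> group_closure S"
  by (induction T rule: infinite_finite_induct) (auto intro: group_closure_add)

lemma group_closure_subset: "S \<subseteq> group_closure T \<Longrightarrow> group_closure S \<subseteq> group_closure T"
proof
  fix x assume "x \<in> group_closure S" "S \<subseteq> group_closure T"
  then show "x \<in> group_closure T"
    by (induction rule: group_closure.induct) (auto intro: group_closure.diff)
qed

lemma group_closure_combination:
  assumes "finite S" "g \<in> group_closure S"
  obtains a where "g = (\<Sum>s\<in>S. zmul (a s) s)"
proof -
  have "\<exists>a. g = (\<Sum>s\<in>S. zmul (a s) s)"
    using assms(2)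
  proof induction
    case (base g)
    show ?case
    proof (cases "g \<in> S")
      case True
      have "(\<Sum>s\<in>S. zmul (if s = g then 1 else 0) s) = (\<Sum>s\<in>S. if s = g then s else 0)"
        by (rule sum.cong) auto
      then show ?thesis using assms(1) True by (intro exI [of _ "\<lambda>s. if s = g then 1 else 0"]) simp
    next
      case False
      then show ?thesis using base by (intro exI [of _ "\<lambda>_. 0"]) simp
    qed
  next
    case (diff g h)
    then obtain a b where "g = (\<Sum>s\<in>S. zmul (a s) s)" "h = (\<Sum>s\<in>S. zmul (b s) s)" by blast
    then show ?case by (intro exI [of _ "\<lambda>s. a s - b s"]) (simp add: zmul_diff sum_subtractf)
  qed
  then show thesis using that by blast
qed

section \<open>Finitely generated torsion-free groups are free\<close>

text \<open>Euclid's algorithm on the coefficients of a relation, which changes generators but not their number.\<close>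

lemma minimal_generators_independent:
  fixes S :: "'g::ab_group_add set"
  assumes tf: "torsion_free TYPE('g)"
    and min: "\<And>T :: 'g set. finite T \<Longrightarrow> group_closure T = UNIV \<Longrightarrow> n \<le> card T"
    and "finite S" "group_closure S = UNIV" "card S = n" "(\<Sum>s\<in>S. zmul (a s) s) = 0" "s\<^sub>0 \<in> S"
  shows "a s\<^sub>0 = 0"
proof (rule ccontr)
  assume "a s\<^sub>0 \<noteq> 0"
  then have "\<exists>s\<in>S. a s \<noteq> 0" using assms(7) by blast
  then show False
    using assms(3-6)
  proof (induction "\<Sum>s\<in>S. nat \<bar>a s\<bar>" arbitrary: S a rule: less_induct)
    case less
    obtain p where p: "p \<in> S" "a p \<noteq> 0" using less.prems by blast
    \<comment> \<open>With a single nonzero coefficient, torsion-freeness would make the generator p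
      zero, and dropping it would contradict minimality.\<close>
    have "\<exists>q\<in>S. q \<noteq> p \<and> a q \<noteq> 0"
    proof (rule ccontr)
      assume "\<not> ?thesis"
      then have "(\<Sum>s\<in>S - {p}. zmul (a s) s) = 0" by (intro sum.neutral) auto
      then have "zmul (a p) p = 0"
        using less.prems(5) sum.remove [OF less.prems(2) p(1), of "\<lambda>s. zmul (a s) s"] by simp
      then have "p = 0" using torsion_free_zmul [OF tf] p by blast
      then have "group_closure (S - {p}) = UNIV"
        using less.prems(3) p group_closure_insert_zero [of "S - {p}"] by (metis insert_Diff)
      then have "n \<le> card (S - {p})" using less.prems by (intro min) auto
      moreover have "card (S - {p}) < card S" using p(1) less.prems(2) by (rule card_Diff1_less [rotated])
      ultimately show False using less.prems(4) by simp
    qed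
    then obtain q where q: "q \<in> S" "q \<noteq> p" "a q \<noteq> 0" by blast
    have step: False if pq: "p \<in> S" "q \<in> S" "p \<noteq> q" "a p \<noteq> 0" "a q \<noteq> 0" "\<bar>a q\<bar> \<le> \<bar>a p\<bar>" for p q
    proof -
      \<comment> \<open>With this sign the coefficient of p becomes \<open>a p - t * a q\<close>,
        whose absolute value is that of \<open>a p\<close> minus that of \<open>a q\<close>.
        Replacing q by \<open>q + zmul t p\<close> compensates for the change, so the relation
        persists.\<close>
      define t where "t = sgn (a p) * sgn (a q)"
      define q' where "q' = q + zmul t p"
      let ?U = "S - {q}"
      let ?S = "insert q' ?U"
      have U: "finite ?U" "p \<in> ?U" "card ?U < n"
        using pq less.prems(2,4) card_Diff1_less [of S q] by auto
      have pcl: "p \<in> group_closure ?S" "q' \<in> group_closure ?S"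
        using U by (auto intro: group_closure.base)
      have "S \<subseteq> group_closure ?S"
      proof
        fix s assume "s \<in> S"
        show "s \<in> group_closure ?S"
        proof (cases "s = q")
          case True
          then have "s = q' - zmul t p" by (simp add: q'_def)
          then show ?thesis using pcl by (metis group_closure.diff zmul_group_closure)
        next
          case False
          then show ?thesis using \<open>s \<in> S\<close> by (intro group_closure.base) auto
        qed
      qed
      then have gen: "group_closure ?S = UNIV"
        using group_closure_subset [of S ?S] less.prems(3) by blast
      then have nS: "n \<le> card ?S" using U by (intro min) auto
      \<comment> \<open>If the new generator were already present, fewer than n elements would
        generate the group.\<close>
      have new: "q' \<notin> ?U"
      proof
        assume "q' \<in> ?U"
        then have "?S = ?U" by (rule insert_absorb)
        then show False using nS U(3) by simp
      qed
      define b where "b s = (if s = q' then a q else if s = p then a p - t * a q else a s)" for s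
      have q'p: "q' \<noteq> p" using new U by blast
      have "(\<Sum>s\<in>?S. zmul (b s) s) = zmul (a q) q' + (\<Sum>s\<in>?U. zmul (b s) s)"
        using U new by (subst sum.insert) (auto simp: b_def)
      also have "(\<Sum>s\<in>?U. zmul (b s) s) = zmul (a p - t * a q) p + (\<Sum>s\<in>?U - {p}. zmul (b s) s)"
        using U q'p by (subst sum.remove [OF U(1,2)]) (auto simp: b_def)
      also have "(\<Sum>s\<in>?U - {p}. zmul (b s) s) = (\<Sum>s\<in>?U - {p}. zmul (a s) s)"
        using new by (intro sum.cong) (auto simp: b_def)
      also have "zmul (a q) q' + (zmul (a p - t * a q) p + (\<Sum>s\<in>?U - {p}. zmul (a s) s)) =
          zmul (a q) q + (zmul (a p) p + (\<Sum>s\<in>?U - {p}. zmul (a s) s))"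
        by (simp add: q'_def zmul_add_right zmul_diff mult.commute flip: zmul_mult)
      also have "\<dots> = (\<Sum>s\<in>S. zmul (a s) s)"
        using sum.remove [OF less.prems(2) pq(2), of "\<lambda>s. zmul (a s) s"]
          sum.remove [OF U(1,2), of "\<lambda>s. zmul (a s) s"] by simp
      finally have rel: "(\<Sum>s\<in>?S. zmul (b s) s) = 0" using less.prems(5) by simp
      have "(\<Sum>s\<in>?S. nat \<bar>b s\<bar>) = nat \<bar>a q\<bar> + (\<Sum>s\<in>?U. nat \<bar>b s\<bar>)"
        using U new by (subst sum.insert) (auto simp: b_def)
      also have "(\<Sum>s\<in>?U. nat \<bar>b s\<bar>) = nat \<bar>a p - t * a q\<bar> + (\<Sum>s\<in>?U - {p}. nat \<bar>b s\<bar>)"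
        using U q'p by (subst sum.remove [OF U(1,2)]) (auto simp: b_def)
      also have "(\<Sum>s\<in>?U - {p}. nat \<bar>b s\<bar>) = (\<Sum>s\<in>?U - {p}. nat \<bar>a s\<bar>)"
        using new by (intro sum.cong) (auto simp: b_def)
      also have "nat \<bar>a q\<bar> + (nat \<bar>a p - t * a q\<bar> + (\<Sum>s\<in>?U - {p}. nat \<bar>a s\<bar>)) <
          nat \<bar>a q\<bar> + (nat \<bar>a p\<bar> + (\<Sum>s\<in>?U - {p}. nat \<bar>a s\<bar>))"
      proof -
        have "\<bar>a p - t * a q\<bar> < \<bar>a p\<bar>"
          using pq(4-6) unfolding t_def by (cases "0 < a p"; cases "0 < a q"; simp)
        then show ?thesis by linarith
      qed
      also have "\<dots> = (\<Sum>s\<in>S. nat \<bar>a s\<bar>)"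
        using sum.remove [OF less.prems(2) pq(2), of "\<lambda>s. nat \<bar>a s\<bar>"]
          sum.remove [OF U(1,2), of "\<lambda>s. nat \<bar>a s\<bar>"] by simp
      finally have "(\<Sum>s\<in>?S. nat \<bar>b s\<bar>) < (\<Sum>s\<in>S. nat \<bar>a s\<bar>)" .
      moreover have "\<exists>s\<in>?S. b s \<noteq> 0" using pq by (auto simp: b_def)
      moreover have "card ?S = n" using nS U by (simp add: card_insert_if split: if_splits)
      ultimately show False using less.hyps [of b ?S] gen rel U by simp
    qed
    show False
      using step [of p q] step [of q p] p q by (cases "\<bar>a q\<bar> \<le> \<bar>a p\<bar>") auto
  qed
qed

text \<open>A generating set of least cardinality satisfies no nontrivial relation, so the
  coordinates with respect to it are well defined and give the isomorphism.\<close>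

lemma finitely_generated_imp_finite_free:
  assumes tf: "torsion_free TYPE('g::ab_group_add)" and fg: "finitely_generated TYPE('g)"
  shows "finite_free TYPE('g)"
proof -
  define n where "n = (LEAST n. \<exists>S::'g set. finite S \<and> group_closure S = UNIV \<and> card S = n)"
  have "\<exists>n. \<exists>S::'g set. finite S \<and> group_closure S = UNIV \<and> card S = n"
    using fg by (auto simp: finitely_generated_def)
  then have "\<exists>S::'g set. finite S \<and> group_closure S = UNIV \<and> card S = n"
    unfolding n_def by (rule LeastI_ex)
  then obtain S :: "'g set" where S: "finite S" "group_closure S = UNIV" "card S = n" by blast
  have min: "n \<le> card T" if "finite T" "group_closure T = UNIV" for T :: "'g set"
    unfolding n_def using that by (intro Least_le) blast
  obtain e where e: "bij_betw e {..<n} S"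
    using ex_bij_betw_nat_finite [OF S(1)] S(3) by (auto simp: atLeast0LessThan)
  define c where "c v = (\<Sum>i<n. zmul (v i) (e i))" for v
  have c_S: "c v = (\<Sum>s\<in>S. zmul (v (the_inv_into {..<n} e s)) s)" for v
    unfolding c_def
  proof (rule sum.reindex_bij_betw [OF e, THEN sym, THEN trans, THEN sym])
    show "(\<Sum>i<n. zmul (v (the_inv_into {..<n} e (e i))) (e i)) = (\<Sum>i<n. zmul (v i) (e i))"
      using e by (intro sum.cong) (auto simp: bij_betw_def the_inv_into_f_f)
  qed
  let ?V = "{v::nat \<Rightarrow> int. \<forall>i\<ge>n. v i = 0}"
  have c_add: "c (\<lambda>i. v i + w i) = c v + c w" for v w
    by (simp add: c_def zmul_add sum.distrib)
  have "bij_betw c ?V UNIV"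
    unfolding bij_betw_def
  proof
    show "inj_on c ?V"
    proof (rule inj_onI)
      fix v w assume vw: "v \<in> ?V" "w \<in> ?V" "c v = c w"
      have "c (\<lambda>i. v i - w i) = 0" using vw(3) by (simp add: c_def zmul_diff sum_subtractf)
      then have rel: "(\<Sum>s\<in>S. zmul (v (the_inv_into {..<n} e s) - w (the_inv_into {..<n} e s)) s) = 0"
        by (simp add: c_S)
      have *: "v (the_inv_into {..<n} e s) - w (the_inv_into {..<n} e s) = 0" if "s \<in> S" for s
        by (rule minimal_generators_independent [OF tf _ S rel that]) (rule min)
      have "v i = w i" for i
      proof (cases "i < n")
        case True
        then show ?thesis
          using e * [of "e i"] by (auto simp: bij_betw_def the_inv_into_f_f)
      qed (use vw in auto)
      then show "v = w" by blast
    qed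
    have "g \<in> c ` ?V" for g
    proof -
      obtain a where a: "g = (\<Sum>s\<in>S. zmul (a s) s)"
        using group_closure_combination [OF S(1), of g] S(2) by auto
      have "g = (\<Sum>i<n. zmul (a (e i)) (e i))"
        unfolding a by (rule sum.reindex_bij_betw [OF e, symmetric])
      then have "g = c (\<lambda>i. if i < n then a (e i) else 0)" by (simp add: c_def)
      then show ?thesis by (intro image_eqI [of g c "\<lambda>i. if i < n then a (e i) else 0"]) auto
    qed
    then show "c ` ?V = UNIV" by blast
  qed
  moreover define f where "f = the_inv_into ?V c"
  ultimately have f: "bij_betw f UNIV ?V" "\<And>g. c (f g) = g"
    by (auto intro: bij_betw_the_inv_into simp: f_the_inv_into_f_bij_betw)
  have fV: "f g \<in> ?V" for g using f(1) by (auto simp: bij_betw_def)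
  have "f (a + b) = (\<lambda>i. f a i + f b i)" for a b
  proof -
    have "c (f (a + b)) = c (\<lambda>i. f a i + f b i)" by (simp add: f c_add)
    moreover have "(\<lambda>i. f a i + f b i) \<in> ?V" using fV by auto
    ultimately show ?thesis
      using \<open>bij_betw c ?V UNIV\<close> fV by (meson bij_betw_def inj_onD)
  qed
  then show ?thesis using f(1) unfolding finite_free_def by blast
qed

lemma finite_free_basis:
  assumes "finite_free TYPE('g::ab_group_add)"
  obtains n and e :: "nat \<Rightarrow> 'g::ab_group_add" and f :: "'g::ab_group_add \<Rightarrow> nat \<Rightarrow> int"
  where "\<And>g. g = (\<Sum>i<n. zmul (f g i) (e i))" "\<And>a b i. f (a + b) i = f a i + f b i"
proof -
  obtain n and f :: "'g \<Rightarrow> nat \<Rightarrow> int" where bij: "bij_betw f UNIV {v. \<forall>i\<ge>n. v i = 0}"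
    and f: "\<And>a b. f (a + b) = (\<lambda>i. f a i + f b i)"
    using assms unfolding finite_free_def by blast
  have inj: "f a = f b \<Longrightarrow> a = b" for a b using bij by (meson UNIV_I bij_betw_def inj_onD)
  have zero: "f a i = 0" if "n \<le> i" for a i using bij that by (auto simp: bij_betw_def)
  have "\<exists>g. f g = (\<lambda>j. if j = i then 1 else 0)" if "i < n" for i
  proof -
    have "(\<lambda>j. if j = i then 1 else 0) \<in> f ` UNIV" using bij that by (auto simp: bij_betw_def)
    then show ?thesis by (metis imageE)
  qed
  then obtain e where e: "\<And>i. i < n \<Longrightarrow> f (e i) = (\<lambda>j. if j = i then 1 else 0)" by metis
  have f_sum: "f (sum u T) j = (\<Sum>i\<in>T. f (u i) j)" for u and T :: "nat set" and j
  proof (induction T rule: infinite_finite_induct)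
    case empty
    have "f 0 j + f 0 j = f 0 j" using f [of 0 0] by (metis add.right_neutral)
    then show ?case by simp
  next
    case (infinite T)
    have "f 0 j + f 0 j = f 0 j" using f [of 0 0] by (metis add.right_neutral)
    then show ?case using infinite by simp
  qed (simp add: f)
  have "g = (\<Sum>i<n. zmul (f g i) (e i))" for g
  proof (rule inj, rule ext)
    fix j
    have "f (\<Sum>i<n. zmul (f g i) (e i)) j = (\<Sum>i<n. f (zmul (f g i) (e i)) j)" by (rule f_sum)
    also have "\<dots> = (\<Sum>i<n. f g i * f (e i) j)"
      using additive_zmul [of "\<lambda>g. f g j"] by (simp add: f)
    also have "\<dots> = (\<Sum>i<n. if j = i then f g i else 0)"
      by (intro sum.cong) (auto simp: e)
    also have "\<dots> = f g j" using zero [of j g] by auto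
    finally show "f g j = f (\<Sum>i<n. zmul (f g i) (e i)) j" by simp
  qed
  then show thesis using that f by metis
qed

lemma finite_free_imp_finitely_generated:
  assumes "finite_free TYPE('g::ab_group_add)"
  shows "finitely_generated TYPE('g)"
proof -
  obtain n and e :: "nat \<Rightarrow> 'g" and f :: "'g \<Rightarrow> nat \<Rightarrow> int"
    where g: "\<And>g::'g. g = (\<Sum>i<n. zmul (f g i) (e i))" and "\<And>a b i. f (a + b) i = f a i + f b i"
    by (rule finite_free_basis [OF assms]) blast
  have "g \<in> group_closure (e ` {..<n})" for g
    by (subst g [of g]) (intro sum_group_closure zmul_group_closure group_closure.base, auto)
  then have "group_closure (e ` {..<n}) = UNIV" by blast
  then show ?thesis unfolding finitely_generated_def by blast
qed

section \<open>Group rings\<close>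

text \<open>The passage from subsets of a type, where the arguments take place, to the rings with
  explicit carrier in the statement: images of ideals are ideals of the image, and injectivity
  brings the generators back.\<close>

lemma noetherian_ring_embedding:
  assumes S: "ring S" and h: "inj_on h (carrier S)"
    and add: "\<And>x y. x \<in> carrier S \<Longrightarrow> y \<in> carrier S \<Longrightarrow> h (x \<oplus>\<^bsub>S\<^esub> y) = h x + h y"
    and mult: "\<And>x y. x \<in> carrier S \<Longrightarrow> y \<in> carrier S \<Longrightarrow> h (x \<otimes>\<^bsub>S\<^esub> y) = h x * h y"
    and R: "noetherian_subring (h ` carrier S)"
  shows "noetherian_ring S"
proof -
  interpret S: ring S by fact
  have "h \<zero>\<^bsub>S\<^esub> + h \<zero>\<^bsub>S\<^esub> = h \<zero>\<^bsub>S\<^esub>" using add [of "\<zero>\<^bsub>S\<^esub>" "\<zero>\<^bsub>S\<^esub>"] by simp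
  then have h0: "h \<zero>\<^bsub>S\<^esub> = 0" by simp
  show ?thesis
  proof (rule S.noetherian_ringI)
    fix I assume I: "ideal I S"
    interpret I: ideal I S by fact
    have Ic: "I \<subseteq> carrier S" using I.Icarr by blast
    have "ideal_in (h ` carrier S) (h ` I)"
      unfolding ideal_in_def
    proof (intro conjI ballI)
      show "h ` I \<subseteq> h ` carrier S" using Ic by blast
      show "0 \<in> h ` I" using h0 I.zero_closed by (metis imageI)
      show "x + y \<in> h ` I" if xy: "x \<in> h ` I" "y \<in> h ` I" for x y
      proof -
        obtain a b where "a \<in> I" "b \<in> I" "x = h a" "y = h b" using xy by blast
        then show ?thesis using add [of a b] I.a_closed [of a b] Ic by (metis imageI subsetD)
      qed
      show "r * x \<in> h ` I" if rx: "r \<in> h ` carrier S" "x \<in> h ` I" for r x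
      proof -
        obtain s a where "s \<in> carrier S" "a \<in> I" "r = h s" "x = h a" using rx by blast
        then show ?thesis using mult [of s a] I.I_l_closed [of a s] Ic by (metis imageI subsetD)
      qed
    qed
    then obtain F where F: "finite F" "F \<subseteq> h ` I" "h ` I \<subseteq> lin_span (h ` carrier S) F"
      using R unfolding noetherian_subring_def fin_gen_def by blast
    obtain A where A: "A \<subseteq> I" "finite A" "F = h ` A"
      using finite_subset_image [OF F(1,2)] by blast
    have Ac: "A \<subseteq> carrier S" using A(1) Ic by blast
    interpret J: ideal "Idl\<^bsub>S\<^esub> A" S by (rule S.genideal_ideal [OF Ac])
    have "x \<in> h ` (Idl\<^bsub>S\<^esub> A)" if "x \<in> lin_span (h ` carrier S) F" for x
      using that
    proof (induction rule: lin_span_induct)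
      case zero
      then show ?case using h0 J.zero_closed by (metis imageI)
    next
      case (gen r u)
      then obtain s a where sa: "s \<in> carrier S" "a \<in> A" "r = h s" "u = h a" using A(3) by blast
      then have "s \<otimes>\<^bsub>S\<^esub> a \<in> Idl\<^bsub>S\<^esub> A" using S.genideal_self [OF Ac] J.I_l_closed by blast
      moreover have "r * u = h (s \<otimes>\<^bsub>S\<^esub> a)" using sa Ac mult by auto
      ultimately show ?case by blast
    next
      case (add x y)
      then obtain a b where ab: "a \<in> Idl\<^bsub>S\<^esub> A" "b \<in> Idl\<^bsub>S\<^esub> A" "x = h a" "y = h b" by blast
      then have "x + y = h (a \<oplus>\<^bsub>S\<^esub> b)" using assms(3) J.Icarr by metis
      then show ?case using J.a_closed [OF ab(1,2)] by blast
    qed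
    then have sub: "h ` I \<subseteq> h ` (Idl\<^bsub>S\<^esub> A)" using F(3) by blast
    have "I \<subseteq> Idl\<^bsub>S\<^esub> A"
    proof
      fix x assume x: "x \<in> I"
      then obtain z where "z \<in> Idl\<^bsub>S\<^esub> A" "h x = h z" using sub by blast
      then show "x \<in> Idl\<^bsub>S\<^esub> A" using inj_onD [OF h, of x z] x Ic J.Icarr by blast
    qed
    moreover have "Idl\<^bsub>S\<^esub> A \<subseteq> I" by (rule S.genideal_minimal [OF I A(1)])
    ultimately show "\<exists>A\<subseteq>carrier S. finite A \<and> I = Idl\<^bsub>S\<^esub> A" using Ac A(2) by blast
  qed
qed

lemma twisted_mult_trivial: "twisted_mult (\<lambda>_ _. 1) p q = p * q"
proof (induction p rule: poly_mapping_add_induct)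
  case single: (single f a)
  show ?case
    by (induction q rule: poly_mapping_add_induct)
      (simp_all add: twisted_mult_add_right distrib_left mult_single)
qed (simp_all add: twisted_mult_add_left distrib_right)

text \<open>A nonzero ideal in the image of a field is generated by any of its nonzero elements.
  This starts the induction of Laurent extensions at the field of constants.\<close>

lemma noetherian_subring_constants:
  fixes u :: "'k::field \<Rightarrow> 'r::comm_ring_1"
  assumes u: "u 1 = 1" "\<And>a b. u (a * b) = u a * u b" "\<And>a b. u (a - b) = u a - u b"
  shows "noetherian_subring (range u)"
  unfolding noetherian_subring_def
proof (intro conjI allI impI)
  have "1 \<in> range u" using u(1) by (metis rangeI)
  then show R: "unital_subring (range u)"
    unfolding unital_subring_def by (auto simp flip: u(2,3))
  fix I assume I: "ideal_in (range u) I"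
  show "fin_gen (range u) I"
  proof (cases "I = {0}")
    case True
    then show ?thesis unfolding fin_gen_def by (intro exI [of _ "{}"]) (auto intro: lin_span.zero)
  next
    case False
    then obtain x where x: "x \<in> I" "x \<noteq> 0" using ideal_inD(2) [OF I] by blast
    then obtain a where a: "x = u a" using ideal_inD(1) [OF I] by blast
    then have "a \<noteq> 0" using x(2) u(3) [of 0 0] by auto
    then have inv: "u (inverse a) * x = 1" using u(1) by (simp add: a flip: u(2))
    have "I \<subseteq> lin_span (range u) {x}"
    proof
      fix z assume "z \<in> I"
      then have "z * u (inverse a) \<in> range u" using ideal_inD(1) [OF I] unital_subringD(4) [OF R] by blast
      then have "(z * u (inverse a)) * x \<in> lin_span (range u) {x}" by (rule lin_span_gen) simp
      then show "z \<in> lin_span (range u) {x}" using inv by (simp add: mult.assoc)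
    qed
    then show ?thesis using x(1) unfolding fin_gen_def by blast
  qed
qed

lemma trivial_cocycle: "(\<lambda>_ _. 1) \<in> Z2S kstar"
  by (auto simp: Z2S_def Z2_def)

lemma noetherian_group_ring:
  assumes "finitely_generated TYPE('g::ab_group_add)"
  shows "noetherian_ring (twisted_ring (\<lambda>_ _. 1) :: ('g \<Rightarrow>\<^sub>0 'k::field) ring)"
proof -
  obtain S :: "'g set" where S: "finite S" "group_closure S = UNIV"
    using assms by (auto simp: finitely_generated_def)
  let ?C = "range (Poly_Mapping.single (0::'g)) :: ('g \<Rightarrow>\<^sub>0 'k) set"
  let ?x = "\<lambda>g::'g. Poly_Mapping.single g (1::'k)"
  have C: "noetherian_subring ?C"
    by (rule noetherian_subring_constants) (simp_all add: mult_single single_diff)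
  have "noetherian_subring (lin_span ?C (?x ` group_closure S))"
    by (rule noetherian_monomial_span [OF C S(1)]) (simp_all add: mult_single)
  moreover have "p \<in> lin_span ?C (?x ` UNIV)" for p
  proof (induction p rule: poly_mapping_add_induct)
    case (single g a)
    have "Poly_Mapping.single 0 a * ?x g \<in> lin_span ?C (?x ` UNIV)" by (intro lin_span_gen) auto
    then show ?case by (simp add: mult_single)
  qed (auto intro: lin_span.zero lin_span_add)
  ultimately have "noetherian_subring (UNIV :: ('g \<Rightarrow>\<^sub>0 'k) set)" using S(2) by (metis UNIV_eq_I)
  then show ?thesis
    using cring.axioms(1) [OF twisted_ring_cring [OF trivial_cocycle]]
    by (intro noetherian_ring_embedding [where h = id])
      (auto simp: twisted_ring_def twisted_mult_trivial)
qed

text \<open>The kernel of the projection of the group ring of \<open>G\<close> to the group ring of \<open>G / H\<close>.\<close>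

definition coset_kernel :: "'g::ab_group_add set \<Rightarrow> ('g \<Rightarrow>\<^sub>0 'k::field) set" where
  "coset_kernel H = {p. \<forall>g. (\<Sum>h | h \<in> Poly_Mapping.keys p \<and> h - g \<in> H. Poly_Mapping.lookup p h) = 0}"

lemma coset_sum_superset:
  assumes "finite T" "Poly_Mapping.keys p \<subseteq> T"
  shows "(\<Sum>h | h \<in> Poly_Mapping.keys p \<and> h - g \<in> H. Poly_Mapping.lookup p h) =
    (\<Sum>h | h \<in> T \<and> h - g \<in> H. Poly_Mapping.lookup p h)"
  using assms by (intro sum.mono_neutral_left) (auto simp: in_keys_iff)

lemma coset_kernel_add:
  assumes "p \<in> coset_kernel H" "q \<in> coset_kernel H"
  shows "p + q \<in> coset_kernel H"
  unfolding coset_kernel_def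
proof (intro CollectI allI)
  fix g
  let ?T = "Poly_Mapping.keys p \<union> Poly_Mapping.keys q"
  have "Poly_Mapping.keys (p + q) \<subseteq> ?T" by (rule keys_add)
  then have "(\<Sum>h | h \<in> Poly_Mapping.keys (p + q) \<and> h - g \<in> H. Poly_Mapping.lookup (p + q) h) =
      (\<Sum>h | h \<in> ?T \<and> h - g \<in> H. Poly_Mapping.lookup p h) +
      (\<Sum>h | h \<in> ?T \<and> h - g \<in> H. Poly_Mapping.lookup q h)"
    by (subst coset_sum_superset [of ?T]) (auto simp: lookup_add sum.distrib)
  also have "(\<Sum>h | h \<in> ?T \<and> h - g \<in> H. Poly_Mapping.lookup p h) = 0"
    using assms(1) by (subst coset_sum_superset [symmetric]) (auto simp: coset_kernel_def)
  also have "(\<Sum>h | h \<in> ?T \<and> h - g \<in> H. Poly_Mapping.lookup q h) = 0"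
    using assms(2) by (subst coset_sum_superset [symmetric]) (auto simp: coset_kernel_def)
  finally show "(\<Sum>h | h \<in> Poly_Mapping.keys (p + q) \<and> h - g \<in> H. Poly_Mapping.lookup (p + q) h) = 0"
    by simp
qed

lemma lookup_single_mult:
  "Poly_Mapping.lookup (Poly_Mapping.single g a * p) h = a * Poly_Mapping.lookup p (h - g)"
  for p :: "'g::ab_group_add \<Rightarrow>\<^sub>0 'k::comm_ring_1"
proof (induction p rule: poly_mapping_add_induct)
  case (single f b)
  show ?case by (auto simp: mult_single lookup_single when_def algebra_simps)
qed (simp_all add: distrib_left lookup_add)

text \<open>Multiplication by a monomial permutes the cosets of H and scales the coset sums.\<close>

lemma coset_kernel_single_mult:
  assumes "p \<in> coset_kernel H"
  shows "Poly_Mapping.single f a * p \<in> coset_kernel H"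
  unfolding coset_kernel_def
proof (intro CollectI allI)
  fix g
  let ?T = "(+) f ` Poly_Mapping.keys p"
  have "Poly_Mapping.keys (Poly_Mapping.single f a * p) \<subseteq> ?T"
  proof
    fix h assume "h \<in> Poly_Mapping.keys (Poly_Mapping.single f a * p)"
    then have "h - f \<in> Poly_Mapping.keys p" by (auto simp: in_keys_iff lookup_single_mult)
    then show "h \<in> ?T" by (intro image_eqI [of _ _ "h - f"]) auto
  qed
  then have "(\<Sum>h | h \<in> Poly_Mapping.keys (Poly_Mapping.single f a * p) \<and> h - g \<in> H.
      Poly_Mapping.lookup (Poly_Mapping.single f a * p) h) =
    (\<Sum>h | h \<in> ?T \<and> h - g \<in> H. a * Poly_Mapping.lookup p (h - f))"
    by (subst coset_sum_superset [of ?T]) (auto simp: lookup_single_mult)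
  also have "\<dots> = (\<Sum>h | h \<in> Poly_Mapping.keys p \<and> h - (g - f) \<in> H. a * Poly_Mapping.lookup p h)"
    by (rule sum.reindex_bij_witness [of _ "(+) f" "\<lambda>h. h - f"]) (auto simp: algebra_simps)
  also have "\<dots> = 0"
    using assms by (simp add: coset_kernel_def flip: sum_distrib_left)
  finally show "(\<Sum>h | h \<in> Poly_Mapping.keys (Poly_Mapping.single f a * p) \<and> h - g \<in> H.
      Poly_Mapping.lookup (Poly_Mapping.single f a * p) h) = 0" .
qed

lemma coset_kernel_ideal:
  "ideal (coset_kernel H) (twisted_ring (\<lambda>_ _. 1) :: ('g::ab_group_add \<Rightarrow>\<^sub>0 'k::field) ring)"
proof -
  let ?R = "twisted_ring (\<lambda>_ _. 1) :: ('g \<Rightarrow>\<^sub>0 'k) ring"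
  have R: "cring ?R" by (rule twisted_ring_cring [OF trivial_cocycle])
  have mult: "r * p \<in> coset_kernel H" if "p \<in> coset_kernel H" for r p :: "'g \<Rightarrow>\<^sub>0 'k"
  proof (induction r rule: poly_mapping_add_induct)
    case zero
    then show ?case by (simp add: coset_kernel_def)
  next
    case (single g a)
    then show ?case using that by (rule coset_kernel_single_mult)
  qed (simp add: distrib_right coset_kernel_add)
  have R': "ring ?R" by (rule cring.axioms(1) [OF R])
  interpret R: ring ?R by (rule R')
  show ?thesis
  proof (rule idealI [OF R'])
    show "subgroup (coset_kernel H) (add_monoid ?R)"
    proof (rule R.add.subgroupI)
      show "coset_kernel H \<subseteq> carrier ?R" by (simp add: twisted_ring_def)
      have "0 \<in> coset_kernel H" by (simp add: coset_kernel_def)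
      then show "coset_kernel H \<noteq> {}" by blast
      show "\<ominus>\<^bsub>?R\<^esub> p \<in> coset_kernel H" if "p \<in> coset_kernel H" for p
      proof -
        have "\<ominus>\<^bsub>?R\<^esub> p = - 1 * p"
          by (rule R.minus_equality) (simp_all add: twisted_ring_def)
        then show ?thesis using mult [OF that, of "- 1"] by simp
      qed
      show "p \<oplus>\<^bsub>?R\<^esub> q \<in> coset_kernel H" if "p \<in> coset_kernel H" "q \<in> coset_kernel H" for p q
        using coset_kernel_add [OF that] by (simp add: twisted_ring_def)
    qed
    show "r \<otimes>\<^bsub>?R\<^esub> p \<in> coset_kernel H" "p \<otimes>\<^bsub>?R\<^esub> r \<in> coset_kernel H"
      if "p \<in> coset_kernel H" for p r
      using mult [OF that] by (simp_all add: twisted_ring_def twisted_mult_trivial mult.commute [of p r])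
  qed
qed

text \<open>If finitely many elements with supports in \<open>H\<close> generate the augmentation ideal, then that
  ideal vanishes in the group ring of \<open>G / H\<close>.\<close>

lemma noetherian_group_ring_imp_finitely_generated:
  assumes "noetherian_ring (twisted_ring (\<lambda>_ _. 1) :: ('g::ab_group_add \<Rightarrow>\<^sub>0 'k::field) ring)"
  shows "finitely_generated TYPE('g)"
proof -
  let ?R = "twisted_ring (\<lambda>_ _. 1) :: ('g \<Rightarrow>\<^sub>0 'k) ring"
  interpret R: noetherian_ring ?R by fact
  obtain A where A: "A \<subseteq> carrier ?R" "finite A" "coset_kernel UNIV = Idl\<^bsub>?R\<^esub> A"
    using R.finetely_gen [OF coset_kernel_ideal] by blast
  define S where "S = (\<Union>p\<in>A. Poly_Mapping.keys p)"
  define H where "H = group_closure S"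
  have "A \<subseteq> coset_kernel H"
  proof
    fix p assume p: "p \<in> A"
    then have "p \<in> coset_kernel UNIV" using A(1,3) R.genideal_self by blast
    then have zero: "(\<Sum>h\<in>Poly_Mapping.keys p. Poly_Mapping.lookup p h) = 0"
      by (simp add: coset_kernel_def)
    have pH: "Poly_Mapping.keys p \<subseteq> H"
      using p by (auto simp: H_def S_def intro: group_closure.base)
    show "p \<in> coset_kernel H"
      unfolding coset_kernel_def
    proof (intro CollectI allI)
      fix g
      show "(\<Sum>h | h \<in> Poly_Mapping.keys p \<and> h - g \<in> H. Poly_Mapping.lookup p h) = 0"
      proof (cases "g \<in> H")
        case True
        then have "{h. h \<in> Poly_Mapping.keys p \<and> h - g \<in> H} = Poly_Mapping.keys p"
          using pH by (auto simp: H_def intro: group_closure.diff)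
        then show ?thesis using zero by simp
      next
        case False
        have "h - g \<notin> H" if "h \<in> Poly_Mapping.keys p" for h
          using group_closure.diff [of h S "h - g"] pH that False by (auto simp: H_def)
        then have "{h. h \<in> Poly_Mapping.keys p \<and> h - g \<in> H} = {}" by blast
        then show ?thesis by (simp only: sum.empty)
      qed
    qed
  qed
  then have sub: "coset_kernel UNIV \<subseteq> (coset_kernel H :: ('g \<Rightarrow>\<^sub>0 'k) set)"
    unfolding A(3) by (rule R.genideal_minimal [OF coset_kernel_ideal])
  have "g \<in> H" for g
  proof (rule ccontr)
    assume g: "g \<notin> H"
    then have "g \<noteq> 0" by (auto simp: H_def)
    \<comment> \<open>This difference lies in the augmentation ideal. For g outside H, its sum over
      the coset H consists of the coefficient -1 alone.\<close>
    let ?p = "Poly_Mapping.single g (1::'k) - Poly_Mapping.single 0 1"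
    have keys: "Poly_Mapping.keys ?p = {g, 0}"
      using \<open>g \<noteq> 0\<close> by (auto simp: in_keys_iff lookup_minus lookup_single lookup_one when_def split: if_splits)
    then have "?p \<in> coset_kernel UNIV"
      using \<open>g \<noteq> 0\<close> by (simp add: coset_kernel_def lookup_minus lookup_single lookup_one)
    then have "?p \<in> coset_kernel H" using sub by blast
    then have "\<forall>x. (\<Sum>h | h \<in> {g, 0} \<and> h - x \<in> H. Poly_Mapping.lookup ?p h) = 0"
      by (simp only: coset_kernel_def keys mem_Collect_eq simp_thms)
    then have "(\<Sum>h | h \<in> {g, 0} \<and> h - 0 \<in> H. Poly_Mapping.lookup ?p h) = 0" ..
    moreover have "{h. h \<in> {g, 0} \<and> h - 0 \<in> H} = {0}" using g by (auto simp: H_def)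
    ultimately have "Poly_Mapping.lookup ?p 0 = 0" by simp
    then show False using \<open>g \<noteq> 0\<close> by (simp add: lookup_minus lookup_single lookup_one)
  qed
  then have "group_closure S = UNIV" by (auto simp: H_def)
  moreover have "finite S" using A(2) by (simp add: S_def)
  ultimately show ?thesis unfolding finitely_generated_def by blast
qed

section \<open>Symmetric cocycles on free groups\<close>

definition extension_group :: "('g::ab_group_add \<Rightarrow> 'g \<Rightarrow> 'k::field) \<Rightarrow> ('k \<times> 'g) monoid" where
  "extension_group \<phi> =
     \<lparr>carrier = {(a, g). a \<noteq> 0}, monoid.mult = \<lambda>(a, g) (b, h). (a * b * \<phi> g h, g + h),
      one = (inverse (\<phi> 0 0), 0)\<rparr>"

lemma comm_group_extension_group:
  assumes "\<phi> \<in> Z2S kstar"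
  shows "comm_group (extension_group \<phi>)"
proof -
  let ?E = "extension_group \<phi>"
  note \<phi> = Z2S_kstarD [OF assms]
  have assoc: "a * b * \<phi> f g * c * \<phi> (f + g) h = a * (b * c * \<phi> g h) * \<phi> f (g + h)" for a b c f g h
    using \<phi>(2) [of g h f] by (simp add: mult_ac)
  show ?thesis
  proof (rule comm_groupI)
    fix x y z assume xyz: "x \<in> carrier ?E" "y \<in> carrier ?E"
      "z \<in> carrier ?E"
    show "x \<otimes>\<^bsub>?E\<^esub> y \<in> carrier ?E"
      using xyz \<phi>(1) by (auto simp: extension_group_def)
    show "x \<otimes>\<^bsub>?E\<^esub> y \<otimes>\<^bsub>?E\<^esub> z =
        x \<otimes>\<^bsub>?E\<^esub> (y \<otimes>\<^bsub>?E\<^esub> z)"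
      by (simp add: extension_group_def assoc add.assoc split: prod.split)
    show "x \<otimes>\<^bsub>?E\<^esub> y = y \<otimes>\<^bsub>?E\<^esub> x"
      using \<phi>(3) by (simp add: extension_group_def mult.commute add.commute split: prod.split)
  next
    show "\<one>\<^bsub>?E\<^esub> \<in> carrier ?E"
      using \<phi>(1) by (simp add: extension_group_def)
    fix x assume x: "x \<in> carrier ?E"
    obtain a g where ag: "x = (a, g)" "a \<noteq> 0" using x by (auto simp: extension_group_def)
    show "\<one>\<^bsub>?E\<^esub> \<otimes>\<^bsub>?E\<^esub> x = x"
      using \<phi>(1) [of 0 0] \<phi>(4) [of g] by (simp add: ag extension_group_def)
    have "(inverse (a * \<phi> (- g) g * \<phi> 0 0), - g) \<in> carrier ?E"
      using \<phi>(1) ag(2) by (simp add: extension_group_def)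
    moreover have "(inverse (a * \<phi> (- g) g * \<phi> 0 0), - g) \<otimes>\<^bsub>?E\<^esub> x =
        \<one>\<^bsub>?E\<^esub>"
      using \<phi>(1) ag(2) by (simp add: ag(1) extension_group_def field_simps)
    ultimately show "\<exists>y\<in>carrier ?E. y \<otimes>\<^bsub>?E\<^esub> x = \<one>\<^bsub>?E\<^esub>"
      by blast
  qed
qed

text \<open>The extension of \<open>G\<close> by the multiplicative group defined by \<open>\<phi>\<close> has a homomorphic section.\<close>

lemma finite_free_cocycle_trivial:
  fixes \<phi> :: "'g::ab_group_add \<Rightarrow> 'g \<Rightarrow> 'k::field"
  assumes free: "finite_free TYPE('g)" and \<phi>: "\<phi> \<in> Z2S kstar"
  obtains \<beta> where "\<And>g. \<beta> g \<noteq> 0" "\<And>f g. \<phi> f g = \<beta> g * inverse (\<beta> (f + g)) * \<beta> f"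
proof -
  obtain n and e :: "nat \<Rightarrow> 'g" and f :: "'g \<Rightarrow> nat \<Rightarrow> int"
    where basis: "\<And>g::'g. g = (\<Sum>i<n. zmul (f g i) (e i))"
      and f_add: "\<And>a b i. f (a + b) i = f a i + f b i"
    by (rule finite_free_basis [OF free]) blast
  define E where "E = extension_group \<phi>"
  interpret E: comm_group E
    unfolding E_def by (rule comm_group_extension_group [OF \<phi>])
  have snd_mult: "snd (x \<otimes>\<^bsub>E\<^esub> y) = snd x + snd y" and snd_one: "snd \<one>\<^bsub>E\<^esub> = 0" for x y
    by (simp_all add: E_def extension_group_def split: prod.split)
  have snd_pow: "snd (x [^]\<^bsub>E\<^esub> k) = zmul k (snd x)" if x: "x \<in> carrier E" for x and k :: int
  proof (induction k rule: int_induct [where k = 0])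
    case base
    then show ?case by (simp add: snd_one)
  next
    case (step1 i)
    have "x [^]\<^bsub>E\<^esub> (i + 1) = x [^]\<^bsub>E\<^esub> i \<otimes>\<^bsub>E\<^esub> x" using E.int_pow_mult [OF x, of i 1] x by simp
    then show ?case using step1 by (simp add: snd_mult zmul_succ)
  next
    case (step2 i)
    have "x [^]\<^bsub>E\<^esub> i = x [^]\<^bsub>E\<^esub> (i - 1) \<otimes>\<^bsub>E\<^esub> x" using E.int_pow_mult [OF x, of "i - 1" 1] x by simp
    then show ?case using step2 zmul_succ [of "i - 1" "snd x"] by (simp add: snd_mult)
  qed
  have snd_prod: "snd (finprod E u T) = (\<Sum>i\<in>T. snd (u i))" if "finite T" "u \<in> T \<rightarrow> carrier E"
    for u and T :: "nat set"
    using that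
  proof (induction T rule: finite_induct)
    case (insert i T)
    then show ?case by (subst E.finprod_insert) (auto simp: snd_mult)
  qed (simp add: snd_one)
  \<comment> \<open>The basis elements are lifted to \<open>(1, e i)\<close> and the lift is
    extended multiplicatively. It is a homomorphism because coordinates are additive and
    \<open>E\<close> is commutative; the latter is where symmetry of the cocycle enters.\<close>
  define s where "s g = finprod E (\<lambda>i. (1, e i) [^]\<^bsub>E\<^esub> f g i) {..<n}" for g
  have e: "(1, e i) \<in> carrier E" for i by (simp add: E_def extension_group_def)
  have s_closed: "s g \<in> carrier E" for g
    unfolding s_def using e by (intro E.finprod_closed) auto
  have s_mult: "s (g + h) = s g \<otimes>\<^bsub>E\<^esub> s h" for g h
    unfolding s_def using e by (subst E.finprod_multf [symmetric]) (auto simp: f_add E.int_pow_mult)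
  have snd_s: "snd (s g) = g" for g
  proof -
    have "snd (s g) = (\<Sum>i<n. zmul (f g i) (e i))"
      unfolding s_def using e by (subst snd_prod) (auto simp: snd_pow)
    then show ?thesis using basis [of g] by simp
  qed
  have nz: "fst (s g) \<noteq> 0" for g
    using s_closed [of g] by (auto simp: E_def extension_group_def)
  have "fst (s (f + g)) = fst (s f) * fst (s g) * \<phi> f g" for f g
  proof -
    have "s g = (fst (s g), g)" for g using snd_s by (metis prod.collapse)
    then have "s (f + g) = (fst (s f), f) \<otimes>\<^bsub>E\<^esub> (fst (s g), g)" using s_mult by metis
    then show ?thesis by (simp add: E_def extension_group_def)
  qed
  \<comment> \<open>Comparing first components in the homomorphism law exhibits the cocycle as the
    coboundary of the inverse of the first component of the section.\<close>
  then have "\<phi> f g = inverse (fst (s g)) * inverse (inverse (fst (s (f + g)))) * inverse (fst (s f))" for f g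
    using nz by (simp add: field_simps)
  then show thesis using that [of "\<lambda>g. inverse (fst (s g))"] nz by auto
qed

section \<open>Coboundaries and the zero class\<close>

lemma B2S_kstar_iff:
  "\<phi> \<in> B2S kstar \<longleftrightarrow> (\<exists>\<beta>. (\<forall>g. \<beta> g \<noteq> 0) \<and> (\<forall>f g. \<phi> f g = \<beta> g * inverse (\<beta> (f + g)) * \<beta> f))"
  for \<phi> :: "'g::ab_group_add \<Rightarrow> 'g \<Rightarrow> 'k::field"
proof
  assume "\<phi> \<in> B2S kstar"
  then obtain \<beta> where "\<And>g. \<beta> g \<noteq> 0"
    "\<phi> = (\<lambda>f g. \<beta> g \<otimes>\<^bsub>kstar\<^esub> inv\<^bsub>kstar\<^esub> \<beta> (f + g) \<otimes>\<^bsub>kstar\<^esub> \<beta> f)"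
    unfolding B2S_def B2_def by fastforce
  then show "\<exists>\<beta>. (\<forall>g. \<beta> g \<noteq> 0) \<and> (\<forall>f g. \<phi> f g = \<beta> g * inverse (\<beta> (f + g)) * \<beta> f)"
    by (intro exI [of _ \<beta>]) simp
next
  assume "\<exists>\<beta>. (\<forall>g. \<beta> g \<noteq> 0) \<and> (\<forall>f g. \<phi> f g = \<beta> g * inverse (\<beta> (f + g)) * \<beta> f)"
  then obtain \<beta> where \<beta>: "\<And>g. \<beta> g \<noteq> 0" "\<And>f g. \<phi> f g = \<beta> g * inverse (\<beta> (f + g)) * \<beta> f" by blast
  then have "\<phi> = (\<lambda>f g. \<beta> g \<otimes>\<^bsub>kstar\<^esub> inv\<^bsub>kstar\<^esub> \<beta> (f + g) \<otimes>\<^bsub>kstar\<^esub> \<beta> f)" by (auto simp: fun_eq_iff)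
  then have "\<phi> \<in> B2 kstar" unfolding B2_def using \<beta>(1)
    by (intro CollectI exI [of _ \<beta>] conjI) (assumption, simp)
  moreover have "\<phi> g h = \<phi> h g" for g h using \<beta>(2) by (simp add: add.commute mult.commute mult.left_commute)
  ultimately show "\<phi> \<in> B2S kstar" unfolding B2S_def by blast
qed

lemma trivial_cocycle_B2S: "(\<lambda>_ _. 1) \<in> B2S kstar"
  unfolding B2S_kstar_iff by (intro exI [of _ "\<lambda>_. 1"]) simp

lemma H2S_one: "\<one>\<^bsub>H2S kstar\<^esub> = B2S kstar"
  by (simp add: H2S_def FactGroup_def)

lemma H2S_coset_eq_one:
  fixes \<phi> :: "'g::ab_group_add \<Rightarrow> 'g \<Rightarrow> 'k::field"
  assumes "\<phi> \<in> B2S kstar"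
  shows "B2S kstar #>\<^bsub>Z2S_group kstar\<^esub> \<phi> = B2S kstar"
proof -
  obtain \<beta> where \<beta>: "\<And>g. \<beta> g \<noteq> 0" "\<And>f g. \<phi> f g = \<beta> g * inverse (\<beta> (f + g)) * \<beta> f"
    using assms unfolding B2S_kstar_iff by blast
  show ?thesis
  proof (intro equalityI subsetI)
    fix \<chi> assume "\<chi> \<in> B2S kstar #>\<^bsub>Z2S_group kstar\<^esub> \<phi>"
    then obtain \<psi> where \<psi>: "\<psi> \<in> B2S kstar" "\<chi> = (\<lambda>f g. \<psi> f g * \<phi> f g)"
      by (auto simp: r_coset_def Z2S_group_def)
    then obtain \<gamma> where \<gamma>: "\<And>g. \<gamma> g \<noteq> 0" "\<And>f g. \<psi> f g = \<gamma> g * inverse (\<gamma> (f + g)) * \<gamma> f"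
      unfolding B2S_kstar_iff by blast
    have "\<chi> f g = (\<beta> g * \<gamma> g) * inverse (\<beta> (f + g) * \<gamma> (f + g)) * (\<beta> f * \<gamma> f)" for f g
      by (simp add: \<psi>(2) \<beta>(2) \<gamma>(2) mult_ac)
    then show "\<chi> \<in> B2S kstar"
      unfolding B2S_kstar_iff using \<beta>(1) \<gamma>(1) by (intro exI [of _ "\<lambda>g. \<beta> g * \<gamma> g"]) auto
  next
    fix \<chi> :: "'g \<Rightarrow> 'g \<Rightarrow> 'k" assume "\<chi> \<in> B2S kstar"
    then obtain \<gamma> where \<gamma>: "\<And>g. \<gamma> g \<noteq> 0" "\<And>f g. \<chi> f g = \<gamma> g * inverse (\<gamma> (f + g)) * \<gamma> f"
      unfolding B2S_kstar_iff by blast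
    define \<delta> where "\<delta> g = \<gamma> g * inverse (\<beta> g)" for g
    define \<psi> where "\<psi> f g = \<delta> g * inverse (\<delta> (f + g)) * \<delta> f" for f g
    have "\<psi> \<in> B2S kstar"
      unfolding B2S_kstar_iff using \<beta>(1) \<gamma>(1) by (intro exI [of _ \<delta>]) (auto simp: \<psi>_def \<delta>_def)
    moreover have "\<chi> f g = \<psi> f g * \<phi> f g" for f g
      using \<beta>(1) by (simp add: \<psi>_def \<delta>_def \<gamma>(2) \<beta>(2) field_simps)
    then have "\<chi> = (\<lambda>f g. \<psi> f g * \<phi> f g)" by blast
    ultimately show "\<chi> \<in> B2S kstar #>\<^bsub>Z2S_group kstar\<^esub> \<phi>"
      by (auto simp: r_coset_def Z2S_group_def)
  qed
qed

lemma H2S_carrier: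
  "carrier (H2S kstar) = (\<lambda>\<phi>. B2S kstar #>\<^bsub>Z2S_group kstar\<^esub> \<phi>) ` Z2S kstar"
  by (auto simp: H2S_def carrier_FactGroup Z2S_group_def)

lemma H2S_one_closed: "\<one>\<^bsub>H2S kstar\<^esub> \<in> carrier (H2S kstar)"
  unfolding H2S_carrier H2S_one
  using H2S_coset_eq_one [OF trivial_cocycle_B2S] trivial_cocycle by (metis imageI)

lemma noetherian_class_one_iff:
  "noetherian_class (\<one>\<^bsub>H2S kstar\<^esub> :: ('g::ab_group_add \<Rightarrow> 'g \<Rightarrow> 'k::field) set) \<longleftrightarrow>
     noetherian_ring (twisted_ring (\<lambda>_ _. 1) :: ('g \<Rightarrow>\<^sub>0 'k) ring)"
  using noetherian_class_iff [OF H2S_one_closed] trivial_cocycle_B2S unfolding H2S_one by blast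

lemma finite_free_H2S:
  assumes "finite_free TYPE('g::ab_group_add)"
  shows "carrier (H2S kstar :: ('g \<Rightarrow> 'g \<Rightarrow> 'k::field) set monoid) = {\<one>\<^bsub>H2S kstar\<^esub>}"
proof -
  have "\<phi> \<in> B2S kstar" if "\<phi> \<in> Z2S kstar" for \<phi> :: "'g \<Rightarrow> 'g \<Rightarrow> 'k"
    using finite_free_cocycle_trivial [OF assms that] unfolding B2S_kstar_iff by metis
  then have "B2S kstar #>\<^bsub>Z2S_group kstar\<^esub> \<phi> = B2S kstar" if "\<phi> \<in> Z2S kstar" for \<phi> :: "'g \<Rightarrow> 'g \<Rightarrow> 'k"
    using H2S_coset_eq_one that by blast
  then show ?thesis
    using trivial_cocycle unfolding H2S_carrier H2S_one by (auto intro!: image_eqI)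
qed

lemma noetherian_class_of_cocycle:
  fixes \<phi> :: "'g::ab_group_add \<Rightarrow> 'g \<Rightarrow> 'k::field"
  assumes "\<phi> \<in> Z2S kstar" "noetherian_ring (twisted_ring \<phi>)"
  shows "\<exists>c\<in>carrier (H2S kstar :: ('g \<Rightarrow> 'g \<Rightarrow> 'k) set monoid). noetherian_class c"
proof (rule bexI [of _ "B2S kstar #>\<^bsub>Z2S_group kstar\<^esub> \<phi>"])
  show "B2S kstar #>\<^bsub>Z2S_group kstar\<^esub> \<phi> \<in> carrier (H2S kstar)"
    unfolding H2S_carrier using assms(1) by blast
  have "\<phi> \<in> B2S kstar #>\<^bsub>Z2S_group kstar\<^esub> \<phi>"
    using trivial_cocycle_B2S by (force simp: r_coset_def Z2S_group_def)
  then show "noetherian_class (B2S kstar #>\<^bsub>Z2S_group kstar\<^esub> \<phi>)"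
    using assms(2) unfolding noetherian_class_def by blast
qed

section \<open>Coordinates on groups of finite rank\<close>

text \<open>All multiples of the denominator are included, so that several denominators can be
  cleared at once and integrality survives as the denominators of the tower grow.\<close>

lemma rat_common_denominator:
  obtains N :: nat where "N > 0" "\<And>M. N dvd M \<Longrightarrow> of_nat M * (q :: rat) \<in> \<int>"
proof -
  obtain a b where ab: "quotient_of q = (a, b)" by fastforce
  then have b: "b > 0" "q = of_int a / of_int b"
    using quotient_of_denom_pos quotient_of_div by blast+
  show thesis
  proof (rule that [of "nat b"])
    fix M assume "nat b dvd M"
    then obtain k where "M = nat b * k" by blast
    then have "of_nat M * q = of_int (a * int k)" using b by simp
    then show "of_nat M * q \<in> \<int>" by (metis Ints_of_int)
  qed (use b in simp)
qed

text \<open>Multiplying all rational factors by \<open>N\<close> maps tensors with integral factors to \<open>G\<close>.\<close>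

definition clear_denominators :: "nat \<Rightarrow> (rat \<times> 'g::ab_group_add \<Rightarrow>\<^sub>0 int) \<Rightarrow> 'g" where
  "clear_denominators N x =
     (\<Sum>(q, g)\<in>Poly_Mapping.keys x. zmul (Poly_Mapping.lookup x (q, g) * \<lfloor>of_nat N * q\<rfloor>) g)"

lemma clear_denominators_superset:
  assumes "finite T" "Poly_Mapping.keys x \<subseteq> T"
  shows "clear_denominators N x =
     (\<Sum>(q, g)\<in>T. zmul (Poly_Mapping.lookup x (q, g) * \<lfloor>of_nat N * q\<rfloor>) g)"
  unfolding clear_denominators_def using assms
  by (intro sum.mono_neutral_left) (auto simp: in_keys_iff)

lemma clear_denominators_0 [simp]: "clear_denominators N 0 = 0"
  by (simp add: clear_denominators_def)

lemma clear_denominators_diff: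
  "clear_denominators N (x - y) = clear_denominators N x - clear_denominators N y"
proof -
  let ?T = "Poly_Mapping.keys x \<union> Poly_Mapping.keys y"
  have "Poly_Mapping.keys (x - y) \<subseteq> ?T" by (rule keys_diff)
  then show ?thesis
    by (simp add: clear_denominators_superset [of ?T] lookup_minus left_diff_distrib zmul_diff
        case_prod_unfold sum_subtractf)
qed

lemma clear_denominators_frag_of: "clear_denominators N (frag_of (q, g)) = zmul \<lfloor>of_nat N * q\<rfloor> g"
  by (simp add: clear_denominators_def keys_frag_of)

text \<open>The floor is not additive, so \<open>clear_denominators N\<close> for a fixed N does not
  respect all relations. A given element of the relation subgroup involves finitely many rationals,
  however, and is killed by every sufficiently divisible N.\<close>

lemma clear_denominators_relations:
  assumes "x \<in> group_closure (tensor_relations :: (rat \<times> 'g::ab_group_add \<Rightarrow>\<^sub>0 int) set)"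
  shows "\<exists>N>0. \<forall>M. N dvd M \<longrightarrow> clear_denominators M x = 0"
  using assms
proof induction
  case (base s)
  then consider "s = 0"
    | q r and g :: 'g where "s = frag_of (q + r, g) - frag_of (q, g) - frag_of (r, g)"
    | q and g h :: 'g where "s = frag_of (q, g + h) - frag_of (q, g) - frag_of (q, h)"
    unfolding tensor_relations_def by blast
  then show ?case
  proof cases
    case 1
    then show ?thesis by auto
  next
    case (2 q r g)
    \<comment> \<open>Clearing q alone suffices: an integral summand passes through the floor of the
      sum.\<close>
    obtain N :: nat where N: "N > 0" "\<And>M. N dvd M \<Longrightarrow> of_nat M * q \<in> \<int>"
      by (rule rat_common_denominator [of q]) blast
    have "clear_denominators M s = 0" if M: "N dvd M" for M
    proof -
      obtain a where "of_nat M * q = of_int a" using N(2) [OF M] by (rule Ints_cases)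
      then show ?thesis
        by (simp add: 2 clear_denominators_diff clear_denominators_frag_of distrib_left zmul_add)
    qed
    then show ?thesis using N(1) by blast
  next
    case (3 q g h)
    then show ?thesis
      by (auto simp: clear_denominators_diff clear_denominators_frag_of zmul_add_right)
  qed
next
  case (diff s t)
  then obtain N N' where "N > 0" "\<And>M. N dvd M \<Longrightarrow> clear_denominators M s = 0"
    "N' > 0" "\<And>M. N' dvd M \<Longrightarrow> clear_denominators M t = 0" by blast
  then show ?case
    by (intro exI [of _ "N * N'"]) (auto simp: clear_denominators_diff dest: dvd_mult_left dvd_mult_right)
qed

text \<open>The map sends g to the tensor of 1 and g. If that tensor vanishes, clearing denominators
  yields a positive N with \<open>zmul (int N) g = 0\<close>, and g is zero by
  torsion-freeness.\<close>

lemma torsion_free_tensor_embedding: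
  assumes "torsion_free TYPE('g::ab_group_add)"
  obtains f :: "'g::ab_group_add \<Rightarrow> 'g rat_tensor" where "inj f" "\<And>g h. f (g + h) = f g + f h"
proof -
  define f :: "'g \<Rightarrow> 'g rat_tensor" where "f g = abs_rat_tensor (frag_of (1, g))" for g
  have add: "f (g + h) = f g + f h" for g h
  proof -
    have "frag_of (1, g + h) - frag_of (1, g) - frag_of (1, h) \<in> tensor_relations"
      unfolding tensor_relations_def by blast
    then have "frag_of (1, g + h) - (frag_of (1, g) + frag_of (1, h)) \<in> group_closure tensor_relations"
      by (simp add: group_closure.base diff_diff_eq)
    then show ?thesis
      unfolding f_def plus_rat_tensor.abs_eq by (simp add: rat_tensor.abs_eq_iff)
  qed
  have zero: "g = 0" if "f g = 0" for g
  proof -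
    have "frag_of (1, g) - 0 \<in> group_closure tensor_relations"
      using that unfolding f_def zero_rat_tensor_def rat_tensor.abs_eq_iff .
    then have "frag_of (1, g) \<in> group_closure tensor_relations" by simp
    then obtain N where N: "N > 0" "\<forall>M. N dvd M \<longrightarrow> clear_denominators M (frag_of (1, g)) = 0"
      using clear_denominators_relations by blast
    then have "zmul (int N) g = 0" by (auto simp: clear_denominators_frag_of)
    then show ?thesis using torsion_free_zmul [OF assms] N(1) by auto
  qed
  have "inj f"
  proof (rule injI)
    fix g h assume gh: "f g = f h"
    have "f (g - h) + f h = f g" using add [of "g - h" h] by simp
    then have "f (g - h) = 0" using gh by simp
    then show "g = h" using zero by fastforce
  qed
  then show thesis using add that by blast
qed

text \<open>Coordinates of the image in the tensor product with respect to a rational basis. They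
  are kept as finitely supported functions because this one type serves as exponent group of the
  ambient group ring for every n.\<close>

lemma finite_rank_coordinates:
  assumes tf: "torsion_free TYPE('g::ab_group_add)" and fr: "finite_rank TYPE('g)"
  obtains n and f :: "'g::ab_group_add \<Rightarrow> nat \<Rightarrow>\<^sub>0 rat"
  where "inj f" "\<And>g h. f (g + h) = f g + f h" "\<And>g. Poly_Mapping.keys (f g) \<subseteq> {..<n}"
proof -
  obtain i :: "'g \<Rightarrow> 'g rat_tensor" where i: "inj i" "\<And>g h. i (g + h) = i g + i h"
    using torsion_free_tensor_embedding [OF tf] by blast
  obtain B\<^sub>0 :: "'g rat_tensor set" where B\<^sub>0: "finite B\<^sub>0" "rat_tensor.span B\<^sub>0 = UNIV"
    using fr by (auto simp: finite_rank_def)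
  obtain B where B: "B \<subseteq> B\<^sub>0" "rat_tensor.independent B" "B\<^sub>0 \<subseteq> rat_tensor.span B"
    using rat_tensor.maximal_independent_subset by blast
  have fin: "finite B" using B(1) B\<^sub>0(1) by (rule finite_subset)
  have span: "v \<in> rat_tensor.span B" for v
    using rat_tensor.span_minimal [OF B(3)] B\<^sub>0(2) by auto
  obtain e where e: "bij_betw e {..<card B} B"
    using ex_bij_betw_nat_finite [OF fin] by (auto simp: atLeast0LessThan)
  define r where "r = rat_tensor.representation B"
  have r_add: "r (v + w) b = r v b + r w b" for v w b
    using rat_tensor.representation_add [OF B(2) span span] by (simp add: r_def)
  define f where "f g = (\<Sum>j<card B. Poly_Mapping.single j (r (i g) (e j)))" for g
  have lookup_f: "Poly_Mapping.lookup (f g) j = (if j < card B then r (i g) (e j) else 0)" for g j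
    by (simp add: f_def lookup_sum lookup_single when_def)
  show thesis
  proof (rule that [of f "card B"])
    show "f (g + h) = f g + f h" for g h
      by (rule poly_mapping_eqI) (simp add: lookup_f lookup_add i(2) r_add)
    show "Poly_Mapping.keys (f g) \<subseteq> {..<card B}" for g
      by (auto simp: in_keys_iff lookup_f split: if_splits)
    show "inj f"
    proof (rule injI)
      fix g h assume gh: "f g = f h"
      have "r (i g) b = r (i h) b" if "b \<in> B" for b
      proof -
        have "b \<in> e ` {..<card B}" using that e by (simp add: bij_betw_def)
        then obtain j where "j < card B" "b = e j" by blast
        then show ?thesis using lookup_f [of g j] lookup_f [of h j] gh by simp
      qed
      then have "(\<Sum>b\<in>B. tensor_scale (r (i g) b) b) = (\<Sum>b\<in>B. tensor_scale (r (i h) b) b)"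
        by (intro sum.cong) auto
      then have "i g = i h"
        using rat_tensor.sum_representation_eq [OF B(2) span fin subset_refl] by (simp add: r_def)
      then show "g = h" using i(1) by (simp add: inj_eq)
    qed
  qed
qed

section \<open>Purely transcendental extensions\<close>

lemma poly_eval_superset:
  assumes "finite T" "Poly_Mapping.keys p \<subseteq> T"
  shows "poly_eval \<alpha> p =
     (\<Sum>m\<in>T. Poly_Mapping.lookup p m * (\<Prod>i\<in>Poly_Mapping.keys m. \<alpha> i ^ Poly_Mapping.lookup m i))"
  unfolding poly_eval_def using assms
  by (intro sum.mono_neutral_left) (auto simp: in_keys_iff)

lemma poly_eval_add: "poly_eval \<alpha> (p + q) = poly_eval \<alpha> p + poly_eval \<alpha> q"
proof -
  let ?T = "Poly_Mapping.keys p \<union> Poly_Mapping.keys q"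
  have "Poly_Mapping.keys (p + q) \<subseteq> ?T" by (rule keys_add)
  then show ?thesis
    by (simp add: poly_eval_superset [of ?T] lookup_add distrib_right sum.distrib)
qed

lemma poly_eval_0 [simp]: "poly_eval \<alpha> 0 = 0"
  by (simp add: poly_eval_def)

lemma poly_eval_single:
  "poly_eval \<alpha> (Poly_Mapping.single m c) =
     c * (\<Prod>i\<in>Poly_Mapping.keys m. \<alpha> i ^ Poly_Mapping.lookup m i)"
  by (subst poly_eval_superset [of "{m}"]) auto

lemma monomial_eval_add:
  fixes \<alpha> :: "nat \<Rightarrow> 'k::comm_ring_1"
  shows "(\<Prod>i\<in>Poly_Mapping.keys (m + m'). \<alpha> i ^ Poly_Mapping.lookup (m + m') i) =
    (\<Prod>i\<in>Poly_Mapping.keys m. \<alpha> i ^ Poly_Mapping.lookup m i) *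
    (\<Prod>i\<in>Poly_Mapping.keys m'. \<alpha> i ^ Poly_Mapping.lookup m' i)"
proof -
  let ?T = "Poly_Mapping.keys m \<union> Poly_Mapping.keys m'"
  have *: "(\<Prod>i\<in>Poly_Mapping.keys l. \<alpha> i ^ Poly_Mapping.lookup l i) = (\<Prod>i\<in>?T. \<alpha> i ^ Poly_Mapping.lookup l i)"
    if "Poly_Mapping.keys l \<subseteq> ?T" for l
    using that by (intro prod.mono_neutral_left) (auto simp: in_keys_iff)
  have "Poly_Mapping.keys (m + m') \<subseteq> ?T" by (rule keys_add)
  then have "(\<Prod>i\<in>Poly_Mapping.keys (m + m'). \<alpha> i ^ Poly_Mapping.lookup (m + m') i) =
      (\<Prod>i\<in>?T. \<alpha> i ^ Poly_Mapping.lookup (m + m') i)" by (rule *)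
  then show ?thesis
    by (simp add: * [of m] * [of m'] lookup_add power_add prod.distrib)
qed

lemma poly_eval_mult: "poly_eval \<alpha> (p * q) = poly_eval \<alpha> p * poly_eval \<alpha> q"
proof (induction p rule: poly_mapping_add_induct)
  case single: (single m a)
  show ?case
  proof (induction q rule: poly_mapping_add_induct)
    case (single m' b)
    show ?case by (simp add: mult_single poly_eval_single monomial_eval_add)
  qed (simp_all add: distrib_left poly_eval_add)
qed (simp_all add: distrib_right poly_eval_add)

lemma poly_eval_diff: "poly_eval \<alpha> (p - q) = poly_eval \<alpha> p - poly_eval \<alpha> q"
  using poly_eval_add [of \<alpha> "p - q" q] by simp

lemma poly_eval_1 [simp]: "poly_eval \<alpha> 1 = 1"
  using poly_eval_single [of \<alpha> 0 1] by simp

text \<open>The polynomials over K in the variables indexed by I, written as a span of monomials so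
  that the closure properties and the induction rule of \<open>lin_span\<close> apply.\<close>

definition polys_in :: "'k::field set \<Rightarrow> nat set \<Rightarrow> ((nat \<Rightarrow>\<^sub>0 nat) \<Rightarrow>\<^sub>0 'k) set" where
  "polys_in K I = lin_span (Poly_Mapping.single 0 ` K)
     ((\<lambda>m. Poly_Mapping.single m 1) ` {m. Poly_Mapping.keys m \<subseteq> I})"

lemma unital_subring_image:
  assumes "unital_subring K" "u 1 = 1" "\<And>a b. u (a * b) = u a * u b" "\<And>a b. u (a - b) = u a - u b"
  shows "unital_subring (u ` K)"
proof -
  have "1 \<in> u ` K" using assms(2) unital_subringD(1) [OF assms(1)] by force
  then show ?thesis
    using unital_subringD(3,4) [OF assms(1)]
    unfolding unital_subring_def by (auto simp flip: assms(3,4))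
qed

lemma unital_subring_polys_in:
  assumes "unital_subring K"
  shows "unital_subring (polys_in K I)"
  unfolding polys_in_def
proof (rule unital_subring_lin_span)
  show "unital_subring (Poly_Mapping.single 0 ` K)"
    using assms by (rule unital_subring_image) (simp_all add: mult_single single_diff)
  show "g + h \<in> {m. Poly_Mapping.keys m \<subseteq> I}"
    if "g \<in> {m. Poly_Mapping.keys m \<subseteq> I}" "h \<in> {m. Poly_Mapping.keys m \<subseteq> I}" for g h :: "nat \<Rightarrow>\<^sub>0 nat"
    using that keys_add [of g h] by auto
qed (simp_all add: mult_single)

lemma polys_in_single:
  assumes "c \<in> K" "Poly_Mapping.keys m \<subseteq> I"
  shows "Poly_Mapping.single m c \<in> polys_in K I"
proof -
  have "Poly_Mapping.single 0 c * Poly_Mapping.single m 1 \<in> polys_in K I"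
    unfolding polys_in_def using assms by (intro lin_span_gen) auto
  then show ?thesis by (simp add: mult_single)
qed

lemma polys_in_induct [consumes 1, case_names zero single add]:
  assumes "p \<in> polys_in K I" "Q 0"
    "\<And>m c. c \<in> K \<Longrightarrow> Poly_Mapping.keys m \<subseteq> I \<Longrightarrow> Q (Poly_Mapping.single m c)"
    "\<And>p q. Q p \<Longrightarrow> Q q \<Longrightarrow> Q (p + q)"
  shows "Q p"
  using assms(1) unfolding polys_in_def
proof (induction rule: lin_span_induct)
  case (gen r a)
  then show ?case using assms(3) by (auto simp: mult_single)
qed (auto intro: assms)

lemma polys_in_coeffs:
  assumes "unital_subring K" "p \<in> polys_in K I"
  shows "range (Poly_Mapping.lookup p) \<subseteq> K"
proof -
  have "Poly_Mapping.lookup p m \<in> K" for m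
    using assms(2)
    by (induction rule: polys_in_induct)
      (auto simp: lookup_single lookup_add when_def intro: unital_subringD [OF assms(1)])
  then show ?thesis by blast
qed

lemma polys_in_mono: "I \<subseteq> J \<Longrightarrow> polys_in K I \<subseteq> polys_in K J"
  unfolding polys_in_def by (intro lin_span_mono) auto

definition fractions :: "'k::field set \<Rightarrow> 'k set" where
  "fractions A = {a / b | a b. a \<in> A \<and> b \<in> A \<and> b \<noteq> 0}"

lemma fractionsI: "a \<in> A \<Longrightarrow> b \<in> A \<Longrightarrow> b \<noteq> 0 \<Longrightarrow> a / b \<in> fractions A"
  unfolding fractions_def by blast

lemma fractionsE:
  assumes "x \<in> fractions A"
  obtains a b where "a \<in> A" "b \<in> A" "b \<noteq> 0" "x = a / b"
  using assms unfolding fractions_def by blast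

lemma ring_of_type_algebra_simps [simp]:
  "carrier ring_of_type_algebra = UNIV" "x \<otimes>\<^bsub>ring_of_type_algebra\<^esub> y = x * y"
  "x \<oplus>\<^bsub>ring_of_type_algebra\<^esub> y = x + y" "\<one>\<^bsub>ring_of_type_algebra\<^esub> = 1" "\<zero>\<^bsub>ring_of_type_algebra\<^esub> = 0"
  by (simp_all add: ring_of_type_algebra_def)

lemma ring_of_type_algebra_uminus [simp]:
  "\<ominus>\<^bsub>ring_of_type_algebra\<^esub> x = - (x :: 'k::comm_ring_1)"
proof -
  interpret ring "ring_of_type_algebra :: 'k ring" by (rule ring_from_type_algebra)
  show ?thesis by (rule minus_equality) simp_all
qed

lemma ring_of_type_algebra_inverse [simp]:
  assumes "x \<noteq> 0"
  shows "inv\<^bsub>ring_of_type_algebra\<^esub> x = inverse (x :: 'k::field)"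
proof -
  interpret cring "ring_of_type_algebra :: 'k ring" by (rule cring_from_type_algebra)
  show ?thesis using assms by (intro comm_inv_char) simp_all
qed

lemma generate_field_subset_fractions:
  fixes A :: "'k::field set"
  assumes A: "unital_subring A" and "S \<subseteq> A"
  shows "generate_field ring_of_type_algebra S \<subseteq> fractions A"
proof
  fix x assume "x \<in> generate_field ring_of_type_algebra S"
  then show "x \<in> fractions A"
  proof induction
    case one
    show ?case using fractionsI [OF unital_subringD(1,1) [OF A]] by simp
  next
    case (incl h)
    then show ?case using fractionsI [OF _ unital_subringD(1) [OF A], of h] assms(2) by auto
  next
    case (a_inv h)
    obtain a b where "a \<in> A" "b \<in> A" "b \<noteq> 0" "h = a / b" using a_inv.IH by (rule fractionsE)
    then show ?case using fractionsI [OF unital_subringD(5) [OF A], of a b] by simp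
  next
    case (m_inv h)
    obtain a b where ab: "a \<in> A" "b \<in> A" "b \<noteq> 0" "h = a / b" using m_inv.IH by (rule fractionsE)
    have "h \<noteq> 0" using m_inv.hyps by simp
    then show ?case using fractionsI [of b A a] ab by simp
  next
    case (eng_add h1 h2)
    obtain a b where h1: "a \<in> A" "b \<in> A" "b \<noteq> 0" "h1 = a / b" using eng_add.IH(1) by (rule fractionsE)
    obtain c d where h2: "c \<in> A" "d \<in> A" "d \<noteq> 0" "h2 = c / d" using eng_add.IH(2) by (rule fractionsE)
    have "h1 + h2 = (a * d + c * b) / (b * d)" using h1 h2 by (simp add: add_frac_eq)
    then show ?case
      using h1 h2 fractionsI [of "a * d + c * b" A "b * d"] unital_subringD(4,6) [OF A] by simp
  next
    case (eng_mult h1 h2)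
    obtain a b where h1: "a \<in> A" "b \<in> A" "b \<noteq> 0" "h1 = a / b" using eng_mult.IH(1) by (rule fractionsE)
    obtain c d where h2: "c \<in> A" "d \<in> A" "d \<noteq> 0" "h2 = c / d" using eng_mult.IH(2) by (rule fractionsE)
    show ?case
      using h1 h2 fractionsI [of "a * c" A "b * d"] unital_subringD(4) [OF A] by simp
  qed
qed

lemma generate_field_mono: "S \<subseteq> T \<Longrightarrow> generate_field R S \<subseteq> generate_field R T"
proof
  fix x assume "x \<in> generate_field R S" "S \<subseteq> T"
  then show "x \<in> generate_field R T"
    by induction (auto intro: generate_field.intros)
qed

lemma unital_subring_generate_field: "unital_subring (generate_field ring_of_type_algebra S)"
  for S :: "'k::field set"
proof -
  let ?F = "generate_field ring_of_type_algebra S"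
  have "x - y \<in> ?F" if "x \<in> ?F" "y \<in> ?F" for x y
    using generate_field.eng_add [OF that(1) generate_field.a_inv [OF that(2)]] by simp
  moreover have "x * y \<in> ?F" if "x \<in> ?F" "y \<in> ?F" for x y
    using generate_field.eng_mult [OF that] by simp
  moreover have "1 \<in> ?F" using generate_field.one [of "ring_of_type_algebra :: 'k ring" S] by simp
  ultimately show ?thesis by (simp add: unital_subring_def)
qed

lemma inverse_generate_field:
  "x \<in> generate_field ring_of_type_algebra S \<Longrightarrow> inverse x \<in> generate_field ring_of_type_algebra S"
  for S :: "'k::field set"
  using generate_field.m_inv [of x "ring_of_type_algebra :: 'k ring" S] by (cases "x = 0") simp_all

lemma unital_subring_subfield:
  fixes K :: "'k::field set"
  assumes "subfield K ring_of_type_algebra"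
  shows "unital_subring K"
proof -
  have K: "subring K ring_of_type_algebra" using assms by (rule subfieldE(1))
  have "x - y \<in> K" if "x \<in> K" "y \<in> K" for x y
    using subringE(7) [OF K that(1) subringE(5) [OF K that(2)]] by simp
  moreover have "x * y \<in> K" if "x \<in> K" "y \<in> K" for x y
    using subringE(6) [OF K that] by simp
  moreover have "1 \<in> K" using subringE(3) [OF K] by simp
  ultimately show ?thesis by (simp add: unital_subring_def)
qed

section \<open>The tower of coefficient fields\<close>

locale transcendental_tower =
  fixes K :: "'k::field set" and \<alpha> :: "nat \<Rightarrow> 'k"
  assumes pure: "purely_transcendental_over K \<alpha>"
begin

definition level :: "nat \<Rightarrow> 'k set" where
  "level m = generate_field ring_of_type_algebra (K \<union> \<alpha> ` {..<m})"

lemma subring_K: "unital_subring K"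
  using pure unital_subring_subfield by (auto simp: purely_transcendental_over_def)

lemma level_subring: "unital_subring (level m)"
  unfolding level_def by (rule unital_subring_generate_field)

lemma level_inverse: "x \<in> level m \<Longrightarrow> inverse x \<in> level m"
  unfolding level_def by (rule inverse_generate_field)

lemma level_mono: "m \<le> m' \<Longrightarrow> level m \<subseteq> level m'"
  unfolding level_def by (rule generate_field_mono) auto

lemma alpha_level: "\<alpha> m \<in> level (Suc m)"
  unfolding level_def by (intro generate_field.incl) auto

lemma level_cover: "\<exists>m. x \<in> level m"
proof -
  have "x \<in> generate_field ring_of_type_algebra (K \<union> range \<alpha>)"
    using pure by (simp add: purely_transcendental_over_def)
  then show ?thesis
  proof induction
    case one
    then show ?case using unital_subringD(1) [OF level_subring] by auto
  next
    case (incl h)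
    then show ?case
    proof
      assume "h \<in> K"
      then show ?thesis unfolding level_def by (intro exI [of _ 0] generate_field.incl) auto
    next
      assume "h \<in> range \<alpha>"
      then show ?thesis using alpha_level by blast
    qed
  next
    case (a_inv h)
    then show ?case using unital_subringD(5) [OF level_subring] by auto
  next
    case (m_inv h)
    then show ?case using level_inverse by auto
  next
    case (eng_add h1 h2)
    then obtain m m' where "h1 \<in> level m" "h2 \<in> level m'" by blast
    then have "h1 \<in> level (max m m')" "h2 \<in> level (max m m')"
      using level_mono [of m "max m m'"] level_mono [of m' "max m m'"] by auto
    then show ?case using unital_subringD(6) [OF level_subring] by auto
  next
    case (eng_mult h1 h2)
    then obtain m m' where "h1 \<in> level m" "h2 \<in> level m'" by blast
    then have "h1 \<in> level (max m m')" "h2 \<in> level (max m m')"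
      using level_mono [of m "max m m'"] level_mono [of m' "max m m'"] by auto
    then show ?case using unital_subringD(4) [OF level_subring] by auto
  qed
qed

text \<open>\<open>level (Suc m)\<close> is generated by \<open>level m\<close> and
  \<open>\<alpha> m\<close>, so its elements are fractions of polynomials in
  \<open>\<alpha> m\<close>. The denominator is multiplied out because the identity will be
  transported by \<open>const\<close> into a group ring.\<close>

lemma level_fraction:
  assumes "x \<in> level (Suc m)"
  obtains a b where "a \<in> polys (level m)" "b \<in> polys (level m)" "poly b (\<alpha> m) \<noteq> 0"
    "poly b (\<alpha> m) * x = poly a (\<alpha> m)"
proof -
  let ?A = "(\<lambda>f. poly f (\<alpha> m)) ` polys (level m)"
  have "unital_subring ?A"
    unfolding unital_subring_def
  proof (intro conjI ballI)
    have "poly 1 (\<alpha> m) \<in> ?A" by (intro imageI polys_closed(2) [OF level_subring])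
    then show "1 \<in> ?A" by simp
    fix x y assume "x \<in> ?A" "y \<in> ?A"
    then obtain f g where fg: "f \<in> polys (level m)" "x = poly f (\<alpha> m)" "g \<in> polys (level m)" "y = poly g (\<alpha> m)"
      by blast
    have "poly (f - g) (\<alpha> m) \<in> ?A" "poly (f * g) (\<alpha> m) \<in> ?A"
      using fg by (intro imageI polys_closed(4,5) [OF level_subring]; simp)+
    then show "x - y \<in> ?A" "x * y \<in> ?A" using fg by simp_all
  qed
  moreover have "K \<union> \<alpha> ` {..<Suc m} \<subseteq> ?A"
  proof
    fix h assume "h \<in> K \<union> \<alpha> ` {..<Suc m}"
    then consider "h \<in> K \<union> \<alpha> ` {..<m}" | "h = \<alpha> m" by (auto simp: less_Suc_eq)
    then show "h \<in> ?A"
    proof cases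
      case 1
      then have "h \<in> level m" unfolding level_def by (intro generate_field.incl)
      then have "poly (Polynomial.monom h 0) (\<alpha> m) \<in> ?A"
        by (intro imageI polys_closed(6) [OF level_subring])
      then show ?thesis by (simp add: poly_monom)
    next
      case 2
      have "poly (Polynomial.monom 1 1) (\<alpha> m) \<in> ?A"
        by (intro imageI polys_closed(6) [OF level_subring] unital_subringD(1) [OF level_subring])
      then show ?thesis by (simp add: poly_monom 2)
    qed
  qed
  ultimately have "level (Suc m) \<subseteq> fractions ?A"
    unfolding level_def by (rule generate_field_subset_fractions)
  then obtain a b where "a \<in> polys (level m)" "b \<in> polys (level m)" "poly b (\<alpha> m) \<noteq> 0"
    "x = poly a (\<alpha> m) / poly b (\<alpha> m)"
    using assms unfolding fractions_def by blast
  then show thesis using that by (metis nonzero_mult_div_cancel_left times_divide_eq_right)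
qed

lemma level_polys_fraction:
  assumes "x \<in> level m"
  obtains p q where "p \<in> polys_in K {..<m}" "q \<in> polys_in K {..<m}" "poly_eval \<alpha> q \<noteq> 0"
    "poly_eval \<alpha> q * x = poly_eval \<alpha> p"
proof -
  let ?A = "poly_eval \<alpha> ` polys_in K {..<m}"
  have "unital_subring ?A"
    by (intro unital_subring_image unital_subring_polys_in subring_K poly_eval_1 poly_eval_mult poly_eval_diff)
  moreover have "K \<union> \<alpha> ` {..<m} \<subseteq> ?A"
  proof
    fix h assume "h \<in> K \<union> \<alpha> ` {..<m}"
    then consider "h \<in> K" | i where "i < m" "h = \<alpha> i" by blast
    then show "h \<in> ?A"
    proof cases
      case 1
      then have "Poly_Mapping.single 0 h \<in> polys_in K {..<m}" by (intro polys_in_single) auto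
      moreover have "poly_eval \<alpha> (Poly_Mapping.single 0 h) = h" by (simp add: poly_eval_single)
      ultimately show ?thesis by (metis imageI)
    next
      case 2
      then have "Poly_Mapping.single (Poly_Mapping.single i 1) 1 \<in> polys_in K {..<m}"
        using unital_subringD(1) [OF subring_K] by (intro polys_in_single) auto
      moreover have "poly_eval \<alpha> (Poly_Mapping.single (Poly_Mapping.single i 1) 1) = h"
        using 2 by (simp add: poly_eval_single)
      ultimately show ?thesis by blast
    qed
  qed
  ultimately have "level m \<subseteq> fractions ?A"
    unfolding level_def by (rule generate_field_subset_fractions)
  then obtain p q where "p \<in> polys_in K {..<m}" "q \<in> polys_in K {..<m}" "poly_eval \<alpha> q \<noteq> 0"
    "x = poly_eval \<alpha> p / poly_eval \<alpha> q"
    using assms unfolding fractions_def by blast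
  then show thesis using that by (metis nonzero_mult_div_cancel_left times_divide_eq_right)
qed

text \<open>One denominator for all coefficients of a polynomial turns a relation over
  \<open>level m\<close> into one whose coefficients are polynomials over K in the earlier
  indeterminates.\<close>

lemma level_common_denominator:
  assumes "\<And>i. c i \<in> level m"
  shows "\<exists>q\<in>polys_in K {..<m}. poly_eval \<alpha> q \<noteq> 0 \<and>
    (\<forall>i<(d::nat). \<exists>p\<in>polys_in K {..<m}. poly_eval \<alpha> q * c i = poly_eval \<alpha> p)"
proof (induction d)
  case 0
  show ?case
    using unital_subringD(1) [OF unital_subring_polys_in [OF subring_K]] by (intro bexI [of _ 1]) auto
next
  case (Suc d)
  then obtain q where q: "q \<in> polys_in K {..<m}" "poly_eval \<alpha> q \<noteq> 0"
    "\<And>i. i < d \<Longrightarrow> \<exists>p\<in>polys_in K {..<m}. poly_eval \<alpha> q * c i = poly_eval \<alpha> p" by blast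
  obtain p' q' where q': "p' \<in> polys_in K {..<m}" "q' \<in> polys_in K {..<m}" "poly_eval \<alpha> q' \<noteq> 0"
    "poly_eval \<alpha> q' * c d = poly_eval \<alpha> p'" using level_polys_fraction [OF assms] .
  note mult = unital_subringD(4) [OF unital_subring_polys_in [OF subring_K]]
  have "\<exists>p\<in>polys_in K {..<m}. poly_eval \<alpha> (q * q') * c i = poly_eval \<alpha> p" if "i < Suc d" for i
  proof (cases "i = d")
    case True
    then have "poly_eval \<alpha> (q * q') * c i = poly_eval \<alpha> (q * p')"
      using q'(4) by (simp add: poly_eval_mult mult.assoc)
    then show ?thesis using mult q(1) q'(1) by blast
  next
    case False
    then obtain p where p: "p \<in> polys_in K {..<m}" "poly_eval \<alpha> q * c i = poly_eval \<alpha> p"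
      using q(3) [of i] \<open>i < Suc d\<close> by (auto simp: less_Suc_eq)
    then have "poly_eval \<alpha> (q * q') * c i = poly_eval \<alpha> (p * q')"
      by (simp add: poly_eval_mult mult_ac flip: p(2))
    then show ?thesis using mult p(1) q'(2) by blast
  qed
  then show ?case using mult [OF q(1) q'(2)] q(2) q'(3) by (intro bexI [of _ "q * q'"]) (auto simp: poly_eval_mult)
qed

text \<open>No monomial of p involves the variable m, so the exponent of that variable identifies
  the summand from which a monomial comes.\<close>

lemma lookup_polys_in_times_variable:
  assumes "p \<in> polys_in K {..<m}" "Poly_Mapping.keys l \<subseteq> {..<m}"
  shows "Poly_Mapping.lookup (p * Poly_Mapping.single (Poly_Mapping.single m e) 1)
      (l + Poly_Mapping.single m e') = (Poly_Mapping.lookup p l when e = e')"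
  using assms(1)
proof (induction rule: polys_in_induct)
  case (single l' c)
  have "l' + Poly_Mapping.single m e = l + Poly_Mapping.single m e' \<longleftrightarrow> l' = l \<and> e = e'"
  proof
    assume eq: "l' + Poly_Mapping.single m e = l + Poly_Mapping.single m e'"
    have m0: "Poly_Mapping.lookup l m = 0" "Poly_Mapping.lookup l' m = 0"
      using assms(2) single(2) by (auto simp: in_keys_iff)
    have "Poly_Mapping.lookup (l' + Poly_Mapping.single m e) m = Poly_Mapping.lookup (l + Poly_Mapping.single m e') m"
      using eq by simp
    then have "e = e'" using m0 by (simp add: lookup_add)
    then show "l' = l \<and> e = e'" using eq by simp
  qed simp
  then show ?case by (auto simp: mult_single lookup_single when_def)
qed (auto simp: distrib_right lookup_add when_def)

text \<open>After denominators are cleared, a relation for \<open>\<alpha> m\<close> over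
  \<open>level m\<close> becomes a polynomial F over K in the indeterminates up to index m that
  vanishes at \<alpha>. Algebraic independence makes F zero, and its parts of degree i in the last
  variable are the cleared coefficients.\<close>

lemma alpha_transcendental:
  assumes f: "f \<in> polys (level m)" and zero: "poly f (\<alpha> m) = 0"
  shows "f = 0"
proof -
  define d where "d = Suc (Polynomial.degree f)"
  obtain q where q: "q \<in> polys_in K {..<m}" "poly_eval \<alpha> q \<noteq> 0"
    "\<forall>i<d. \<exists>p\<in>polys_in K {..<m}. poly_eval \<alpha> q * Polynomial.coeff f i = poly_eval \<alpha> p"
    using level_common_denominator [of "Polynomial.coeff f" m d] polysD [OF f] by blast
  then obtain p where p: "\<And>i. i < d \<Longrightarrow> p i \<in> polys_in K {..<m}"
    "\<And>i. i < d \<Longrightarrow> poly_eval \<alpha> q * Polynomial.coeff f i = poly_eval \<alpha> (p i)"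
    by metis
  define F where "F = (\<Sum>i<d. p i * Poly_Mapping.single (Poly_Mapping.single m i) 1)"
  have "poly_eval \<alpha> F = (\<Sum>i<d. poly_eval \<alpha> (p i * Poly_Mapping.single (Poly_Mapping.single m i) 1))"
    unfolding F_def by (induction d) (simp_all add: poly_eval_add)
  also have "\<dots> = (\<Sum>i<d. poly_eval \<alpha> q * (Polynomial.coeff f i * \<alpha> m ^ i))"
  proof (rule sum.cong [OF refl])
    fix i assume "i \<in> {..<d}"
    moreover have "poly_eval \<alpha> (Poly_Mapping.single (Poly_Mapping.single m i) 1) = \<alpha> m ^ i"
      by (cases "i = 0") (simp_all add: poly_eval_single)
    ultimately show "poly_eval \<alpha> (p i * Poly_Mapping.single (Poly_Mapping.single m i) 1) =
        poly_eval \<alpha> q * (Polynomial.coeff f i * \<alpha> m ^ i)"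
      using p(2) [of i] by (simp add: poly_eval_mult mult.assoc [symmetric])
  qed
  also have "\<dots> = poly_eval \<alpha> q * poly f (\<alpha> m)"
    by (simp add: poly_altdef sum_distrib_left d_def lessThan_Suc_atMost)
  finally have F0: "poly_eval \<alpha> F = 0" using zero by simp
  have "F \<in> polys_in K UNIV"
    unfolding F_def
  proof (rule unital_subring_sum [OF unital_subring_polys_in [OF subring_K]])
    fix i assume "i \<in> {..<d}"
    then show "p i * Poly_Mapping.single (Poly_Mapping.single m i) 1 \<in> polys_in K UNIV"
      using p(1) polys_in_mono [of "{..<m}" UNIV K]
      by (intro unital_subringD(4) [OF unital_subring_polys_in [OF subring_K]] polys_in_single
          unital_subringD(1) [OF subring_K]) auto
  qed
  then have "range (Poly_Mapping.lookup F) \<subseteq> K" by (rule polys_in_coeffs [OF subring_K])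
  then have F: "F = 0"
    using F0 pure unfolding purely_transcendental_over_def algebraically_independent_def by blast
  have coeff: "Polynomial.coeff f i = 0" if i: "i < d" for i
  proof -
    have "p i = 0"
    proof (rule poly_mapping_eqI)
      fix l
      show "Poly_Mapping.lookup (p i) l = Poly_Mapping.lookup 0 l"
      proof (cases "Poly_Mapping.keys l \<subseteq> {..<m}")
        case True
        have "Poly_Mapping.lookup F (l + Poly_Mapping.single m i) =
            (\<Sum>j<d. Poly_Mapping.lookup (p j) l when j = i)"
          unfolding F_def lookup_sum
          using lookup_polys_in_times_variable [OF p(1) True] by (intro sum.cong) auto
        also have "\<dots> = Poly_Mapping.lookup (p i) l" using i by (simp add: when_def)
        finally show ?thesis using F by simp
      next
        case False
        have "Poly_Mapping.lookup (p i) l = 0"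
          using p(1) [OF i] False
          by (induction rule: polys_in_induct) (auto simp: lookup_single lookup_add when_def)
        then show ?thesis by simp
      qed
    qed
    then show ?thesis using p(2) [OF i] q(2) by simp
  qed
  have "Polynomial.coeff f (Polynomial.degree f) = 0" by (rule coeff) (simp add: d_def)
  then show "f = 0" using leading_coeff_0_iff by blast
qed

lemma alpha_nonzero: "\<alpha> m \<noteq> 0"
proof
  assume "\<alpha> m = 0"
  then have "poly (Polynomial.monom 1 1) (\<alpha> m) = 0" by (simp add: poly_monom)
  moreover have "Polynomial.monom 1 1 \<in> polys (level m)"
    by (intro polys_closed(6) [OF level_subring] unital_subringD(1) [OF level_subring])
  ultimately have "Polynomial.monom (1::'k) 1 = 0" by (rule alpha_transcendental [rotated])
  then show False by (simp add: monom_eq_0_iff)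
qed

end

section \<open>A Noetherian twisted group ring of \<open>\<rat>\<^sup>n\<close>\<close>

lemma to_ac_power_int: "to_ac (a powi k) = to_ac a powi k"
  by (simp add: power_int_def)

text \<open>
  Step \<open>m\<close> of the tower adjoins an \<open>expo m\<close>-th root of the current generator in coordinate
  \<open>coord m\<close>, twisted by the fresh indeterminate \<open>\<alpha> m\<close>. All this takes place in the untwisted group
  ring over the algebraic closure, where \<open>rad m j\<close> is the scalar factor of the generator of
  coordinate \<open>j\<close> after \<open>m\<close> steps and \<open>1 / den m j\<close> is its exponent.
\<close>

locale cocycle_tower = transcendental_tower K \<alpha>
  for K :: "'k::field set" and \<alpha> :: "nat \<Rightarrow> 'k" +
  fixes n :: nat
  assumes n_pos: "0 < n"
begin

text \<open>Decoding pairs makes every coordinate meet every root order at some step. Reduction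
  modulo n turns any decoded number into a coordinate, and the successor in \<open>expo\<close>
  excludes the order 0.\<close>

definition coord :: "nat \<Rightarrow> nat" where "coord m = fst (prod_decode m) mod n"

definition expo :: "nat \<Rightarrow> nat" where "expo m = Suc (snd (prod_decode m))"

primrec den :: "nat \<Rightarrow> nat \<Rightarrow> nat" where
  "den 0 j = 1"
| "den (Suc m) j = (if j = coord m then expo m else 1) * den m j"

primrec rad :: "nat \<Rightarrow> nat \<Rightarrow> 'k alg_closure" where
  "rad 0 j = 1"
| "rad (Suc m) j = (if j = coord m then SOME z. z ^ expo m = to_ac (\<alpha> m) * rad m j else rad m j)"

definition lat :: "nat \<Rightarrow> (nat \<Rightarrow>\<^sub>0 rat) set" where
  "lat m = {v. Poly_Mapping.keys v \<subseteq> {..<n} \<and> (\<forall>j. of_nat (den m j) * Poly_Mapping.lookup v j \<in> \<int>)}"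

text \<open>On \<open>lat m\<close> the floor is exact, and these are the integer coordinates of v
  in the basis formed by the degrees of the current generators.\<close>

definition cf :: "nat \<Rightarrow> (nat \<Rightarrow>\<^sub>0 rat) \<Rightarrow> nat \<Rightarrow> int" where
  "cf m v j = \<lfloor>of_nat (den m j) * Poly_Mapping.lookup v j\<rfloor>"

definition scal :: "nat \<Rightarrow> (nat \<Rightarrow>\<^sub>0 rat) \<Rightarrow> 'k alg_closure" where
  "scal m v = (\<Prod>j<n. rad m j powi cf m v j)"

text \<open>The product of the current generators with exponents \<open>cf m v j\<close>. For v in
  \<open>lat m\<close>, later stages have in general a different monomial of degree v, but the two
  differ by a nonzero factor from k.\<close>

definition xmon :: "nat \<Rightarrow> (nat \<Rightarrow>\<^sub>0 rat) \<Rightarrow> (nat \<Rightarrow>\<^sub>0 rat) \<Rightarrow>\<^sub>0 'k alg_closure" where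
  "xmon m v = Poly_Mapping.single v (scal m v)"

definition const :: "'k \<Rightarrow> (nat \<Rightarrow>\<^sub>0 rat) \<Rightarrow>\<^sub>0 'k alg_closure" where
  "const c = Poly_Mapping.single 0 (to_ac c)"

definition ring_at :: "nat \<Rightarrow> ((nat \<Rightarrow>\<^sub>0 rat) \<Rightarrow>\<^sub>0 'k alg_closure) set" where
  "ring_at m = lin_span (const ` level m) (xmon m ` lat m)"

definition full_at :: "nat \<Rightarrow> ((nat \<Rightarrow>\<^sub>0 rat) \<Rightarrow>\<^sub>0 'k alg_closure) set" where
  "full_at m = lin_span (range const) (xmon m ` lat m)"

definition full_ring :: "((nat \<Rightarrow>\<^sub>0 rat) \<Rightarrow>\<^sub>0 'k alg_closure) set" where
  "full_ring = (\<Union>m. full_at m)"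

lemma coord_less: "coord m < n"
  using n_pos by (simp add: coord_def)

lemma expo_pos: "0 < expo m"
  by (simp add: expo_def)

lemma den_pos: "0 < den m j"
  by (induction m) (simp_all add: expo_pos)

lemma rad_power: "rad (Suc m) (coord m) ^ expo m = to_ac (\<alpha> m) * rad m (coord m)"
  using someI_ex [OF nth_root_exists [OF expo_pos [of m], of "to_ac (\<alpha> m) * rad m (coord m)"]] by simp

lemma rad_nonzero: "rad m j \<noteq> 0"
proof (induction m)
  case (Suc m)
  then show ?case
    using rad_power [of m] alpha_nonzero [of m] expo_pos [of m] by (cases "j = coord m") (auto simp: zero_power)
qed simp

lemma const_simps:
  "const 1 = 1" "const (a * b) = const a * const b" "const (a - b) = const a - const b"
  "const (a + b) = const a + const b" "const 0 = 0"
  "const a * Poly_Mapping.single v x = Poly_Mapping.single v (to_ac a * x)"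
  by (simp_all add: const_def mult_single single_diff single_add)

lemma const_sum: "const (sum u T) = (\<Sum>i\<in>T. const (u i))"
  by (induction T rule: infinite_finite_induct) (simp_all add: const_simps)

lemma const_power: "const (a ^ i) = const a ^ i"
  by (induction i) (simp_all add: const_simps)

lemma of_int_cf: "v \<in> lat m \<Longrightarrow> of_int (cf m v j) = of_nat (den m j) * Poly_Mapping.lookup v j"
  unfolding lat_def cf_def by (auto elim!: allE [of _ j] Ints_cases)

lemma cf_eqI: "of_nat (den m j) * Poly_Mapping.lookup v j = of_int k \<Longrightarrow> cf m v j = k"
  by (simp add: cf_def)

lemma lat_0: "0 \<in> lat m"
  by (simp add: lat_def)

lemma lat_add: "v \<in> lat m \<Longrightarrow> w \<in> lat m \<Longrightarrow> v + w \<in> lat m"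
  using keys_add [of v w] by (auto simp: lat_def lookup_add distrib_left)

lemma lat_uminus: "v \<in> lat m \<Longrightarrow> - v \<in> lat m"
  by (auto simp: lat_def)

lemma lat_diff: "v \<in> lat m \<Longrightarrow> w \<in> lat m \<Longrightarrow> v - w \<in> lat m"
  using lat_add [of v m "- w"] lat_uminus by simp

lemma lat_Suc: "lat m \<subseteq> lat (Suc m)"
  by (auto simp: lat_def mult.assoc)

lemma lat_mono: "m \<le> m' \<Longrightarrow> lat m \<subseteq> lat m'"
  by (rule lift_Suc_mono_le [of lat]) (rule lat_Suc)

lemma cf_add: "v \<in> lat m \<Longrightarrow> w \<in> lat m \<Longrightarrow> cf m (v + w) j = cf m v j + cf m w j"
  by (rule cf_eqI) (simp add: lookup_add distrib_left of_int_cf)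

lemma scal_nonzero: "scal m v \<noteq> 0"
  by (simp add: scal_def rad_nonzero power_int_eq_0_iff)

lemma scal_0: "scal m 0 = 1"
  by (simp add: scal_def cf_def)

lemma scal_add: "v \<in> lat m \<Longrightarrow> w \<in> lat m \<Longrightarrow> scal m (v + w) = scal m v * scal m w"
  by (simp add: scal_def cf_add power_int_add rad_nonzero prod.distrib)

lemma xmon_add: "v \<in> lat m \<Longrightarrow> w \<in> lat m \<Longrightarrow> xmon m (v + w) = xmon m v * xmon m w"
  by (simp add: xmon_def scal_add mult_single)

lemma xmon_0: "xmon m 0 = 1"
  by (simp add: xmon_def scal_0)

text \<open>Passing to the next stage multiplies the exponent in coordinate \<open>coord m\<close>
  by \<open>expo m\<close>. By the relation defining the new root, its \<open>expo m\<close>-th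
  power is the old scalar times \<open>\<alpha> m\<close>, so one factor \<open>\<alpha> m\<close>
  appears for each unit of the old exponent.\<close>

lemma scal_Suc:
  assumes v: "v \<in> lat m"
  shows "scal (Suc m) v = to_ac (\<alpha> m powi cf m v (coord m)) * scal m v"
proof -
  let ?c = "coord m"
  have c: "?c \<in> {..<n}" using coord_less by simp
  have cf_c: "cf (Suc m) v ?c = int (expo m) * cf m v ?c"
    by (rule cf_eqI) (simp add: of_int_cf [OF v] mult.assoc)
  have cf_other: "cf (Suc m) v j = cf m v j" if "j \<noteq> ?c" for j
    using that by (simp add: cf_def)
  have "scal (Suc m) v = rad (Suc m) ?c powi cf (Suc m) v ?c * (\<Prod>j\<in>{..<n} - {?c}. rad (Suc m) j powi cf (Suc m) v j)"
    unfolding scal_def using c by (intro prod.remove) auto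
  also have "(\<Prod>j\<in>{..<n} - {?c}. rad (Suc m) j powi cf (Suc m) v j) = (\<Prod>j\<in>{..<n} - {?c}. rad m j powi cf m v j)"
    by (intro prod.cong) (auto simp: cf_other)
  also have "rad (Suc m) ?c powi cf (Suc m) v ?c = (rad (Suc m) ?c ^ expo m) powi cf m v ?c"
    unfolding cf_c power_int_mult by simp
  also have "\<dots> = to_ac (\<alpha> m powi cf m v ?c) * rad m ?c powi cf m v ?c"
    unfolding rad_power by (simp add: power_int_mult_distrib to_ac_power_int)
  also have "\<dots> * (\<Prod>j\<in>{..<n} - {?c}. rad m j powi cf m v j) = to_ac (\<alpha> m powi cf m v ?c) * scal m v"
    unfolding scal_def using c by (simp add: prod.remove [of "{..<n}" ?c])
  finally show ?thesis .
qed

lemma level_power_int: "x \<in> level m \<Longrightarrow> x powi k \<in> level m"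
  by (simp add: power_int_def level_inverse unital_subringD(7) [OF level_subring])

lemma scal_level:
  assumes "v \<in> lat m" "m \<le> m'"
  shows "\<exists>c\<in>level m'. c \<noteq> 0 \<and> scal m' v = to_ac c * scal m v"
  using assms(2)
proof (induction m' rule: dec_induct)
  case base
  then show ?case using unital_subringD(1) [OF level_subring] by (intro bexI [of _ 1]) auto
next
  case (step i)
  then obtain c where c: "c \<in> level i" "c \<noteq> 0" "scal i v = to_ac c * scal m v" by blast
  let ?k = "cf i v (coord i)"
  have "v \<in> lat i" using lat_mono [OF step(1)] assms(1) by blast
  then have "scal (Suc i) v = to_ac (\<alpha> i powi ?k * c) * scal m v"
    by (simp add: scal_Suc c(3))
  moreover have "\<alpha> i powi ?k * c \<in> level (Suc i)"
    using c(1) level_mono [of i "Suc i"] level_power_int [OF alpha_level]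
    by (intro unital_subringD(4) [OF level_subring]) auto
  moreover have "\<alpha> i powi ?k * c \<noteq> 0" using c(2) alpha_nonzero by (simp add: power_int_eq_0_iff)
  ultimately show ?case by blast
qed

lemma xmon_level:
  assumes "v \<in> lat m" "m \<le> m'"
  obtains c where "c \<in> level m'" "c \<noteq> 0" "xmon m v = const c * xmon m' v"
proof -
  obtain c where c: "c \<in> level m'" "c \<noteq> 0" "scal m' v = to_ac c * scal m v"
    using scal_level [OF assms] by blast
  then have "xmon m v = const (inverse c) * xmon m' v"
    by (simp add: xmon_def const_simps mult.assoc [symmetric])
  then show thesis using that [of "inverse c"] c level_inverse by simp
qed

lemma const_level_subring: "unital_subring (const ` level m)"
  by (rule unital_subring_image [OF level_subring]) (simp_all add: const_simps)

lemma const_subring: "unital_subring (range const)"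
  by (rule unital_subring_image) (simp_all add: const_simps unital_subring_def)

lemma ring_at_subring: "unital_subring (ring_at m)"
  unfolding ring_at_def
  by (rule unital_subring_lin_span [OF const_level_subring lat_0]) (simp_all add: lat_add xmon_0 xmon_add)

lemma full_at_subring: "unital_subring (full_at m)"
  unfolding full_at_def
  by (rule unital_subring_lin_span [OF const_subring lat_0]) (simp_all add: lat_add xmon_0 xmon_add)

lemma const_xmon_ring_at: "c \<in> level m \<Longrightarrow> v \<in> lat m \<Longrightarrow> const c * xmon m v \<in> ring_at m"
  unfolding ring_at_def by (intro lin_span_gen) auto

lemma const_xmon_full_at: "v \<in> lat m \<Longrightarrow> const c * xmon m v \<in> full_at m"
  unfolding full_at_def by (intro lin_span_gen) auto

lemma const_ring_at: "c \<in> level m \<Longrightarrow> const c \<in> ring_at m"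
  using const_xmon_ring_at [OF _ lat_0] by (simp add: xmon_0)

lemma const_full_at: "const c \<in> full_at m"
  using const_xmon_full_at [OF lat_0] by (simp add: xmon_0)

lemma xmon_ring_at: "v \<in> lat m \<Longrightarrow> xmon m v \<in> ring_at m"
  using const_xmon_ring_at [of 1 m v] unital_subringD(1) [OF level_subring] by (simp add: const_simps)

lemma ring_at_induct [consumes 1, case_names zero gen add]:
  assumes "x \<in> ring_at m" "Q 0" "\<And>c v. c \<in> level m \<Longrightarrow> v \<in> lat m \<Longrightarrow> Q (const c * xmon m v)"
    "\<And>x y. Q x \<Longrightarrow> Q y \<Longrightarrow> Q (x + y)"
  shows "Q x"
  using assms(1) unfolding ring_at_def by (induction rule: lin_span_induct) (auto intro: assms(2-4))

lemma full_at_induct [consumes 1, case_names zero gen add]: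
  assumes "x \<in> full_at m" "Q 0" "\<And>c v. v \<in> lat m \<Longrightarrow> Q (const c * xmon m v)"
    "\<And>x y. Q x \<Longrightarrow> Q y \<Longrightarrow> Q (x + y)"
  shows "Q x"
  using assms(1) unfolding full_at_def by (induction rule: lin_span_induct) (auto intro: assms(2-4))

lemma ring_at_mono:
  assumes "m \<le> m'"
  shows "ring_at m \<subseteq> ring_at m'"
proof
  fix x assume "x \<in> ring_at m"
  then show "x \<in> ring_at m'"
  proof (induction rule: ring_at_induct)
    case (gen c v)
    obtain d where d: "d \<in> level m'" "xmon m v = const d * xmon m' v"
      using xmon_level [OF gen(2) assms] .
    have "const (c * d) * xmon m' v \<in> ring_at m'"
      using gen d(1) lat_mono [OF assms] level_mono [OF assms]
      by (intro const_xmon_ring_at unital_subringD(4) [OF level_subring]) auto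
    then show ?case unfolding d(2) by (simp add: const_simps mult.assoc)
  qed (auto intro: unital_subringD [OF ring_at_subring])
qed

lemma full_at_mono:
  assumes "m \<le> m'"
  shows "full_at m \<subseteq> full_at m'"
proof
  fix x assume "x \<in> full_at m"
  then show "x \<in> full_at m'"
  proof (induction rule: full_at_induct)
    case (gen c v)
    obtain d where d: "d \<in> level m'" "xmon m v = const d * xmon m' v"
      using xmon_level [OF gen assms] .
    have "const (c * d) * xmon m' v \<in> full_at m'"
      using gen lat_mono [OF assms] by (intro const_xmon_full_at) auto
    then show ?case unfolding d(2) by (simp add: const_simps mult.assoc)
  qed (auto intro: unital_subringD [OF full_at_subring])
qed

lemma ring_at_subset_full_at: "ring_at m \<subseteq> full_at m"
  unfolding ring_at_def full_at_def by (intro lin_span_mono) auto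

lemma ring_at_subset_full_ring: "ring_at m \<subseteq> full_ring"
  using ring_at_subset_full_at by (auto simp: full_ring_def)

lemma full_at_subset_full_ring: "full_at m \<subseteq> full_ring"
  by (auto simp: full_ring_def)

lemma full_ring_subring: "unital_subring full_ring"
  unfolding unital_subring_def
proof (intro conjI ballI)
  show "1 \<in> full_ring" using unital_subringD(1) [OF full_at_subring] by (auto simp: full_ring_def)
  fix x y assume "x \<in> full_ring" "y \<in> full_ring"
  then obtain i j where "x \<in> full_at i" "y \<in> full_at j" by (auto simp: full_ring_def)
  then have "x \<in> full_at (max i j)" "y \<in> full_at (max i j)"
    using full_at_mono [of i "max i j"] full_at_mono [of j "max i j"] by auto
  then show "x - y \<in> full_ring" "x * y \<in> full_ring"
    using unital_subringD(3,4) [OF full_at_subring] full_at_subset_full_ring by blast+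
qed

text \<open>An element involves one lattice and finitely many coefficients, each of which lies in
  some \<open>level\<close>.\<close>

lemma full_ring_cover:
  assumes "x \<in> full_ring"
  obtains m where "x \<in> ring_at m"
proof -
  obtain m where "x \<in> full_at m" using assms by (auto simp: full_ring_def)
  then have "\<exists>m. x \<in> ring_at m"
  proof (induction rule: full_at_induct)
    case zero
    then show ?case using unital_subringD(2) [OF ring_at_subring] by blast
  next
    case (gen c v)
    obtain i where i: "c \<in> level i" using level_cover by blast
    have "const c \<in> ring_at (max i m)" using const_ring_at [OF i] ring_at_mono [of i "max i m"] by auto
    moreover have "xmon m v \<in> ring_at (max i m)" using xmon_ring_at [OF gen] ring_at_mono [of m "max i m"] by auto
    ultimately show ?case using unital_subringD(4) [OF ring_at_subring] by blast
  next
    case (add x y)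
    then obtain i j where "x \<in> ring_at i" "y \<in> ring_at j" by blast
    then have "x \<in> ring_at (max i j)" "y \<in> ring_at (max i j)"
      using ring_at_mono [of i "max i j"] ring_at_mono [of j "max i j"] by auto
    then show ?case using unital_subringD(6) [OF ring_at_subring] by blast
  qed
  then show thesis using that by blast
qed

lemma ring_at_lookup:
  assumes "x \<in> ring_at m"
  shows "v \<notin> lat m \<Longrightarrow> Poly_Mapping.lookup x v = 0"
    "v \<in> lat m \<Longrightarrow> \<exists>c\<in>level m. Poly_Mapping.lookup x v = to_ac c * scal m v"
proof -
  have "(v \<notin> lat m \<longrightarrow> Poly_Mapping.lookup x v = 0) \<and>
    (v \<in> lat m \<longrightarrow> (\<exists>c\<in>level m. Poly_Mapping.lookup x v = to_ac c * scal m v))"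
    using assms
  proof (induction rule: ring_at_induct)
    case zero
    then show ?case using unital_subringD(2) [OF level_subring] by force
  next
    case (gen c w)
    then show ?case
      using unital_subringD(2) [OF level_subring, of m]
      by (auto simp: xmon_def const_simps lookup_single when_def intro: bexI [of _ 0])
  next
    case (add x y)
    show ?case
    proof (cases "v \<in> lat m")
      case True
      then obtain c d where cd: "c \<in> level m" "Poly_Mapping.lookup x v = to_ac c * scal m v"
        "d \<in> level m" "Poly_Mapping.lookup y v = to_ac d * scal m v" using add by blast
      then have "Poly_Mapping.lookup (x + y) v = to_ac (c + d) * scal m v"
        by (simp add: lookup_add distrib_right)
      then show ?thesis using True cd unital_subringD(6) [OF level_subring] by blast
    qed (use add in \<open>simp add: lookup_add\<close>)
  qed
  then show "v \<notin> lat m \<Longrightarrow> Poly_Mapping.lookup x v = 0"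
    "v \<in> lat m \<Longrightarrow> \<exists>c\<in>level m. Poly_Mapping.lookup x v = to_ac c * scal m v" by blast+
qed

section \<open>Generators of the lattices and finiteness over the initial one\<close>

definition shift :: "nat \<Rightarrow> nat \<Rightarrow> int \<Rightarrow> nat \<Rightarrow>\<^sub>0 rat" where
  "shift m j k = Poly_Mapping.single j (of_int k / of_nat (den m j))"

lemma shift_lat: "j < n \<Longrightarrow> shift m j k \<in> lat m"
  using den_pos [of m j] by (auto simp: lat_def shift_def lookup_single when_def split: if_splits)

lemma cf_shift: "cf m (shift m j k) i = (if i = j then k else 0)"
  using den_pos [of m j] by (intro cf_eqI) (auto simp: shift_def lookup_single)

lemma scal_shift: "j < n \<Longrightarrow> scal m (shift m j k) = rad m j powi k"
  by (simp add: scal_def cf_shift if_distrib [of "\<lambda>i. _ powi i"] prod.delta cong: if_cong)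

lemma shift_add: "shift m j (k + l) = shift m j k + shift m j l"
  by (simp add: shift_def add_divide_distrib single_add)

lemma shift_0 [simp]: "shift m j 0 = 0"
  by (simp add: shift_def)

lemma zmul_shift: "zmul k (shift m j 1) = shift m j k"
proof (induction k rule: int_induct [where k = 0])
  case (step1 i)
  then show ?case by (simp add: zmul_succ shift_add)
next
  case (step2 i)
  then show ?case using zmul_diff [of i 1 "shift m j 1"] shift_add [of m j "i - 1" 1] by simp
qed simp

lemma lat_decomp: "v \<in> lat m \<Longrightarrow> v = (\<Sum>j<n. shift m j (cf m v j))"
proof (rule poly_mapping_eqI)
  fix i assume v: "v \<in> lat m"
  have "Poly_Mapping.lookup (\<Sum>j<n. shift m j (cf m v j)) i =
      (\<Sum>j<n. if i = j then of_int (cf m v j) / of_nat (den m j) else 0)"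
    unfolding lookup_sum by (intro sum.cong) (auto simp: shift_def lookup_single)
  also have "\<dots> = (if i < n then of_int (cf m v i) / of_nat (den m i) else 0)" by simp
  also have "\<dots> = Poly_Mapping.lookup v i"
    using v den_pos [of m i] by (auto simp: of_int_cf lat_def in_keys_iff subset_iff)
  finally show "Poly_Mapping.lookup v i = Poly_Mapping.lookup (\<Sum>j<n. shift m j (cf m v j)) i" by simp
qed

lemma lat_group_closure: "lat m = group_closure ((\<lambda>j. shift m j 1) ` {..<n})"
proof
  show "lat m \<subseteq> group_closure ((\<lambda>j. shift m j 1) ` {..<n})"
  proof
    fix v assume "v \<in> lat m"
    then have "v = (\<Sum>j<n. zmul (cf m v j) (shift m j 1))" using lat_decomp by (simp add: zmul_shift)
    also have "\<dots> \<in> group_closure ((\<lambda>j. shift m j 1) ` {..<n})"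
      by (intro sum_group_closure zmul_group_closure group_closure.base) auto
    finally show "v \<in> group_closure ((\<lambda>j. shift m j 1) ` {..<n})" .
  qed
  show "group_closure ((\<lambda>j. shift m j 1) ` {..<n}) \<subseteq> lat m"
  proof
    fix v assume "v \<in> group_closure ((\<lambda>j. shift m j 1) ` {..<n})"
    then show "v \<in> lat m" by induction (auto intro: lat_0 shift_lat lat_diff)
  qed
qed

lemma full_at_noetherian: "noetherian_subring (full_at m)"
  unfolding full_at_def lat_group_closure
proof (rule noetherian_monomial_span)
  show "noetherian_subring (range const)"
    by (rule noetherian_subring_constants) (simp_all add: const_simps)
qed (simp_all add: xmon_0 xmon_add flip: lat_group_closure)

text \<open>Division with remainder in each coordinate: the exponents in T have their coordinates
  between 0 and \<open>den m j\<close>, so they represent \<open>lat m\<close> modulo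
  \<open>lat 0\<close>, and only finitely many exist.\<close>

lemma full_at_span:
  obtains T where "finite T" "T \<subseteq> lat m" "full_at m \<subseteq> lin_span (full_at 0) (xmon m ` T)"
proof
  let ?T = "{v \<in> lat m. \<forall>j<n. cf m v j \<in> {0..<int (den m j)}}"
  let ?f = "\<lambda>u. \<Sum>j<n. shift m j (u j)"
  have "?T \<subseteq> ?f ` (\<Pi>\<^sub>E j\<in>{..<n}. {0..<int (den m j)})"
  proof
    fix v assume v: "v \<in> ?T"
    then have "v = ?f (restrict (cf m v) {..<n})" using lat_decomp [of v m] by simp
    moreover have "restrict (cf m v) {..<n} \<in> (\<Pi>\<^sub>E j\<in>{..<n}. {0..<int (den m j)})" using v by auto
    ultimately show "v \<in> ?f ` (\<Pi>\<^sub>E j\<in>{..<n}. {0..<int (den m j)})" by blast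
  qed
  then show "finite ?T" by (rule finite_subset) (intro finite_imageI finite_PiE; simp)
  show "?T \<subseteq> lat m" by blast
  show "full_at m \<subseteq> lin_span (full_at 0) (xmon m ` ?T)"
  proof
    fix x assume "x \<in> full_at m"
    then show "x \<in> lin_span (full_at 0) (xmon m ` ?T)"
    proof (induction rule: full_at_induct)
      case (gen c v)
      \<comment> \<open>The part of v with integer coordinates, formed from the quotients. The
        monomials of w at stages 0 and m differ by a unit of k, so either may serve as a coefficient
        from \<open>full_at 0\<close>.\<close>
      define w where "w = (\<Sum>j<n. shift 0 j (cf m v j div int (den m j)))"
      have w0: "w \<in> lat 0"
        unfolding w_def using sum_group_closure [of "{..<n}" _ "(\<lambda>j. shift 0 j 1) ` {..<n}"]
        by (simp add: shift_lat flip: lat_group_closure)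
      then have w: "w \<in> lat m" using lat_mono [of 0 m] by auto
      have lookup_w: "Poly_Mapping.lookup w j = of_int (cf m v j div int (den m j))" if "j < n" for j
        unfolding w_def lookup_sum using that by (simp add: shift_def lookup_single when_def)
      have vw: "v - w \<in> lat m" using lat_diff [OF gen w] .
      have "cf m (v - w) j = cf m v j mod int (den m j)" if "j < n" for j
      proof (rule cf_eqI)
        have "of_nat (den m j) * Poly_Mapping.lookup (v - w) j =
            (of_int (cf m v j - int (den m j) * (cf m v j div int (den m j))) :: rat)"
          by (simp add: lookup_minus lookup_w [OF that] right_diff_distrib of_int_cf [OF gen])
        then show "of_nat (den m j) * Poly_Mapping.lookup (v - w) j = rat_of_int (cf m v j mod int (den m j))"
          by (simp add: minus_mult_div_eq_mod)
      qed
      then have "v - w \<in> ?T" using vw den_pos by simp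
      moreover obtain d where "xmon 0 w = const d * xmon m w" "d \<noteq> 0"
        using xmon_level [OF w0, of m] by auto
      then have "xmon m w = const (inverse d) * xmon 0 w"
        by (simp add: mult.assoc [symmetric] const_simps(1) flip: const_simps(2))
      then have "const c * xmon m w \<in> full_at 0"
        using const_xmon_full_at [OF w0, of "c * inverse d"] by (simp add: const_simps mult.assoc)
      ultimately have "(const c * xmon m w) * xmon m (v - w) \<in> lin_span (full_at 0) (xmon m ` ?T)"
        by (intro lin_span_gen) auto
      then show ?case using xmon_add [OF w vw] by (simp add: mult.assoc)
    qed (auto intro: lin_span.zero lin_span_add)
  qed
qed

text \<open>All powers of an element stay in one \<open>full_at m\<close>, a finitely generated
  module over \<open>full_at 0\<close>.\<close>

lemma full_ring_algebraic:
  assumes "a \<in> full_ring"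
  shows "\<exists>E. finite E \<and> E \<subseteq> full_ring \<and> (\<forall>i. a ^ i \<in> lin_span (full_at 0) E)"
proof -
  obtain m where m: "a \<in> full_at m" using assms by (auto simp: full_ring_def)
  obtain T where T: "finite T" "T \<subseteq> lat m" "full_at m \<subseteq> lin_span (full_at 0) (xmon m ` T)"
    by (rule full_at_span)
  have "xmon m ` T \<subseteq> full_ring"
    using T(2) xmon_ring_at ring_at_subset_full_ring by blast
  moreover have "a ^ i \<in> lin_span (full_at 0) (xmon m ` T)" for i
    using unital_subringD(7) [OF full_at_subring m] T(3) by blast
  ultimately show ?thesis using T(1) by (intro exI [of _ "xmon m ` T"]) auto
qed

section \<open>One step of the tower as a localised polynomial ring\<close>

definition ymon :: "nat \<Rightarrow> (nat \<Rightarrow>\<^sub>0 rat) \<Rightarrow>\<^sub>0 'k alg_closure" where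
  "ymon m = xmon (Suc m) (shift (Suc m) (coord m) 1)"

lemma ymon_power_xmon: "ymon m ^ i = xmon (Suc m) (shift (Suc m) (coord m) (int i))"
proof (induction i)
  case (Suc i)
  then show ?case
    using xmon_add [OF shift_lat shift_lat, OF coord_less coord_less, of "Suc m" m 1 m "int i"]
    by (simp add: ymon_def shift_add)
qed (simp add: xmon_0)

lemma ymon_power:
  "ymon m ^ i = Poly_Mapping.single (shift (Suc m) (coord m) (int i)) (rad (Suc m) (coord m) ^ i)"
  by (simp add: ymon_power_xmon xmon_def scal_shift [OF coord_less] del: rad.simps)

lemma shift_Suc: "shift (Suc m) (coord m) (int (expo m) * k) = shift m (coord m) k"
  using expo_pos [of m] by (simp add: shift_def)

definition uinv :: "nat \<Rightarrow> (nat \<Rightarrow>\<^sub>0 rat) \<Rightarrow>\<^sub>0 'k alg_closure" where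
  "uinv m = xmon m (shift m (coord m) (- 1))"

lemma uinv_ring_at: "uinv m \<in> ring_at m"
  unfolding uinv_def by (intro xmon_ring_at shift_lat coord_less)

lemma uinv_inverse: "xmon m (shift m (coord m) 1) * uinv m = 1"
  using xmon_add [OF shift_lat shift_lat, OF coord_less coord_less, of m m 1 m "- 1"] shift_add [of m "coord m" 1 "- 1"]
  by (simp add: uinv_def xmon_0)

lemma const_alpha: "const (\<alpha> m) = ymon m ^ expo m * uinv m"
proof -
  have "ymon m ^ expo m = Poly_Mapping.single (shift m (coord m) 1) (to_ac (\<alpha> m) * rad m (coord m))"
    unfolding ymon_power rad_power using shift_Suc [of m 1] by simp
  also have "\<dots> = const (\<alpha> m) * xmon m (shift m (coord m) 1)"
    by (simp add: const_simps xmon_def scal_shift [OF coord_less])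
  finally show ?thesis using uinv_inverse [of m] by (simp add: mult.assoc)
qed

text \<open>The result of substituting for \<open>\<alpha> m\<close> its expression as
  \<open>ymon m ^ expo m * uinv m\<close>. The outcome is a polynomial in the new generator with
  coefficients from the preceding ring.\<close>

definition lift_poly :: "nat \<Rightarrow> 'k poly \<Rightarrow> ((nat \<Rightarrow>\<^sub>0 rat) \<Rightarrow>\<^sub>0 'k alg_closure) poly" where
  "lift_poly m a = (\<Sum>i\<le>Polynomial.degree a.
     Polynomial.monom (const (Polynomial.coeff a i) * uinv m ^ i) (expo m * i))"

lemma poly_lift_poly: "poly (lift_poly m a) (ymon m) = const (poly a (\<alpha> m))"
  unfolding lift_poly_def poly_sum poly_monom poly_altdef [of a] const_sum
  by (intro sum.cong refl)
    (simp add: const_simps(2) const_power const_alpha power_mult_distrib mult_ac flip: power_mult)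

lemma lift_poly_ring_at:
  assumes "a \<in> polys (level m)"
  shows "lift_poly m a \<in> polys (ring_at m)"
  unfolding lift_poly_def
  by (intro unital_subring_sum [OF unital_subring_polys [OF ring_at_subring]] polys_closed(6) [OF ring_at_subring]
      unital_subringD(4,7) [OF ring_at_subring] const_ring_at uinv_ring_at polysD [OF assms])

lemma coeff_lift_poly:
  assumes "i \<le> Polynomial.degree a"
  shows "Polynomial.coeff (lift_poly m a) (expo m * i) = const (Polynomial.coeff a i) * uinv m ^ i"
proof -
  have "Polynomial.coeff (lift_poly m a) (expo m * i) =
      (\<Sum>j\<le>Polynomial.degree a. if j = i then const (Polynomial.coeff a j) * uinv m ^ j else 0)"
    unfolding lift_poly_def coeff_sum using expo_pos [of m] by (intro sum.cong) auto
  then show ?thesis using assms by simp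
qed

text \<open>The multiplicative set at which the polynomial ring in \<open>ymon m\<close> is
  localised. Its elements are nonzero constants and therefore units of the full ring.\<close>

definition denoms :: "nat \<Rightarrow> ((nat \<Rightarrow>\<^sub>0 rat) \<Rightarrow>\<^sub>0 'k alg_closure) set" where
  "denoms m = (\<lambda>a. const (poly a (\<alpha> m))) ` {a \<in> polys (level m). poly a (\<alpha> m) \<noteq> 0}"

lemma denoms_1: "1 \<in> denoms m"
  unfolding denoms_def by (intro image_eqI [of _ _ 1]) (simp_all add: const_simps polys_closed(2) [OF level_subring])

lemma denoms_mult: "d \<in> denoms m \<Longrightarrow> e \<in> denoms m \<Longrightarrow> d * e \<in> denoms m"
proof -
  assume "d \<in> denoms m" "e \<in> denoms m"
  then obtain a b where "a \<in> polys (level m)" "poly a (\<alpha> m) \<noteq> 0" "d = const (poly a (\<alpha> m))"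
    "b \<in> polys (level m)" "poly b (\<alpha> m) \<noteq> 0" "e = const (poly b (\<alpha> m))"
    by (auto simp: denoms_def)
  then show ?thesis
    unfolding denoms_def using polys_closed(5) [OF level_subring]
    by (intro image_eqI [of _ _ "a * b"]) (simp_all add: const_simps)
qed

text \<open>The leading coefficient of the lifted polynomial is a nonzero constant from
  \<open>level m\<close> times a power of the unit \<open>uinv m\<close>. It is a unit of
  \<open>ring_at m\<close> and cannot lie in Q.\<close>

lemma denoms_not_prime:
  assumes "d \<in> denoms m" and Q: "prime_in (ring_at m) Q"
  shows "\<exists>f\<in>polys (ring_at m). f \<notin> polys Q \<and> d = poly f (ymon m)"
proof -
  obtain a where a: "a \<in> polys (level m)" "poly a (\<alpha> m) \<noteq> 0" "d = const (poly a (\<alpha> m))"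
    using assms(1) by (auto simp: denoms_def)
  have "lift_poly m a \<notin> polys Q"
  proof
    assume in_Q: "lift_poly m a \<in> polys Q"
    let ?i = "Polynomial.degree a"
    let ?c = "Polynomial.coeff a ?i" and ?u = "xmon m (shift m (coord m) 1)"
    have "?c \<noteq> 0" using a(2) by auto
    have "const ?c * uinv m ^ ?i \<in> Q"
      using polysD [OF in_Q, of "expo m * ?i"] by (simp add: coeff_lift_poly)
    moreover have "const (inverse ?c) * ?u ^ ?i \<in> ring_at m"
      using polysD [OF a(1)] coord_less
      by (intro unital_subringD(4,7) [OF ring_at_subring] const_ring_at xmon_ring_at level_inverse shift_lat)
    ultimately have "(const (inverse ?c) * ?u ^ ?i) * (const ?c * uinv m ^ ?i) \<in> Q"
      by (rule ideal_inD(4) [OF prime_inD(1) [OF Q], rotated])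
    moreover have "(const (inverse ?c) * ?u ^ ?i) * (const ?c * uinv m ^ ?i) =
        const (inverse ?c * ?c) * (?u * uinv m) ^ ?i"
      by (simp only: const_simps(2) power_mult_distrib mult_ac)
    ultimately show False
      using prime_inD(2) [OF Q] \<open>?c \<noteq> 0\<close> by (simp add: uinv_inverse const_simps(1))
  qed
  then show ?thesis using lift_poly_ring_at [OF a(1)] a(3) by (auto simp: poly_lift_poly)
qed

text \<open>The degree of a monomial splits into fewer than \<open>expo m\<close> copies of the new
  generator and a degree of the old lattice; its coefficient is a fraction in
  \<open>\<alpha> m\<close>, whose numerator lifts to a polynomial in \<open>ymon m\<close>.\<close>

lemma ring_at_Suc_fraction:
  assumes "r \<in> ring_at (Suc m)"
  shows "\<exists>d\<in>denoms m. \<exists>f\<in>polys (ring_at m). d * r = poly f (ymon m)"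
  using assms
proof (induction rule: ring_at_induct)
  case zero
  show ?case using denoms_1 polys_closed(1) [OF ring_at_subring] by (intro bexI [of _ 1] bexI [of _ 0]) auto
next
  case (gen c v)
  let ?j = "coord m" and ?p = "int (expo m)"
  define k where "k = cf (Suc m) v ?j"
  \<comment> \<open>The remainder of the exponent. Once these copies of the new generator are
    removed, the exponent is a multiple of \<open>expo m\<close>, so the rest w belongs to the old
    lattice.\<close>
  define i where "i = nat (k mod ?p)"
  have i: "int i = k mod ?p" using expo_pos [of m] by (simp add: i_def)
  define w where "w = v - shift (Suc m) ?j (int i)"
  have w': "w \<in> lat (Suc m)" unfolding w_def by (intro lat_diff gen(2) shift_lat coord_less)
  have "of_nat (den m ?j) * Poly_Mapping.lookup w ?j = (of_int (k div ?p) :: rat)"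
  proof -
    have "of_nat (expo m) * (of_nat (den m ?j) * Poly_Mapping.lookup w ?j) = (of_int (k - int i) :: rat)"
      using of_int_cf [OF gen(2), of ?j] den_pos [of m ?j] expo_pos [of m]
      by (simp add: w_def lookup_minus shift_def right_diff_distrib k_def mult.assoc)
    also have "k - int i = ?p * (k div ?p)" by (simp add: i minus_mod_eq_mult_div)
    finally show ?thesis using expo_pos [of m] by simp
  qed
  moreover have "of_nat (den m j) * Poly_Mapping.lookup w j \<in> \<int>" if "j \<noteq> ?j" for j
    using w' that unfolding lat_def by (auto dest: spec [of _ j])
  ultimately have "of_nat (den m j) * Poly_Mapping.lookup w j \<in> \<int>" for j
    by (cases "j = ?j") simp_all
  then have w: "w \<in> lat m" using w' by (simp add: lat_def)
  have "v = shift (Suc m) ?j (int i) + w" by (simp add: w_def)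
  then have v: "xmon (Suc m) v = ymon m ^ i * xmon (Suc m) w"
    using xmon_add [OF shift_lat [OF coord_less] w'] by (simp add: ymon_power_xmon)
  \<comment> \<open>Writing the new monomial of w through the old one costs this power of
    \<open>\<alpha> m\<close>. It is absorbed into the coefficient before that is written as a
    fraction.\<close>
  define l where "l = \<alpha> m powi cf m w ?j"
  have xw: "xmon (Suc m) w = const l * xmon m w"
    by (simp add: xmon_def scal_Suc [OF w] const_simps l_def)
  have "c * l \<in> level (Suc m)"
    unfolding l_def by (intro unital_subringD(4) [OF level_subring] gen(1) level_power_int alpha_level)
  then obtain a b where ab: "a \<in> polys (level m)" "b \<in> polys (level m)" "poly b (\<alpha> m) \<noteq> 0"
    "poly b (\<alpha> m) * (c * l) = poly a (\<alpha> m)" by (rule level_fraction)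
  have "const (poly b (\<alpha> m)) * (const c * xmon (Suc m) v) =
      const (poly b (\<alpha> m) * (c * l)) * (xmon m w * ymon m ^ i)"
    unfolding v xw by (simp only: const_simps(2) mult_ac)
  also have "\<dots> = poly (lift_poly m a * Polynomial.monom (xmon m w) i) (ymon m)"
    by (simp add: ab(4) poly_lift_poly poly_monom)
  finally have "const (poly b (\<alpha> m)) * (const c * xmon (Suc m) v) =
      poly (lift_poly m a * Polynomial.monom (xmon m w) i) (ymon m)" .
  moreover have "const (poly b (\<alpha> m)) \<in> denoms m" using ab by (auto simp: denoms_def)
  moreover have "lift_poly m a * Polynomial.monom (xmon m w) i \<in> polys (ring_at m)"
    by (intro polys_closed(5,6) [OF ring_at_subring] lift_poly_ring_at ab xmon_ring_at w)
  ultimately show ?case by blast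
next
  case (add x y)
  then obtain d f e g where *: "d \<in> denoms m" "f \<in> polys (ring_at m)" "d * x = poly f (ymon m)"
    "e \<in> denoms m" "g \<in> polys (ring_at m)" "e * y = poly g (ymon m)" by blast
  obtain a b where "a \<in> polys (level m)" "d = const (poly a (\<alpha> m))"
    "b \<in> polys (level m)" "e = const (poly b (\<alpha> m))" using *(1,4) by (auto simp: denoms_def)
  then have ab: "lift_poly m a \<in> polys (ring_at m)" "d = poly (lift_poly m a) (ymon m)"
    "lift_poly m b \<in> polys (ring_at m)" "e = poly (lift_poly m b) (ymon m)"
    by (simp_all add: lift_poly_ring_at poly_lift_poly)
  have "(d * e) * (x + y) = e * (d * x) + d * (e * y)" by (simp add: algebra_simps)
  also have "\<dots> = poly (lift_poly m b * f + lift_poly m a * g) (ymon m)"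
    unfolding *(3,6) by (simp add: ab(2,4))
  finally have "(d * e) * (x + y) = poly (lift_poly m b * f + lift_poly m a * g) (ymon m)" .
  moreover have "lift_poly m b * f + lift_poly m a * g \<in> polys (ring_at m)"
    by (intro polys_closed(3,5) [OF ring_at_subring] ab * )
  ultimately show ?case using denoms_mult [OF *(1,4)] by blast
qed

text \<open>
  In degree \<open>v\<close> only those powers of \<open>ymon m\<close> contribute whose exponents agree modulo
  \<open>expo m\<close>; their contributions form a polynomial in \<open>\<alpha> m\<close>.
\<close>

lemma ymon_transcendental:
  assumes f: "f \<in> polys (ring_at m)" and zero: "poly f (ymon m) = 0"
  shows "f = 0"
proof (rule poly_eqI)
  fix i
  let ?j = "coord m" and ?p = "expo m"
  have "Polynomial.coeff f i = 0"
  proof (rule poly_mapping_eqI)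
    fix w
    show "Poly_Mapping.lookup (Polynomial.coeff f i) w = Poly_Mapping.lookup 0 w"
    proof (cases "w \<in> lat m")
      case False
      then show ?thesis using ring_at_lookup(1) [OF polysD [OF f]] by simp
    next
      case w: True
      define i\<^sub>0 where "i\<^sub>0 = i mod ?p"
      define l\<^sub>0 where "l\<^sub>0 = i div ?p"
      have i: "i = i\<^sub>0 + ?p * l\<^sub>0" by (simp add: i\<^sub>0_def l\<^sub>0_def)
      \<comment> \<open>All exponents of f lie below \<open>?p * N\<close>, and this range contains
        exactly N exponents of each residue modulo \<open>?p\<close>.\<close>
      define N where "N = Suc (Polynomial.degree f)"
      have pN: "Polynomial.degree f < ?p * N"
        using mult_le_mono1 [of 1 ?p N] expo_pos [of m] by (simp add: N_def)
      \<comment> \<open>The degree in which the w-term of the i-th coefficient contributes to the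
        value of f. \<open>F i'\<close> is the contribution of the i'-th coefficient to the same
        degree.\<close>
      define v where "v = w + shift (Suc m) ?j (int i)"
      define F where "F i' = rad (Suc m) ?j ^ i' *
        Poly_Mapping.lookup (Polynomial.coeff f i') (v - shift (Suc m) ?j (int i'))" for i'
      have sh: "v - shift (Suc m) ?j (int i') = w + shift (Suc m) ?j (int i - int i')" for i'
        using shift_add [of "Suc m" ?j "int i - int i'" "int i'"] by (simp add: v_def algebra_simps)
      have "(\<Sum>i'<?p * N. F i') = (\<Sum>i'\<le>Polynomial.degree f. F i')"
        using pN by (intro sum.mono_neutral_right) (auto simp: F_def coeff_eq_0)
      also have "\<dots> = Poly_Mapping.lookup (poly f (ymon m)) v"
        unfolding poly_altdef lookup_sum F_def
      proof (rule sum.cong [OF refl])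
        fix i'
        show "rad (Suc m) ?j ^ i' * Poly_Mapping.lookup (Polynomial.coeff f i') (v - shift (Suc m) ?j (int i')) =
            Poly_Mapping.lookup (Polynomial.coeff f i' * ymon m ^ i') v"
          unfolding ymon_power by (simp only: lookup_single_mult mult.commute [of "Polynomial.coeff f i'"])
      qed
      finally have sum0: "(\<Sum>i'<?p * N. F i') = 0" using zero by simp
      \<comment> \<open>The degree required of the i'-th coefficient differs from w by i - i' copies
        of the new generator, and lies in the old lattice only if \<open>?p\<close> divides i -
        i'.\<close>
      have F0: "F i' = 0" if "i' mod ?p \<noteq> i\<^sub>0" for i'
      proof -
        have "v - shift (Suc m) ?j (int i') \<notin> lat m"
        proof
          assume "v - shift (Suc m) ?j (int i') \<in> lat m"
          then have "shift (Suc m) ?j (int i - int i') \<in> lat m"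
            using lat_diff [OF _ w, of "w + shift (Suc m) ?j (int i - int i')"] by (simp add: sh)
          then have "of_nat (den m ?j) * Poly_Mapping.lookup (shift (Suc m) ?j (int i - int i')) ?j =
              rat_of_int (cf m (shift (Suc m) ?j (int i - int i')) ?j)"
            by (rule of_int_cf [symmetric])
          then obtain z where "of_nat (den m ?j) * Poly_Mapping.lookup (shift (Suc m) ?j (int i - int i')) ?j = rat_of_int z"
            by blast
          then have "of_int (int i - int i') / of_nat ?p = rat_of_int z"
            using den_pos [of m ?j] by (simp add: shift_def)
          then have "(of_int (int i - int i') :: rat) = of_int (int ?p * z)"
            using expo_pos [of m] by (simp add: field_simps)
          then have "int i - int i' = int ?p * z" by (simp only: of_int_eq_iff)
          then have "int i mod int ?p = int i' mod int ?p" by (simp add: mod_eq_dvd_iff)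
          then show False using that by (simp add: i\<^sub>0_def flip: of_nat_mod)
        qed
        then show ?thesis unfolding F_def using ring_at_lookup(1) [OF polysD [OF f]] by simp
      qed
      have "(\<Sum>i'<?p * N. F i') = (\<Sum>i'\<in>(\<lambda>l. i\<^sub>0 + ?p * l) ` {..<N}. F i')"
      proof (rule sum.mono_neutral_right)
        show "(\<lambda>l. i\<^sub>0 + ?p * l) ` {..<N} \<subseteq> {..<?p * N}"
        proof
          fix x assume "x \<in> (\<lambda>l. i\<^sub>0 + ?p * l) ` {..<N}"
          then obtain l where l: "l < N" "x = i\<^sub>0 + ?p * l" by auto
          have "i\<^sub>0 < ?p" using expo_pos [of m] by (simp add: i\<^sub>0_def)
          then have "x < ?p * Suc l" using l by simp
          also have "\<dots> \<le> ?p * N" using l by (intro mult_le_mono2) simp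
          finally show "x \<in> {..<?p * N}" by simp
        qed
        show "\<forall>x\<in>{..<?p * N} - (\<lambda>l. i\<^sub>0 + ?p * l) ` {..<N}. F x = 0"
        proof
          fix x assume x: "x \<in> {..<?p * N} - (\<lambda>l. i\<^sub>0 + ?p * l) ` {..<N}"
          show "F x = 0"
          proof (rule F0, rule notI)
            assume "x mod ?p = i\<^sub>0"
            then have "x = i\<^sub>0 + ?p * (x div ?p)" by (metis mod_mult_div_eq)
            moreover have "x div ?p < N" using x by (simp add: less_mult_imp_div_less mult.commute)
            ultimately show False using x by blast
          qed
        qed
      qed simp
      also have "\<dots> = (\<Sum>l<N. F (i\<^sub>0 + ?p * l))"
        using expo_pos [of m] by (subst sum.reindex) (auto simp: inj_on_def)
      finally have sum0': "(\<Sum>l<N. F (i\<^sub>0 + ?p * l)) = 0" using sum0 by simp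
      have "\<forall>l. \<exists>c\<in>level m. Poly_Mapping.lookup (Polynomial.coeff f (i\<^sub>0 + ?p * l)) (w + shift m ?j (int l\<^sub>0 - int l)) =
          to_ac c * scal m (w + shift m ?j (int l\<^sub>0 - int l))"
        using ring_at_lookup(2) [OF polysD [OF f]] lat_add [OF w shift_lat [OF coord_less]] by blast
      then obtain e where e: "\<And>l. e l \<in> level m"
        "\<And>l. Poly_Mapping.lookup (Polynomial.coeff f (i\<^sub>0 + ?p * l)) (w + shift m ?j (int l\<^sub>0 - int l)) =
          to_ac (e l) * scal m (w + shift m ?j (int l\<^sub>0 - int l))"
        by metis
      \<comment> \<open>The factor common to all contributions in degree v; what remains of the l-th
        one is \<open>e l * \<alpha> m ^ l\<close>, with coefficient in
        \<open>level m\<close>.\<close>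
      define s where "s = scal m w * rad m ?j powi int l\<^sub>0 * rad (Suc m) ?j ^ i\<^sub>0"
      have s: "s \<noteq> 0" by (simp add: s_def scal_nonzero rad_nonzero power_int_eq_0_iff del: rad.simps)
      have F_eq: "F (i\<^sub>0 + ?p * l) = to_ac (e l * \<alpha> m ^ l) * s" for l
      proof -
        have "int i - int (i\<^sub>0 + ?p * l) = int ?p * (int l\<^sub>0 - int l)"
          by (subst i) (simp add: algebra_simps)
        then have "v - shift (Suc m) ?j (int (i\<^sub>0 + ?p * l)) = w + shift m ?j (int l\<^sub>0 - int l)"
          unfolding sh by (simp only: shift_Suc)
        then have "F (i\<^sub>0 + ?p * l) = rad (Suc m) ?j ^ (i\<^sub>0 + ?p * l) * (to_ac (e l) * scal m (w + shift m ?j (int l\<^sub>0 - int l)))"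
          unfolding F_def by (simp only: e(2))
        also have "scal m (w + shift m ?j (int l\<^sub>0 - int l)) = scal m w * rad m ?j powi (int l\<^sub>0 - int l)"
          by (simp add: scal_add [OF w shift_lat [OF coord_less]] scal_shift [OF coord_less])
        also have "rad (Suc m) ?j ^ (i\<^sub>0 + ?p * l) = rad (Suc m) ?j ^ i\<^sub>0 * (to_ac (\<alpha> m) ^ l * rad m ?j ^ l)"
          unfolding power_add power_mult rad_power power_mult_distrib ..
        also have "rad m ?j powi (int l\<^sub>0 - int l) = rad m ?j powi int l\<^sub>0 * inverse (rad m ?j ^ l)"
          by (simp add: power_int_diff rad_nonzero divide_inverse)
        finally show ?thesis by (simp add: s_def rad_nonzero del: rad.simps)
      qed
      have "(\<Sum>l<N. to_ac (e l * \<alpha> m ^ l)) * s = 0"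
        using sum0' by (simp add: F_eq sum_distrib_right)
      then have "to_ac (\<Sum>l<N. e l * \<alpha> m ^ l) = 0" using s by (simp add: to_ac_sum)
      then have "poly (\<Sum>l<N. Polynomial.monom (e l) l) (\<alpha> m) = 0" by (simp add: poly_sum poly_monom)
      moreover have "(\<Sum>l<N. Polynomial.monom (e l) l) \<in> polys (level m)"
        by (intro unital_subring_sum [OF unital_subring_polys [OF level_subring]] polys_closed(6) [OF level_subring] e)
      ultimately have "(\<Sum>l<N. Polynomial.monom (e l) l) = 0" by (rule alpha_transcendental [rotated])
      then have "Polynomial.coeff (\<Sum>l<N. Polynomial.monom (e l) l) l\<^sub>0 = 0" by simp
      then have "e l\<^sub>0 = 0" if "l\<^sub>0 < N" using that by (simp add: coeff_sum)
      moreover have "Polynomial.coeff f i = 0" if "\<not> l\<^sub>0 < N"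
      proof (rule coeff_eq_0)
        have "l\<^sub>0 \<le> i" by (simp add: l\<^sub>0_def)
        then show "Polynomial.degree f < i" using that by (simp add: N_def)
      qed
      ultimately show ?thesis using e(2) [of l\<^sub>0] by (cases "l\<^sub>0 < N") (simp_all flip: i)
    qed
  qed
  then show "Polynomial.coeff f i = Polynomial.coeff 0 i" by simp
qed

section \<open>Extension of primes along the tower\<close>

definition extend :: "nat \<Rightarrow> ((nat \<Rightarrow>\<^sub>0 rat) \<Rightarrow>\<^sub>0 'k alg_closure) set \<Rightarrow> ((nat \<Rightarrow>\<^sub>0 rat) \<Rightarrow>\<^sub>0 'k alg_closure) set" where
  "extend m Q = {r \<in> ring_at (Suc m). \<exists>d\<in>denoms m. \<exists>f\<in>polys Q. d * r = poly f (ymon m)}"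

lemma prime_in_extend:
  assumes "prime_in (ring_at m) Q"
  shows "prime_in (ring_at (Suc m)) (extend m Q)"
  unfolding extend_def
  by (rule prime_extension [OF ring_at_subring assms ring_at_subring])
    (auto intro: ymon_transcendental denoms_1 denoms_mult denoms_not_prime [OF _ assms] dest: ring_at_Suc_fraction)

lemma subset_extend:
  assumes "prime_in (ring_at m) Q"
  shows "Q \<subseteq> extend m Q"
proof
  fix r assume r: "r \<in> Q"
  note I = prime_inD(1) [OF assms]
  have "r \<in> ring_at (Suc m)" using ideal_inD(1) [OF I r] ring_at_mono [of m "Suc m"] by auto
  moreover have "[:r:] \<in> polys Q" using r ideal_inD(2) [OF I] by (auto simp: polys_def coeff_pCons split: nat.split)
  moreover have "1 * r = poly [:r:] (ymon m)" by simp
  ultimately show "r \<in> extend m Q" unfolding extend_def using denoms_1 by blast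
qed

text \<open>The denominators become invertible in the full ring. An arbitrary ideal J is allowed
  because two bounds are wanted for the extended primes: the given prime P, and the ideal generated
  by the part of P at one stage.\<close>

lemma extend_minimal:
  assumes "ideal_in full_ring J" "Q \<subseteq> J"
  shows "extend m Q \<subseteq> J"
proof
  fix r assume "r \<in> extend m Q"
  then obtain d f where *: "d \<in> denoms m" "f \<in> polys Q" "d * r = poly f (ymon m)"
    by (auto simp: extend_def)
  obtain a where a: "poly a (\<alpha> m) \<noteq> 0" "d = const (poly a (\<alpha> m))" using *(1) by (auto simp: denoms_def)
  have "ymon m \<in> full_ring"
    unfolding ymon_def using xmon_ring_at [OF shift_lat [OF coord_less]] ring_at_subset_full_ring by blast
  moreover have "f \<in> polys J" using *(2) assms(2) by (auto simp: polys_def)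
  ultimately have "d * r \<in> J" unfolding *(3) by (intro poly_closed [OF full_ring_subring assms(1)])
  moreover have "const (inverse (poly a (\<alpha> m))) \<in> full_ring"
    using const_full_at full_at_subset_full_ring by blast
  ultimately have "const (inverse (poly a (\<alpha> m))) * (d * r) \<in> J"
    by (rule ideal_inD(4) [OF assms(1), rotated])
  moreover have "const (inverse (poly a (\<alpha> m))) * (d * r) = const (inverse (poly a (\<alpha> m)) * poly a (\<alpha> m)) * r"
    by (simp add: a(2) const_simps(2) mult.assoc)
  ultimately show "r \<in> J" using a(1) by (simp add: const_simps(1))
qed

text \<open>
  The extension of \<open>P \<inter> ring_at M\<close> to the full ring is a prime below \<open>P\<close>. For large \<open>M\<close> it has the
  same contraction to \<open>full_at 0\<close> as \<open>P\<close>.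
\<close>

lemma prime_extension_exists:
  assumes P: "prime_in full_ring P"
  obtains Q where "prime_in full_ring Q" "P \<inter> ring_at M \<subseteq> Q" "Q \<subseteq> lin_span full_ring (P \<inter> ring_at M)" "Q \<subseteq> P"
proof -
  \<comment> \<open>The t-th term is a prime of \<open>ring_at (M + t)\<close>. Every product or sum
    in the union can be examined at one late enough stage.\<close>
  define q where "q = rec_nat (P \<inter> ring_at M) (\<lambda>t. extend (M + t))"
  have q_0: "q 0 = P \<inter> ring_at M" and q_Suc: "q (Suc t) = extend (M + t) (q t)" for t
    by (simp_all add: q_def)
  have prime: "prime_in (ring_at (M + t)) (q t)" for t
  proof (induction t)
    case 0
    show ?case
      using prime_in_Int [OF P ring_at_subset_full_ring ring_at_subring] by (simp add: q_0)
  next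
    case (Suc t)
    then show ?case using prime_in_extend [of "M + t" "q t"] by (simp add: q_Suc)
  qed
  have q_mono: "q t \<subseteq> q t'" if "t \<le> t'" for t t'
    using that by (rule lift_Suc_mono_le [of q, rotated]) (simp add: q_Suc subset_extend prime)
  have q_minimal: "q t \<subseteq> J" if "ideal_in full_ring J" "P \<inter> ring_at M \<subseteq> J" for J t
    by (induction t) (simp_all add: q_0 q_Suc that extend_minimal)
  define Q where "Q = (\<Union>t. q t)"
  have QP: "Q \<subseteq> P" unfolding Q_def using q_minimal [OF prime_inD(1) [OF P]] by blast
  have late: "\<exists>t. x \<in> ring_at (M + t)" if "x \<in> full_ring" for x
    using full_ring_cover [OF that] ring_at_mono le_add2 by (metis subsetD)
  have "prime_in full_ring Q"
    unfolding prime_in_def ideal_in_def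
  proof (intro conjI ballI impI)
    show "Q \<subseteq> full_ring" using QP ideal_inD(1) [OF prime_inD(1) [OF P]] by blast
    show "0 \<in> Q" unfolding Q_def using ideal_inD(2) [OF prime_inD(1) [OF prime]] by blast
    show "1 \<notin> Q" using QP prime_inD(2) [OF P] by blast
    show "x + y \<in> Q" if xy: "x \<in> Q" "y \<in> Q" for x y
    proof -
      obtain s t where "x \<in> q s" "y \<in> q t" using xy by (auto simp: Q_def)
      then have "x \<in> q (max s t)" "y \<in> q (max s t)" using q_mono [of s "max s t"] q_mono [of t "max s t"] by auto
      then show ?thesis unfolding Q_def using ideal_inD(3) [OF prime_inD(1) [OF prime]] by blast
    qed
    show "r * x \<in> Q" if r: "r \<in> full_ring" and x: "x \<in> Q" for r x
    proof -
      obtain s t where "r \<in> ring_at (M + s)" "x \<in> q t" using x late [OF r] by (auto simp: Q_def)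
      then have "r \<in> ring_at (M + max s t)" "x \<in> q (max s t)"
        using ring_at_mono [of "M + s" "M + max s t"] q_mono [of t "max s t"] by auto
      then show ?thesis unfolding Q_def using ideal_inD(4) [OF prime_inD(1) [OF prime]] by blast
    qed
    show "a \<in> Q \<or> b \<in> Q" if ab: "a \<in> full_ring" "b \<in> full_ring" "a * b \<in> Q" for a b
    proof -
      obtain s t u where "a \<in> ring_at (M + s)" "b \<in> ring_at (M + t)" "a * b \<in> q u"
        using late [OF ab(1)] late [OF ab(2)] ab(3) by (auto simp: Q_def)
      then have "a \<in> ring_at (M + (s + t + u))" "b \<in> ring_at (M + (s + t + u))" "a * b \<in> q (s + t + u)"
        using ring_at_mono [of "M + s" "M + (s + t + u)"] ring_at_mono [of "M + t" "M + (s + t + u)"]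
          q_mono [of u "s + t + u"] by auto
      then show ?thesis unfolding Q_def using prime_inD(3) [OF prime] by blast
    qed
  qed
  moreover have "P \<inter> ring_at M \<subseteq> Q" unfolding Q_def using q_0 by blast
  moreover have "ideal_in full_ring (lin_span full_ring (P \<inter> ring_at M))"
    using ideal_inD(1) [OF prime_inD(1) [OF P]] by (intro lin_span_ideal_in full_ring_subring) blast
  then have "Q \<subseteq> lin_span full_ring (P \<inter> ring_at M)"
    unfolding Q_def using q_minimal lin_span_base [OF full_ring_subring] by (meson UN_least subsetI)
  ultimately show thesis using QP that by blast
qed

theorem full_ring_noetherian: "noetherian_subring full_ring"
proof (rule cohen_noetherian [OF full_ring_subring])
  fix P assume P: "prime_in full_ring P"
  have "P \<inter> full_at 0 \<subseteq> full_at 0" by blast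
  then obtain F where F: "finite F" "F \<subseteq> P \<inter> full_at 0" "lin_span (full_at 0) (P \<inter> full_at 0) \<subseteq> lin_span (full_at 0) F"
    using noetherian_subring_finite_generators [OF full_at_noetherian] by metis
  have "F \<subseteq> full_ring" using F(2) full_at_subset_full_ring by blast
  with F(1) have "\<exists>M. F \<subseteq> ring_at M"
  proof (induction F rule: finite_induct)
    case (insert x F)
    then obtain i j where "F \<subseteq> ring_at i" "x \<in> ring_at j" using full_ring_cover by (metis insert_subset)
    then have "insert x F \<subseteq> ring_at (max i j)"
      using ring_at_mono [of i "max i j"] ring_at_mono [of j "max i j"] by auto
    then show ?case by blast
  qed simp
  then obtain M where M: "F \<subseteq> ring_at M" by blast
  obtain Q where Q: "prime_in full_ring Q" "P \<inter> ring_at M \<subseteq> Q"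
    "Q \<subseteq> lin_span full_ring (P \<inter> ring_at M)" "Q \<subseteq> P"
    using prime_extension_exists [OF P, of M] by blast
  have "lin_span (full_at 0) F \<subseteq> Q"
    using F(2) M Q(2) by (intro lin_span_minimal [OF prime_inD(1) [OF Q(1)] _ full_at_subset_full_ring]) blast
  moreover have "P \<inter> full_at 0 \<subseteq> lin_span (full_at 0) F"
    using F(3) lin_span_base [OF full_at_subring] by blast
  ultimately have "P = Q"
    by (intro incomparability [OF full_ring_subring full_at_subring full_at_subset_full_ring full_ring_algebraic Q(1) P Q(4)])
      blast+
  then have P_span: "P \<subseteq> lin_span full_ring (P \<inter> ring_at M)" using Q(3) by simp
  \<comment> \<open>The part of P in \<open>ring_at M\<close> generates P but may be infinite.
    Inside the Noetherian ring \<open>full_at M\<close> finitely many of its elements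
    suffice.\<close>
  have "P \<inter> ring_at M \<subseteq> full_at M" using ring_at_subset_full_at by blast
  then obtain E where E: "finite E" "E \<subseteq> P \<inter> ring_at M"
    "lin_span (full_at M) (P \<inter> ring_at M) \<subseteq> lin_span (full_at M) E"
    using noetherian_subring_finite_generators [OF full_at_noetherian] by metis
  have "P \<inter> ring_at M \<subseteq> lin_span (full_at M) E"
    using E(3) lin_span_base [OF full_at_subring] by blast
  also have "\<dots> \<subseteq> lin_span full_ring E"
    by (intro lin_span_mono full_at_subset_full_ring) simp
  finally have "lin_span full_ring (P \<inter> ring_at M) \<subseteq> lin_span full_ring E"
    by (intro lin_span_subset [OF full_ring_subring]) auto
  then show "fin_gen full_ring P"
    unfolding fin_gen_def using E(1,2) P_span by (intro exI [of _ E]) blast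
qed

end

section \<open>Restriction to a subgroup of \<open>\<rat>\<^sup>n\<close>\<close>

definition restrict_keys :: "'g set \<Rightarrow> ('g \<Rightarrow>\<^sub>0 'r::zero) \<Rightarrow> ('g \<Rightarrow>\<^sub>0 'r)" where
  "restrict_keys H = Poly_Mapping.mapp (\<lambda>g a. a when g \<in> H)"

lemma lookup_restrict_keys: "Poly_Mapping.lookup (restrict_keys H p) g = (Poly_Mapping.lookup p g when g \<in> H)"
  by (auto simp: restrict_keys_def lookup_mapp when_def in_keys_iff)

lemma restrict_keys_add: "restrict_keys H (p + q) = restrict_keys H p + restrict_keys H q"
  by (rule poly_mapping_eqI) (simp add: lookup_restrict_keys lookup_add when_def)

lemma restrict_keys_zero [simp]: "restrict_keys H 0 = 0"
  by (rule poly_mapping_eqI) (simp add: lookup_restrict_keys)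

lemma restrict_keys_single:
  "restrict_keys H (Poly_Mapping.single g a) = (if g \<in> H then Poly_Mapping.single g a else 0)"
  by (rule poly_mapping_eqI) (auto simp: lookup_restrict_keys lookup_single when_def)

lemma restrict_keys_id: "Poly_Mapping.keys p \<subseteq> H \<Longrightarrow> restrict_keys H p = p"
  by (rule poly_mapping_eqI) (auto simp: lookup_restrict_keys when_def in_keys_iff)

text \<open>Multiplication by an element supported on the subgroup H maps each coset of H to itself,
  so it commutes with discarding all other cosets.\<close>

lemma restrict_keys_mult:
  fixes p a :: "'g::ab_group_add \<Rightarrow>\<^sub>0 'r::comm_ring_1"
  assumes H: "\<And>g h. g \<in> H \<Longrightarrow> h \<in> H \<Longrightarrow> g + h \<in> H" "\<And>g h. g \<in> H \<Longrightarrow> h \<in> H \<Longrightarrow> g - h \<in> H"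
    and a: "Poly_Mapping.keys a \<subseteq> H"
  shows "restrict_keys H (p * a) = restrict_keys H p * a"
proof (induction p rule: poly_mapping_add_induct)
  case (single g c)
  show ?case
  proof (rule poly_mapping_eqI)
    fix h
    have "Poly_Mapping.lookup a (h - g) = 0" if "(h \<in> H) \<noteq> (g \<in> H)"
    proof (rule ccontr)
      assume "Poly_Mapping.lookup a (h - g) \<noteq> 0"
      then have "h - g \<in> H" using a by (auto simp: in_keys_iff)
      then show False using H(1) [of "h - g" g] H(2) [of h "h - g"] that by auto
    qed
    then show "Poly_Mapping.lookup (restrict_keys H (Poly_Mapping.single g c * a)) h =
        Poly_Mapping.lookup (restrict_keys H (Poly_Mapping.single g c) * a) h"
      by (auto simp: lookup_restrict_keys restrict_keys_single lookup_single_mult when_def)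
  qed
qed (simp_all add: restrict_keys_add distrib_right)

lemma keys_mult_subgroup:
  fixes p q :: "'g::ab_group_add \<Rightarrow>\<^sub>0 'r::comm_ring_1"
  assumes "\<And>g h. g \<in> H \<Longrightarrow> h \<in> H \<Longrightarrow> g + h \<in> H" "Poly_Mapping.keys p \<subseteq> H" "Poly_Mapping.keys q \<subseteq> H"
  shows "Poly_Mapping.keys (p * q) \<subseteq> H"
  using keys_mult [of p q] assms by blast

context cocycle_tower
begin

lemma den_dvd: "m \<le> m' \<Longrightarrow> den m j dvd den m' j"
  by (induction m' rule: dec_induct) (auto simp: dvd_mult)

text \<open>Every denominator of every coordinate is adjoined at some step, and afterwards
  \<open>den\<close> only grows in the order of divisibility.\<close>

lemma lat_cover:
  assumes v: "Poly_Mapping.keys v \<subseteq> {..<n}"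
  shows "\<exists>m. v \<in> lat m"
proof -
  have "\<exists>m. \<forall>m'\<ge>m. of_nat (den m' j) * Poly_Mapping.lookup v j \<in> \<int>" if j: "j < n" for j
  proof -
    obtain N :: nat where N: "N > 0" "\<And>M. N dvd M \<Longrightarrow> of_nat M * Poly_Mapping.lookup v j \<in> \<int>"
      by (rule rat_common_denominator [of "Poly_Mapping.lookup v j"]) blast
    \<comment> \<open>The step that adjoins an N-th root in coordinate j; \<open>expo\<close> adds
      back the 1 subtracted here.\<close>
    define m where "m = prod_encode (j, N - 1)"
    have "coord m = j" "expo m = N" using j N(1) by (simp_all add: m_def coord_def expo_def)
    then have "N dvd den (Suc m) j" by simp
    then have "N dvd den m' j" if "Suc m \<le> m'" for m' using den_dvd [OF that] dvd_trans by blast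
    then show ?thesis using N(2) by blast
  qed
  then obtain M where M: "\<And>j m'. j < n \<Longrightarrow> M j \<le> m' \<Longrightarrow> of_nat (den m' j) * Poly_Mapping.lookup v j \<in> \<int>"
    by metis
  have "of_nat (den (\<Sum>j<n. M j) j) * Poly_Mapping.lookup v j \<in> \<int>" for j
  proof (cases "j < n")
    case True
    then show ?thesis by (intro M member_le_sum) auto
  next
    case False
    then have "Poly_Mapping.lookup v j = 0" using v by (auto simp: in_keys_iff)
    then show ?thesis by simp
  qed
  then show ?thesis using v unfolding lat_def by blast
qed

lemma restrict_keys_full_ring:
  assumes "x \<in> full_ring"
  shows "restrict_keys H x \<in> full_ring"
proof -
  obtain m where "x \<in> full_at m" using assms by (auto simp: full_ring_def)
  then have "restrict_keys H x \<in> full_at m"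
  proof (induction rule: full_at_induct)
    case (gen c v)
    then show ?case
      using const_xmon_full_at [OF gen, of c] unital_subringD(2) [OF full_at_subring]
      by (simp add: xmon_def const_simps(6) restrict_keys_single)
  qed (auto simp: restrict_keys_add intro: unital_subringD [OF full_at_subring])
  then show ?thesis using full_at_subset_full_ring by blast
qed

lemma full_ring_subgroup_noetherian:
  assumes H: "0 \<in> H" "\<And>g h. g \<in> H \<Longrightarrow> h \<in> H \<Longrightarrow> g + h \<in> H" "\<And>g h. g \<in> H \<Longrightarrow> h \<in> H \<Longrightarrow> g - h \<in> H"
  shows "noetherian_subring {x \<in> full_ring. Poly_Mapping.keys x \<subseteq> H}" (is "noetherian_subring ?A")
proof (rule noetherian_subring_retract [OF full_ring_noetherian, where \<pi> = "restrict_keys H"])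
  show "unital_subring ?A"
    unfolding unital_subring_def
  proof (intro conjI ballI)
    show "1 \<in> ?A" using H(1) unital_subringD(1) [OF full_ring_subring] by simp
    fix x y assume xy: "x \<in> ?A" "y \<in> ?A"
    then show "x - y \<in> ?A"
      using unital_subringD(3) [OF full_ring_subring] keys_diff [of x y] by blast
    show "x * y \<in> ?A"
      using xy unital_subringD(4) [OF full_ring_subring] keys_mult_subgroup [OF H(2)] by blast
  qed
  show "restrict_keys H r \<in> ?A" if "r \<in> full_ring" for r
    using restrict_keys_full_ring [OF that] by (auto simp: in_keys_iff lookup_restrict_keys)
qed (auto simp: restrict_keys_add restrict_keys_id intro: restrict_keys_mult [OF H(2,3)])

text \<open>
  The cocycle of a subgroup of \<open>\<rat>\<^sup>n\<close> compares the scalars \<open>\<theta>\<close> of chosen elements of the full ring, one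
  in every degree.
\<close>

theorem noetherian_cocycle_exists:
  fixes f :: "'g::ab_group_add \<Rightarrow> nat \<Rightarrow>\<^sub>0 rat"
  assumes inj: "inj f" and add: "\<And>g h. f (g + h) = f g + f h" and keys: "\<And>g. Poly_Mapping.keys (f g) \<subseteq> {..<n}"
  shows "\<exists>\<phi> :: 'g \<Rightarrow> 'g \<Rightarrow> 'k. \<phi> \<in> Z2S kstar \<and> noetherian_ring (twisted_ring \<phi>)"
proof -
  \<comment> \<open>The least stage is a canonical choice of a scalar in degree \<open>f g\<close>.
    At later stages the scalar changes by a factor from k, which is what makes the cocycle take
    values in k and not merely in its algebraic closure.\<close>
  define first where "first g = (LEAST m. f g \<in> lat m)" for g
  define \<theta> where "\<theta> g = scal (first g) (f g)" for g
  have first: "f g \<in> lat (first g)" "f g \<in> lat m \<Longrightarrow> first g \<le> m" for g m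
    unfolding first_def using lat_cover [OF keys] by (auto intro: LeastI_ex Least_le)
  have \<theta>_nz: "\<theta> g \<noteq> 0" for g by (simp add: \<theta>_def scal_nonzero)
  have scal_\<theta>: "\<exists>c. c \<noteq> 0 \<and> scal m (f g) = to_ac c * \<theta> g" if "f g \<in> lat m" for g m
    unfolding \<theta>_def using scal_level [OF first(1) first(2) [OF that]] by blast
  have "\<exists>c. c \<noteq> 0 \<and> \<theta> g * \<theta> h = to_ac c * \<theta> (g + h)" for g h
  proof -
    define m where "m = max (first g) (first h)"
    have m: "f g \<in> lat m" "f h \<in> lat m"
      using first(1) lat_mono [of "first g" m] lat_mono [of "first h" m] by (auto simp: m_def)
    obtain a b c where abc: "a \<noteq> 0" "scal m (f g) = to_ac a * \<theta> g" "b \<noteq> 0" "scal m (f h) = to_ac b * \<theta> h"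
      "c \<noteq> 0" "scal m (f (g + h)) = to_ac c * \<theta> (g + h)"
      using scal_\<theta> [OF m(1)] scal_\<theta> [OF m(2)] scal_\<theta> [of "g + h" m] lat_add [OF m] by (metis add)
    have "(to_ac a * \<theta> g) * (to_ac b * \<theta> h) = to_ac c * \<theta> (g + h)"
      using scal_add [OF m] abc by (simp add: add)
    then have "\<theta> g * \<theta> h = to_ac (c / (a * b)) * \<theta> (g + h)"
      using abc(1,3) by (simp add: field_simps)
    then show ?thesis using abc(1,3,5) by (intro exI [of _ "c / (a * b)"]) simp
  qed
  then obtain \<phi> where \<phi>: "\<And>g h. \<phi> g h \<noteq> 0" "\<And>g h. \<theta> g * \<theta> h = to_ac (\<phi> g h) * \<theta> (g + h)" by metis
  \<comment> \<open>Associativity of the product of three scalars, read off in k because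
    \<open>to_ac\<close> is injective.\<close>
  have cocycle: "\<phi> g h * \<phi> f' (g + h) = \<phi> (f' + g) h * \<phi> f' g" for f' g h
  proof -
    have "to_ac (\<phi> g h * \<phi> f' (g + h)) * \<theta> (f' + (g + h)) = to_ac (\<phi> g h) * (\<theta> f' * \<theta> (g + h))"
      by (simp add: \<phi>(2) mult.assoc)
    also have "\<dots> = \<theta> f' * (\<theta> g * \<theta> h)" by (simp add: \<phi>(2) mult_ac)
    also have "\<dots> = (\<theta> f' * \<theta> g) * \<theta> h" by (simp only: mult.assoc)
    also have "\<dots> = to_ac (\<phi> f' g) * (\<theta> (f' + g) * \<theta> h)" by (simp only: \<phi>(2) mult.assoc)
    also have "\<dots> = to_ac (\<phi> (f' + g) h * \<phi> f' g) * \<theta> (f' + (g + h))"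
      unfolding \<phi>(2) [of "f' + g" h] by (simp add: add.assoc mult_ac)
    finally have "to_ac (\<phi> g h * \<phi> f' (g + h)) = to_ac (\<phi> (f' + g) h * \<phi> f' g)"
      unfolding mult_right_cancel [OF \<theta>_nz] .
    then show ?thesis by (simp only: to_ac_eq_iff)
  qed
  have \<phi>_Z: "\<phi> \<in> Z2S kstar"
    unfolding Z2S_def Z2_def
  proof (intro CollectI conjI allI)
    show "\<phi> g h \<in> carrier kstar" for g h by (simp add: \<phi>(1))
    show "\<phi> g h \<otimes>\<^bsub>kstar\<^esub> inv\<^bsub>kstar\<^esub> \<phi> (f' + g) h \<otimes>\<^bsub>kstar\<^esub> \<phi> f' (g + h) \<otimes>\<^bsub>kstar\<^esub> inv\<^bsub>kstar\<^esub> \<phi> f' g = \<one>\<^bsub>kstar\<^esub>" for f' g h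
      using cocycle [of g h f'] \<phi>(1) by (simp add: field_simps)
    show "\<phi> g h = \<phi> h g" for g h
    proof -
      have "to_ac (\<phi> g h) * \<theta> (g + h) = to_ac (\<phi> h g) * \<theta> (g + h)"
        using \<phi>(2) [of g h] \<phi>(2) [of h g] by (simp add: mult.commute add.commute)
      then show ?thesis using \<theta>_nz by simp
    qed
  qed
  \<comment> \<open>The linear map sending the basis element of degree g to the chosen element of
    degree \<open>f g\<close>. It identifies the twisted ring with the part of the full ring
    supported on the image of G.\<close>
  define \<Theta> where "\<Theta> p = (\<Sum>g\<in>Poly_Mapping.keys p. Poly_Mapping.single (f g) (to_ac (Poly_Mapping.lookup p g) * \<theta> g))"
    for p
  have \<Theta>_superset: "\<Theta> p = (\<Sum>g\<in>T. Poly_Mapping.single (f g) (to_ac (Poly_Mapping.lookup p g) * \<theta> g))"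
    if "finite T" "Poly_Mapping.keys p \<subseteq> T" for T p
    unfolding \<Theta>_def using that by (intro sum.mono_neutral_left) (auto simp: in_keys_iff)
  have \<Theta>_add: "\<Theta> (p + q) = \<Theta> p + \<Theta> q" for p q
  proof -
    let ?T = "Poly_Mapping.keys p \<union> Poly_Mapping.keys q"
    have "Poly_Mapping.keys (p + q) \<subseteq> ?T" by (rule keys_add)
    then show ?thesis
      by (simp add: \<Theta>_superset [of ?T] lookup_add distrib_right single_add sum.distrib)
  qed
  have \<Theta>_single: "\<Theta> (Poly_Mapping.single g a) = Poly_Mapping.single (f g) (to_ac a * \<theta> g)" for g a
    by (subst \<Theta>_superset [of "{g}"]) auto
  have \<Theta>_0: "\<Theta> 0 = 0" by (simp add: \<Theta>_def)
  have \<Theta>_mult: "\<Theta> (twisted_mult \<phi> p q) = \<Theta> p * \<Theta> q" for p q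
  proof (induction p rule: poly_mapping_add_induct)
    case single: (single g a)
    show ?case
    proof (induction q rule: poly_mapping_add_induct)
      case (single h b)
      have "to_ac a * \<theta> g * (to_ac b * \<theta> h) = to_ac a * to_ac b * (\<theta> g * \<theta> h)" by (simp add: mult_ac)
      also have "\<dots> = to_ac (a * b * \<phi> g h) * \<theta> (g + h)" by (simp add: \<phi>(2) mult.assoc)
      finally show ?case by (simp only: \<Theta>_single twisted_mult_single mult_single add)
    qed (simp_all add: twisted_mult_add_right \<Theta>_add \<Theta>_0 distrib_left)
  qed (simp_all add: twisted_mult_add_left \<Theta>_add \<Theta>_0 distrib_right)
  have lookup_\<Theta>: "Poly_Mapping.lookup (\<Theta> p) (f g) = to_ac (Poly_Mapping.lookup p g) * \<theta> g" for p g
  proof (induction p rule: poly_mapping_add_induct)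
    case (single h a)
    then show ?case by (simp add: \<Theta>_single lookup_single when_def inj_eq [OF inj])
  qed (simp_all add: \<Theta>_0 \<Theta>_add lookup_add distrib_right)
  have \<Theta>_inj: "inj \<Theta>"
  proof (rule injI)
    fix p q assume pq: "\<Theta> p = \<Theta> q"
    show "p = q"
    proof (rule poly_mapping_eqI)
      fix g
      show "Poly_Mapping.lookup p g = Poly_Mapping.lookup q g"
        using lookup_\<Theta> [of p g] lookup_\<Theta> [of q g] \<theta>_nz [of g] pq by simp
    qed
  qed
  let ?A = "{x \<in> full_ring. Poly_Mapping.keys x \<subseteq> range f}"
  have f0: "f 0 = 0" using add [of 0 0] by simp
  have f_diff: "f (g - h) = f g - f h" for g h using add [of "g - h" h] by simp
  have A: "noetherian_subring ?A"
  proof (rule full_ring_subgroup_noetherian)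
    show "0 \<in> range f" using f0 by (metis rangeI)
  qed (auto simp flip: add f_diff)
  then have A': "unital_subring ?A" by (simp add: noetherian_subring_def)
  have "range \<Theta> = ?A"
  proof (intro equalityI subsetI)
    fix x assume "x \<in> range \<Theta>"
    then obtain p where p: "x = \<Theta> p" by blast
    show "x \<in> ?A"
      unfolding p \<Theta>_def
    proof (rule unital_subring_sum [OF A'])
      fix g
      have "Poly_Mapping.single (f g) (to_ac (Poly_Mapping.lookup p g) * \<theta> g) =
          const (Poly_Mapping.lookup p g) * xmon (first g) (f g)"
        by (simp add: xmon_def const_simps(6) \<theta>_def)
      also have "\<dots> \<in> full_ring"
        using const_xmon_full_at [OF first(1)] full_at_subset_full_ring by blast
      finally show "Poly_Mapping.single (f g) (to_ac (Poly_Mapping.lookup p g) * \<theta> g) \<in> ?A" by simp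
    qed
  next
    fix x assume x: "x \<in> ?A"
    then obtain m where m: "x \<in> ring_at m" using full_ring_cover by blast
    have "\<exists>c. Poly_Mapping.lookup x (f g) = to_ac c * \<theta> g" for g
    proof (cases "f g \<in> lat m")
      case True
      obtain a where "Poly_Mapping.lookup x (f g) = to_ac a * scal m (f g)" using ring_at_lookup(2) [OF m True] by blast
      moreover obtain b where "scal m (f g) = to_ac b * \<theta> g" using scal_\<theta> [OF True] by blast
      ultimately show ?thesis by (intro exI [of _ "a * b"]) (simp add: mult.assoc)
    next
      case False
      then show ?thesis using ring_at_lookup(1) [OF m] by (intro exI [of _ 0]) simp
    qed
    then obtain c where c: "\<And>g. Poly_Mapping.lookup x (f g) = to_ac (c g) * \<theta> g" by metis
    have fin: "finite (f -` Poly_Mapping.keys x)" using inj by (intro finite_vimageI) auto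
    define p where "p = (\<Sum>g\<in>f -` Poly_Mapping.keys x. Poly_Mapping.single g (c g))"
    have lookup_p: "to_ac (Poly_Mapping.lookup p g) * \<theta> g = Poly_Mapping.lookup x (f g)" for g
    proof -
      have "Poly_Mapping.lookup p g = (c g when f g \<in> Poly_Mapping.keys x)"
        using fin by (simp add: p_def lookup_sum lookup_single when_def)
      then show ?thesis using c [of g] by (auto simp: when_def in_keys_iff)
    qed
    have "\<Theta> p = x"
    proof (rule poly_mapping_eqI)
      fix v
      show "Poly_Mapping.lookup (\<Theta> p) v = Poly_Mapping.lookup x v"
      proof (cases "v \<in> range f")
        case True
        then show ?thesis using lookup_\<Theta> lookup_p by auto
      next
        case False
        then have "Poly_Mapping.lookup x v = 0" using x by (auto simp: in_keys_iff)
        moreover have "Poly_Mapping.lookup (\<Theta> p) v = 0"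
          unfolding \<Theta>_def lookup_sum using False by (intro sum.neutral) (auto simp: lookup_single when_def)
        ultimately show ?thesis by simp
      qed
    qed
    then show "x \<in> range \<Theta>" by blast
  qed
  then have "noetherian_subring (\<Theta> ` carrier (twisted_ring \<phi>))" using A by (simp add: twisted_ring_def)
  moreover have "ring (twisted_ring \<phi>)" by (rule cring.axioms(1) [OF twisted_ring_cring [OF \<phi>_Z]])
  ultimately have "noetherian_ring (twisted_ring \<phi>)"
    using \<Theta>_inj by (intro noetherian_ring_embedding [where h = \<Theta>]) (auto simp: twisted_ring_def \<Theta>_add \<Theta>_mult)
  then show ?thesis using \<phi>_Z by blast
qed

end

lemma noetherian_class_exists:
  assumes "torsion_free TYPE('g::ab_group_add)" and "finite_rank TYPE('g)"
    and "purely_transcendental_over (k\<^sub>0 :: 'k::field set) \<alpha>"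
  shows "\<exists>c \<in> carrier (H2S kstar :: ('g \<Rightarrow> 'g \<Rightarrow> 'k) set monoid). noetherian_class c"
proof -
  obtain n and f :: "'g \<Rightarrow> nat \<Rightarrow>\<^sub>0 rat" where f: "inj f" "\<And>g h. f (g + h) = f g + f h"
    "\<And>g. Poly_Mapping.keys (f g) \<subseteq> {..<n}"
    by (rule finite_rank_coordinates [OF assms(1,2)]) blast
  \<comment> \<open>The extra coordinate keeps the dimension positive when the group has rank
    0.\<close>
  interpret cocycle_tower k\<^sub>0 \<alpha> "Suc n"
    by unfold_locales (use assms(3) in auto)
  have "Poly_Mapping.keys (f g) \<subseteq> {..<Suc n}" for g using f(3) [of g] by auto
  then obtain \<phi> :: "'g \<Rightarrow> 'g \<Rightarrow> 'k" where "\<phi> \<in> Z2S kstar" "noetherian_ring (twisted_ring \<phi>)"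
    using noetherian_cocycle_exists [OF f(1,2)] by blast
  then show ?thesis by (rule noetherian_class_of_cocycle)
qed

theorem proposition6p2:
  assumes "torsion_free TYPE('g::ab_group_add)" and "finite_rank TYPE('g)"
  shows
    "(finite_free TYPE('g) \<longrightarrow>
        carrier (H2S kstar :: ('g \<Rightarrow> 'g \<Rightarrow> 'k::field) set monoid) = {\<one>\<^bsub>H2S kstar\<^esub>} \<and>
        noetherian_class (\<one>\<^bsub>H2S kstar\<^esub> :: ('g \<Rightarrow> 'g \<Rightarrow> 'k) set)) \<and>
     (\<not> finitely_generated TYPE('g) \<longrightarrow>
        \<not> noetherian_class (\<one>\<^bsub>H2S kstar\<^esub> :: ('g \<Rightarrow> 'g \<Rightarrow> 'k) set)) \<and>
     (\<forall>(k\<^sub>0 :: 'k set) (\<alpha> :: nat \<Rightarrow> 'k).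
        purely_transcendental_over k\<^sub>0 \<alpha> \<and> CHAR('k) = 0 \<longrightarrow>
          (\<exists>c \<in> carrier (H2S kstar :: ('g \<Rightarrow> 'g \<Rightarrow> 'k) set monoid). noetherian_class c) \<and>
          (\<not> finite_free TYPE('g) \<longrightarrow>
             (\<forall>c \<in> carrier (H2S kstar :: ('g \<Rightarrow> 'g \<Rightarrow> 'k) set monoid).
                noetherian_class c \<longrightarrow> c \<noteq> \<one>\<^bsub>H2S kstar\<^esub>)))"
proof -
  have "noetherian_class (\<one>\<^bsub>H2S kstar\<^esub> :: ('g \<Rightarrow> 'g \<Rightarrow> 'k) set)" if "finitely_generated TYPE('g)"
    unfolding noetherian_class_one_iff using that by (rule noetherian_group_ring)
  moreover have "finitely_generated TYPE('g)" if "noetherian_class (\<one>\<^bsub>H2S kstar\<^esub> :: ('g \<Rightarrow> 'g \<Rightarrow> 'k) set)"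
    using that unfolding noetherian_class_one_iff by (rule noetherian_group_ring_imp_finitely_generated)
  \<comment> \<open>This equivalence carries the exclusion of the zero class from groups that are
    not finitely generated to groups that are not finite free.\<close>
  moreover have "finite_free TYPE('g) \<longleftrightarrow> finitely_generated TYPE('g)"
    using finite_free_imp_finitely_generated finitely_generated_imp_finite_free [OF assms(1)] by blast
  moreover have "carrier (H2S kstar :: ('g \<Rightarrow> 'g \<Rightarrow> 'k) set monoid) = {\<one>\<^bsub>H2S kstar\<^esub>}"
    if "finite_free TYPE('g)"
    using that by (rule finite_free_H2S)
  moreover have "\<exists>c \<in> carrier (H2S kstar :: ('g \<Rightarrow> 'g \<Rightarrow> 'k) set monoid). noetherian_class c"
    if "purely_transcendental_over k\<^sub>0 \<alpha>" for k\<^sub>0 :: "'k set" and \<alpha>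
    using assms that by (rule noetherian_class_exists)
  ultimately show ?thesis by metis
qed

end
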